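(* Let $\pi:E\to M$ be a smooth vector bundle of rank $k$ over an $n$-dimensional manifold $M$ that admits a finite atlas of $m$ local trivializations: $M=U_1\cup\dots\cup U_m$ with each $U_i$ open, diffeomorphisms $\varphi_i:U_i\to\mathbb{R}^n$, and fibrewise diffeomorphisms $\psi_i:\pi^{-1}(U_i)\to U_i\times\mathbb{R}^k$, with transition functions $g_{ij}:U_i\cap U_j\to\mathrm{GL}_k(\mathbb{R})$. Then $\pi$ is (as a diffeological vector pseudo-bundle, $E$ and $M$ carrying their standard diffeologies) the result of gluing of the $m$ diffeological vector pseudo-bundles $\pi_i:\mathbb{R}^{n+k}\to\mathbb{R}^n$ (standard diffeologies), where $$\pi_i=\varphi_i\circ\pi\circ\psi_i^{-1}\circ(\varphi_i^{-1}\times\mathrm{Id}_{\mathbb{R}^k})\quad\text{for }i=1,\dots,m,$$ and the gluing $(\tilde f_{ij},f_{ij})$ between $\pi_i$ and $\pi_j$ is given by the maps $$f_{ij}=\varphi_j\circ(\varphi_i|_{U_i\cap U_j})^{-1},\qquad \tilde f_{ij}(y,v)=\bigl(f_{ij}(y),\,g_{ij}(\varphi_i^{-1}(y))v\bigr),$$ for $y\in\varphi_i(U_i\cap U_j)$ and $(y,v)\in\pi_i^{-1}(y)=\{y\}\times\mathbb{R}^k$.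
   Context: A diffeological space is a set $X$ with a collection of maps (plots) $U\to X$, $U$ open in some $\mathbb{R}^d$, containing constant maps, closed under precomposition with usual smooth maps, and satisfying the sheaf condition. The standard diffeology of a smooth manifold consists of all usual smooth maps from such $U$ into it. A map is smooth if it carries plots to plots; a diffeomorphism is a smooth bijection with smooth inverse. A quotient carries the quotient diffeology (maps locally lifting to plots), a disjoint union the disjoint union diffeology (maps locally equal to plots of one component). A diffeological vector pseudo-bundle is a smooth surjection $\pi:V\to X$ with real vector space structures on fibres such that fibrewise addition $V\times_XV\to V$, scalar multiplication $\mathbb{R}\times V\to V$ and the zero section are smooth. An isomorphism of pseudo-bundles is a pair of diffeomorphisms of total spaces and bases commuting with the projections and linear on fibres. The transition functions are defined by $\psi_j\circ\psi_i^{-1}(x,v)=(x,g_{ij}(x)v)$ for $x\in U_i\cap U_j$, $v\in\mathbb{R}^k$. The gluing of two diffeological spaces $X_1,X_2$ along a smooth $f:X_1\supset Y\to X_2$ is $X_1\cup_fX_2=(X_1\sqcup X_2)/(y\sim f(y))$ with the quotient diffeology of the disjoint union diffeology; two pseudo-bundles are glued by gluing bases along $f$ and total spaces along a smooth fibrewise linear lift $\tilde f$ of $f$. The result of gluing the $m$ pseudo-bundles $\pi_i$ along all pairs $(\tilde f_{ij},f_{ij})$ is the pseudo-bundle whose total space is the quotient of $\bigsqcup_{i=1}^m\mathbb{R}^{n+k}$ by all identifications $w\sim\tilde f_{ij}(w)$, whose base is the quotient of $\bigsqcup_{i=1}^m\mathbb{R}^n$ by all identifications $y\sim f_{ij}(y)$,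 both with quotient diffeologies, and whose projection is induced by the $\pi_i$. Saying that $\pi$ "is" this result means that the two are isomorphic as diffeological vector pseudo-bundles. *)

theory Defs
  imports "HOL-Analysis.Abstract_Euclidean_Space"
    "HOL-Analysis.T1_Spaces"
    "HOL-Analysis.Abstract_Topological_Spaces"
    "Jordan_Normal_Form.Matrix"
begin

section \<open>Usual smoothness\<close>

text \<open>The dimension of the domain of a plot is not bounded, so it cannot be a type. Throughout,
  \<open>\<real>\<^sup>d\<close> is the library space \<^const>\<open>Euclidean_space\<close> \<open>d\<close>, i.e. the sequences
  \<open>nat \<Rightarrow> real\<close> that vanish from index \<open>d\<close> on, with the Euclidean topology. Maps are total
  HOL functions of which only the values on the stated domain matter.\<close>

type_synonym rvec = "nat \<Rightarrow> real"

abbreviation Rn :: "nat \<Rightarrow> rvec set"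
  where "Rn d \<equiv> topspace (Euclidean_space d)"

text \<open>\<open>Ck d U r g\<close>: all partial derivatives of \<open>g\<close> of order at most \<open>r\<close> exist and are continuous
  on the open set \<open>U\<close> of \<open>\<real>\<^sup>d\<close>; \<open>g'\<close> below is the \<open>i\<close>-th partial derivative.\<close>

primrec Ck :: "nat \<Rightarrow> rvec set \<Rightarrow> nat \<Rightarrow> (rvec \<Rightarrow> real) \<Rightarrow> bool" where
  "Ck d U 0 g \<longleftrightarrow> continuous_map (subtopology (Euclidean_space d) U) euclideanreal g"
| "Ck d U (Suc r) g \<longleftrightarrow>
     continuous_map (subtopology (Euclidean_space d) U) euclideanreal g \<and>
     (\<forall>i<d. \<exists>g'. (\<forall>x\<in>U. ((\<lambda>t. g (x(i := t))) has_real_derivative g' x) (at (x i))) \<and> Ck d U r g')"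

definition smooth_fun :: "nat \<Rightarrow> rvec set \<Rightarrow> (rvec \<Rightarrow> real) \<Rightarrow> bool" where
  "smooth_fun d U g \<longleftrightarrow> openin (Euclidean_space d) U \<and> (\<forall>r. Ck d U r g)"

definition smooth_on :: "nat \<Rightarrow> rvec set \<Rightarrow> nat \<Rightarrow> (rvec \<Rightarrow> rvec) \<Rightarrow> bool" where
  "smooth_on d U e f \<longleftrightarrow>
     openin (Euclidean_space d) U \<and> f ` U \<subseteq> Rn e \<and> (\<forall>j<e. smooth_fun d U (\<lambda>x. f x j))"

text \<open>The identification \<open>\<real>\<^sup>n \<times> \<real>\<^sup>k = \<real>\<^sup>n\<^sup>+\<^sup>k\<close> and its two projections.\<close>

definition juxt :: "nat \<Rightarrow> rvec \<Rightarrow> rvec \<Rightarrow> rvec" where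
  "juxt n y v = (\<lambda>i. if i < n then y i else v (i - n))"

definition hd_part :: "nat \<Rightarrow> rvec \<Rightarrow> rvec" where
  "hd_part n w = (\<lambda>i. if i < n then w i else 0)"

definition tl_part :: "nat \<Rightarrow> rvec \<Rightarrow> rvec" where
  "tl_part n w = (\<lambda>i. w (n + i))"

definition GL :: "nat \<Rightarrow> real mat set" where
  "GL k = {A \<in> carrier_mat k k. invertible_mat A}"

text \<open>The action of a \<open>k \<times> k\<close> matrix on \<open>\<real>\<^sup>k\<close>.\<close>

definition mat_act :: "nat \<Rightarrow> real mat \<Rightarrow> rvec \<Rightarrow> rvec" where
  "mat_act k A v = (\<lambda>a. if a < k then vec_index (mult_mat_vec A (Matrix.vec k v)) a else 0)"


section \<open>Smooth manifolds and vector bundles\<close>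

text \<open>The smooth structure is given by an atlas that need not be maximal. A chart is a pair of its
  domain and its coordinate map.\<close>

record 'a mfd =
  mdim :: nat
  mtop :: "'a topology"
  atlas :: "('a set \<times> ('a \<Rightarrow> rvec)) set"

abbreviation mset_of :: "'a mfd \<Rightarrow> 'a set"
  where "mset_of M \<equiv> topspace (mtop M)"

definition smooth_manifold :: "'a mfd \<Rightarrow> bool" where
  "smooth_manifold M \<longleftrightarrow>
     Hausdorff_space (mtop M) \<and> second_countable (mtop M) \<and>
     (\<Union>(U, \<phi>)\<in>atlas M. U) = mset_of M \<and>
     (\<forall>(U, \<phi>)\<in>atlas M.
        openin (mtop M) U \<and> openin (Euclidean_space (mdim M)) (\<phi> ` U) \<and>
        homeomorphic_map (subtopology (mtop M) U)
          (subtopology (Euclidean_space (mdim M)) (\<phi> ` U)) \<phi>) \<and>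
     (\<forall>(U, \<phi>)\<in>atlas M. \<forall>(V, \<psi>)\<in>atlas M.
        smooth_on (mdim M) (\<phi> ` (U \<inter> V)) (mdim M) (\<psi> \<circ> inv_into U \<phi>))"

definition smooth_map :: "'a mfd \<Rightarrow> 'b mfd \<Rightarrow> ('a \<Rightarrow> 'b) \<Rightarrow> bool" where
  "smooth_map M N F \<longleftrightarrow>
     continuous_map (mtop M) (mtop N) F \<and>
     (\<forall>(U, \<phi>)\<in>atlas M. \<forall>(V, \<psi>)\<in>atlas N.
        smooth_on (mdim M) (\<phi> ` (U \<inter> F -` V)) (mdim N) (\<psi> \<circ> F \<circ> inv_into U \<phi>))"

definition mfd_diffeo :: "'a mfd \<Rightarrow> 'b mfd \<Rightarrow> ('a \<Rightarrow> 'b) \<Rightarrow> bool" where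
  "mfd_diffeo M N F \<longleftrightarrow>
     bij_betw F (mset_of M) (mset_of N) \<and> smooth_map M N F \<and>
     smooth_map N M (inv_into (mset_of M) F)"

definition euclid_mfd :: "nat \<Rightarrow> rvec mfd" where
  "euclid_mfd d = \<lparr>mdim = d, mtop = Euclidean_space d, atlas = {(Rn d, id)}\<rparr>"

definition open_submfd :: "'a mfd \<Rightarrow> 'a set \<Rightarrow> 'a mfd" where
  "open_submfd M W =
     \<lparr>mdim = mdim M, mtop = subtopology (mtop M) W,
      atlas = {(U \<inter> W, \<phi>) |U \<phi>. (U, \<phi>) \<in> atlas M}\<rparr>"

definition prod_mfd :: "'a mfd \<Rightarrow> 'b mfd \<Rightarrow> ('a \<times> 'b) mfd" where
  "prod_mfd M N =
     \<lparr>mdim = mdim M + mdim N, mtop = prod_topology (mtop M) (mtop N),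
      atlas = {(U \<times> V, \<lambda>(x, y). juxt (mdim M) (\<phi> x) (\<psi> y)) |U \<phi> V \<psi>.
                 (U, \<phi>) \<in> atlas M \<and> (V, \<psi>) \<in> atlas N}\<rparr>"

definition real_vector_space_on ::
  "'v set \<Rightarrow> ('v \<Rightarrow> 'v \<Rightarrow> 'v) \<Rightarrow> (real \<Rightarrow> 'v \<Rightarrow> 'v) \<Rightarrow> 'v \<Rightarrow> bool" where
  "real_vector_space_on S pls scl zer \<longleftrightarrow>
     zer \<in> S \<and> (\<forall>u\<in>S. \<forall>v\<in>S. pls u v \<in> S) \<and> (\<forall>r. \<forall>v\<in>S. scl r v \<in> S) \<and>
     (\<forall>u\<in>S. \<forall>v\<in>S. \<forall>w\<in>S. pls (pls u v) w = pls u (pls v w)) \<and>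
     (\<forall>u\<in>S. \<forall>v\<in>S. pls u v = pls v u) \<and>
     (\<forall>v\<in>S. pls zer v = v) \<and> (\<forall>v\<in>S. \<exists>w\<in>S. pls v w = zer) \<and>
     (\<forall>r. \<forall>u\<in>S. \<forall>v\<in>S. scl r (pls u v) = pls (scl r u) (scl r v)) \<and>
     (\<forall>r s. \<forall>v\<in>S. scl (r + s) v = pls (scl r v) (scl s v)) \<and>
     (\<forall>r s. \<forall>v\<in>S. scl (r * s) v = scl r (scl s v)) \<and>
     (\<forall>v\<in>S. scl 1 v = v)"

text \<open>The operations \<open>pls\<close>, \<open>scl\<close> on \<open>E\<close> carry the vector space structures of all the fibres at once;
  \<open>pls u v\<close> is only meaningful for \<open>u\<close>, \<open>v\<close> in the same fibre, and \<open>zer x\<close> is the zero of the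
  fibre over \<open>x\<close>.\<close>

definition local_triv ::
  "nat \<Rightarrow> 'e mfd \<Rightarrow> 'b mfd \<Rightarrow> ('e \<Rightarrow> 'b) \<Rightarrow> ('e \<Rightarrow> 'e \<Rightarrow> 'e) \<Rightarrow> (real \<Rightarrow> 'e \<Rightarrow> 'e) \<Rightarrow>
   'b set \<Rightarrow> ('e \<Rightarrow> 'b \<times> rvec) \<Rightarrow> bool" where
  "local_triv k E M \<pi> pls scl U \<psi> \<longleftrightarrow>
     openin (mtop M) U \<and>
     mfd_diffeo (open_submfd E (mset_of E \<inter> \<pi> -` U)) (prod_mfd (open_submfd M U) (euclid_mfd k)) \<psi> \<and>
     (\<forall>u \<in> mset_of E \<inter> \<pi> -` U. fst (\<psi> u) = \<pi> u) \<and>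
     (\<forall>u \<in> mset_of E \<inter> \<pi> -` U. \<forall>v \<in> mset_of E. \<pi> v = \<pi> u \<longrightarrow>
        snd (\<psi> (pls u v)) = (\<lambda>a. snd (\<psi> u) a + snd (\<psi> v) a)) \<and>
     (\<forall>r. \<forall>u \<in> mset_of E \<inter> \<pi> -` U. snd (\<psi> (scl r u)) = (\<lambda>a. r * snd (\<psi> u) a))"

definition smooth_vector_bundle ::
  "nat \<Rightarrow> 'e mfd \<Rightarrow> 'b mfd \<Rightarrow> ('e \<Rightarrow> 'b) \<Rightarrow> ('e \<Rightarrow> 'e \<Rightarrow> 'e) \<Rightarrow> (real \<Rightarrow> 'e \<Rightarrow> 'e) \<Rightarrow>
   ('b \<Rightarrow> 'e) \<Rightarrow> bool" where
  "smooth_vector_bundle k E M \<pi> pls scl zer \<longleftrightarrow>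
     smooth_manifold E \<and> smooth_manifold M \<and> smooth_map E M \<pi> \<and> \<pi> ` mset_of E = mset_of M \<and>
     (\<forall>x \<in> mset_of M. real_vector_space_on {u \<in> mset_of E. \<pi> u = x} pls scl (zer x)) \<and>
     (\<forall>x \<in> mset_of M. \<exists>U \<psi>. x \<in> U \<and> local_triv k E M \<pi> pls scl U \<psi>)"


section \<open>Diffeological spaces\<close>

text \<open>\<open>plot X d U p\<close>: the restriction of \<open>p\<close> to the open set \<open>U\<close> of \<open>\<real>\<^sup>d\<close> is a plot of \<open>X\<close>.\<close>

record 'a dspace =
  points :: "'a set"
  plot :: "nat \<Rightarrow> rvec set \<Rightarrow> (rvec \<Rightarrow> 'a) \<Rightarrow> bool"

text \<open>The second conjunct only expresses that the values of \<open>p\<close> outside \<open>U\<close> are irrelevant.\<close>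

definition diffeological_space :: "'a dspace \<Rightarrow> bool" where
  "diffeological_space X \<longleftrightarrow>
     (\<forall>d U p. plot X d U p \<longrightarrow> openin (Euclidean_space d) U \<and> p ` U \<subseteq> points X) \<and>
     (\<forall>d U p q. plot X d U p \<and> (\<forall>x\<in>U. q x = p x) \<longrightarrow> plot X d U q) \<and>
     (\<forall>d U. \<forall>c \<in> points X. openin (Euclidean_space d) U \<longrightarrow> plot X d U (\<lambda>_. c)) \<and>
     (\<forall>d U p e V h. plot X d U p \<and> smooth_on e V d h \<and> h ` V \<subseteq> U \<longrightarrow> plot X e V (p \<circ> h)) \<and>
     (\<forall>d U p. openin (Euclidean_space d) U \<and>
        (\<forall>x\<in>U. \<exists>V. openin (Euclidean_space d) V \<and> x \<in> V \<and> V \<subseteq> U \<and> plot X d V p) \<longrightarrow>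
        plot X d U p)"

definition dsmooth :: "'a dspace \<Rightarrow> 'b dspace \<Rightarrow> ('a \<Rightarrow> 'b) \<Rightarrow> bool" where
  "dsmooth X Y F \<longleftrightarrow>
     F ` points X \<subseteq> points Y \<and> (\<forall>d U p. plot X d U p \<longrightarrow> plot Y d U (F \<circ> p))"

definition ddiffeo :: "'a dspace \<Rightarrow> 'b dspace \<Rightarrow> ('a \<Rightarrow> 'b) \<Rightarrow> bool" where
  "ddiffeo X Y F \<longleftrightarrow>
     bij_betw F (points X) (points Y) \<and> dsmooth X Y F \<and> dsmooth Y X (inv_into (points X) F)"

definition std_dspace :: "'a mfd \<Rightarrow> 'a dspace" where
  "std_dspace M =
     \<lparr>points = mset_of M,
      plot = \<lambda>d U p. openin (Euclidean_space d) U \<and> smooth_map (open_submfd (euclid_mfd d) U) M p\<rparr>"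

definition real_dspace :: "real dspace" where
  "real_dspace = \<lparr>points = UNIV, plot = smooth_fun\<rparr>"

definition sub_dspace :: "'a dspace \<Rightarrow> 'a set \<Rightarrow> 'a dspace" where
  "sub_dspace X S =
     \<lparr>points = points X \<inter> S, plot = \<lambda>d U p. plot X d U p \<and> p ` U \<subseteq> S\<rparr>"

definition prod_dspace :: "'a dspace \<Rightarrow> 'b dspace \<Rightarrow> ('a \<times> 'b) dspace" where
  "prod_dspace X Y =
     \<lparr>points = points X \<times> points Y,
      plot = \<lambda>d U p. plot X d U (fst \<circ> p) \<and> plot Y d U (snd \<circ> p)\<rparr>"

definition disjoint_union_dspace :: "'i set \<Rightarrow> ('i \<Rightarrow> 'a dspace) \<Rightarrow> ('i \<times> 'a) dspace" where
  "disjoint_union_dspace I X =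
     \<lparr>points = (SIGMA i:I. points (X i)),
      plot = \<lambda>d U p. openin (Euclidean_space d) U \<and>
        (\<forall>x\<in>U. \<exists>V i q. x \<in> V \<and> V \<subseteq> U \<and> i \<in> I \<and> plot (X i) d V q \<and> (\<forall>y\<in>V. p y = (i, q y)))\<rparr>"

definition quot_dspace :: "'a dspace \<Rightarrow> ('a \<times> 'a) set \<Rightarrow> 'a set dspace" where
  "quot_dspace X R =
     \<lparr>points = points X // R,
      plot = \<lambda>d U p. openin (Euclidean_space d) U \<and>
        (\<forall>x\<in>U. \<exists>V q. x \<in> V \<and> V \<subseteq> U \<and> plot X d V q \<and> (\<forall>y\<in>V. p y = R `` {q y}))\<rparr>"


section \<open>Diffeological vector pseudo-bundles\<close>

text \<open>As for vector bundles, \<open>fib_add\<close>, \<open>fib_scale\<close>, \<open>fib_zero\<close> carry the vector space structures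
  of all fibres at once.\<close>

record ('e, 'b) pbundle =
  total :: "'e dspace"
  base :: "'b dspace"
  proj :: "'e \<Rightarrow> 'b"
  fib_add :: "'e \<Rightarrow> 'e \<Rightarrow> 'e"
  fib_scale :: "real \<Rightarrow> 'e \<Rightarrow> 'e"
  fib_zero :: "'b \<Rightarrow> 'e"

definition pseudo_bundle :: "('e, 'b) pbundle \<Rightarrow> bool" where
  "pseudo_bundle P \<longleftrightarrow>
     diffeological_space (total P) \<and> diffeological_space (base P) \<and>
     dsmooth (total P) (base P) (proj P) \<and> proj P ` points (total P) = points (base P) \<and>
     (\<forall>x \<in> points (base P).
        real_vector_space_on {v \<in> points (total P). proj P v = x}
          (fib_add P) (fib_scale P) (fib_zero P x)) \<and>
     dsmooth (sub_dspace (prod_dspace (total P) (total P)) {(u, v). proj P u = proj P v})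
       (total P) (\<lambda>(u, v). fib_add P u v) \<and>
     dsmooth (prod_dspace real_dspace (total P)) (total P) (\<lambda>(r, v). fib_scale P r v) \<and>
     dsmooth (base P) (total P) (fib_zero P)"

definition pbundle_iso ::
  "('e, 'b) pbundle \<Rightarrow> ('f, 'c) pbundle \<Rightarrow> ('e \<Rightarrow> 'f) \<Rightarrow> ('b \<Rightarrow> 'c) \<Rightarrow> bool" where
  "pbundle_iso P Q F f \<longleftrightarrow>
     ddiffeo (total P) (total Q) F \<and> ddiffeo (base P) (base Q) f \<and>
     (\<forall>v \<in> points (total P). proj Q (F v) = f (proj P v)) \<and>
     (\<forall>u \<in> points (total P). \<forall>v \<in> points (total P). proj P u = proj P v \<longrightarrow>
        F (fib_add P u v) = fib_add Q (F u) (F v)) \<and>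
     (\<forall>r. \<forall>v \<in> points (total P). F (fib_scale P r v) = fib_scale Q r (F v))"

definition pbundles_isomorphic :: "('e, 'b) pbundle \<Rightarrow> ('f, 'c) pbundle \<Rightarrow> bool" where
  "pbundles_isomorphic P Q \<longleftrightarrow> (\<exists>F f. pbundle_iso P Q F f)"

definition std_pbundle ::
  "'e mfd \<Rightarrow> 'b mfd \<Rightarrow> ('e \<Rightarrow> 'b) \<Rightarrow> ('e \<Rightarrow> 'e \<Rightarrow> 'e) \<Rightarrow> (real \<Rightarrow> 'e \<Rightarrow> 'e) \<Rightarrow>
   ('b \<Rightarrow> 'e) \<Rightarrow> ('e, 'b) pbundle" where
  "std_pbundle E M \<pi> pls scl zer =
     \<lparr>total = std_dspace E, base = std_dspace M, proj = \<pi>,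
      fib_add = pls, fib_scale = scl, fib_zero = zer\<rparr>"

text \<open>A map \<open>p : \<real>\<^sup>n\<^sup>+\<^sup>k \<rightarrow> \<real>\<^sup>n\<close> with fibres \<open>{y} \<times> \<real>\<^sup>k\<close>, each with the vector space structure of
  the second factor.\<close>

definition euclid_pbundle :: "nat \<Rightarrow> nat \<Rightarrow> (rvec \<Rightarrow> rvec) \<Rightarrow> (rvec, rvec) pbundle" where
  "euclid_pbundle n k p =
     std_pbundle (euclid_mfd (n + k)) (euclid_mfd n) p
       (\<lambda>w w'. juxt n (hd_part n w) (\<lambda>a. tl_part n w a + tl_part n w' a))
       (\<lambda>r w. juxt n (hd_part n w) (\<lambda>a. r * tl_part n w a))
       (\<lambda>y. juxt n y (\<lambda>_. 0))"


section \<open>Gluing\<close>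

text \<open>\<open>f\<close> is a smooth map to the base of \<open>Q\<close> from the subset \<open>Y\<close> of the base of \<open>P\<close>, and \<open>F\<close> is a
  smooth fibrewise linear lift of it, defined over \<open>Y\<close>.\<close>

definition gluing_maps ::
  "('e, 'b) pbundle \<Rightarrow> ('e, 'b) pbundle \<Rightarrow> 'b set \<Rightarrow> ('e \<Rightarrow> 'e) \<Rightarrow> ('b \<Rightarrow> 'b) \<Rightarrow> bool" where
  "gluing_maps P Q Y F f \<longleftrightarrow>
     Y \<subseteq> points (base P) \<and>
     dsmooth (sub_dspace (base P) Y) (base Q) f \<and>
     dsmooth (sub_dspace (total P) (proj P -` Y)) (total Q) F \<and>
     (\<forall>v \<in> points (total P) \<inter> proj P -` Y. proj Q (F v) = f (proj P v)) \<and>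
     (\<forall>u \<in> points (total P) \<inter> proj P -` Y. \<forall>v \<in> points (total P). proj P v = proj P u \<longrightarrow>
        F (fib_add P u v) = fib_add Q (F u) (F v)) \<and>
     (\<forall>r. \<forall>v \<in> points (total P) \<inter> proj P -` Y. F (fib_scale P r v) = fib_scale Q r (F v))"

text \<open>The equivalence relation on \<open>\<Squnion>\<^sub>i X i\<close> generated by all identifications \<open>x \<sim> f i j x\<close>
  for \<open>x \<in> A i j\<close>, where \<open>A i j\<close> is the subset of \<open>X i\<close> on which \<open>f i j\<close> is defined.\<close>

definition glue_rel ::
  "'i set \<Rightarrow> ('i \<Rightarrow> 'a set) \<Rightarrow> ('i \<Rightarrow> 'i \<Rightarrow> 'a set) \<Rightarrow> ('i \<Rightarrow> 'i \<Rightarrow> 'a \<Rightarrow> 'a) \<Rightarrow>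
   (('i \<times> 'a) \<times> ('i \<times> 'a)) set" where
  "glue_rel I X A f =
     {(s, t). s \<in> Sigma I X \<and> t \<in> Sigma I X \<and>
        equivclp (\<lambda>s t. \<exists>i\<in>I. \<exists>j\<in>I. \<exists>x \<in> X i \<inter> A i j. s = (i, x) \<and> t = (j, f i j x)) s t}"

text \<open>The result of gluing the \<open>P i\<close> along all pairs \<open>(F i j, f i j)\<close>. A point of the glued spaces is
  an equivalence class. The projection and the operations are the ones induced by those of the
  \<open>P i\<close>: one applies the latter to all representatives (for the addition, to all pairs of
  representatives in a common fibre of some \<open>P i\<close>) and takes the class of the results.\<close>

definition glue_pbundles ::
  "'i set \<Rightarrow> ('i \<Rightarrow> ('e, 'b) pbundle) \<Rightarrow> ('i \<Rightarrow> 'i \<Rightarrow> 'b set) \<Rightarrow>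
   ('i \<Rightarrow> 'i \<Rightarrow> 'e \<Rightarrow> 'e) \<Rightarrow> ('i \<Rightarrow> 'i \<Rightarrow> 'b \<Rightarrow> 'b) \<Rightarrow> (('i \<times> 'e) set, ('i \<times> 'b) set) pbundle" where
  "glue_pbundles I P Y F f =
     (let RE = glue_rel I (\<lambda>i. points (total (P i))) (\<lambda>i j. proj (P i) -` Y i j) F;
          RB = glue_rel I (\<lambda>i. points (base (P i))) Y f
      in \<lparr>total = quot_dspace (disjoint_union_dspace I (\<lambda>i. total (P i))) RE,
          base = quot_dspace (disjoint_union_dspace I (\<lambda>i. base (P i))) RB,
          proj = \<lambda>C. RB `` {(i, proj (P i) w) |i w. (i, w) \<in> C},
          fib_add = \<lambda>C C'. RE `` {(i, fib_add (P i) w w') |i w w'.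
                        (i, w) \<in> C \<and> (i, w') \<in> C' \<and> proj (P i) w = proj (P i) w'},
          fib_scale = \<lambda>r C. RE `` {(i, fib_scale (P i) r w) |i w. (i, w) \<in> C},
          fib_zero = \<lambda>c. RE `` {(i, fib_zero (P i) y) |i y. (i, y) \<in> c}\<rparr>)"

end

theory Submission
  imports Defs "HOL-Analysis.Derivative"
begin

text \<open>The idea. A space that is covered by open pieces is recovered by gluing the pieces along their
  overlaps: send a point \<open>x\<close> to the set of its coordinates in all charts around it. Two pairs
  \<open>(i, a)\<close>, \<open>(j, b)\<close> are identified by the gluing exactly if \<open>a\<close> and \<open>b\<close> are the coordinates of one point,
  because each elementary identification is a change of coordinates, so this map is a bijection onto
  the glued space (\<open>gl_iff\<close>, \<open>points_glued\<close>). It is smooth, since a plot runs locally in a single open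
  piece and its coordinates there are a lift; its inverse is smooth, since a plot of the glued space
  locally lifts to a single chart, whose inverse is smooth (\<open>ddiffeo_reps\<close>).

  This is used twice: for \<open>M\<close> with the charts \<open>\<phi>\<^sub>i\<close>, and for \<open>E\<close> with the charts
  \<open>\<Phi>\<^sub>i = (\<phi>\<^sub>i \<times> id) \<circ> \<psi>\<^sub>i : \<pi>\<^sup>-\<^sup>1(U\<^sub>i) \<rightarrow> \<real>\<^sup>n\<^sup>+\<^sup>k\<close>. Their changes of coordinates are the given maps \<open>f\<^sub>i\<^sub>j\<close> and \<open>F\<^sub>i\<^sub>j\<close>;
  for the latter this is the defining property of the transition functions (\<open>F_Phi\<close>). As each \<open>\<Phi>\<^sub>i\<close> is
  linear on fibres and covers \<open>\<phi>\<^sub>i\<close>, the two diffeomorphisms respect projections and operations, hence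
  form an isomorphism of pseudo-bundles (\<open>iso_reps\<close>). That \<open>E\<close> is a pseudo-bundle is checked in local
  trivializations (\<open>pseudo_bundle_std\<close>), and the glued object is one because it is isomorphic to \<open>E\<close>
  (\<open>pseudo_bundle_iso\<close>).

  What remains is to connect smooth maps of manifolds with plots: smooth maps and products of
  manifolds induce smooth maps and products of diffeological spaces (\<open>smooth_map_imp_dsmooth\<close>,
  \<open>std_dspace_prod_mfd\<close>). As smoothness on \<open>\<real>\<^sup>d\<close> is phrased by iterated continuous partial derivatives, the
  analytic core is that such functions are closed under composition (\<open>Ck_compose\<close>) and that this
  property is local (\<open>Ck_local\<close>).\<close>

section \<open>Calculus of iterated partial derivatives\<close>

lemma continuous_map_local:
  assumes "\<And>x. x \<in> U \<Longrightarrow> \<exists>V. openin X V \<and> x \<in> V \<and> V \<subseteq> U \<and> continuous_map (subtopology X V) Y f"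
  shows "continuous_map (subtopology X U) Y f"
proof -
  obtain V where V: "\<And>x. x \<in> U \<Longrightarrow> openin X (V x) \<and> x \<in> V x \<and> V x \<subseteq> U \<and>
      continuous_map (subtopology X (V x)) Y f"
    using assms by metis
  show ?thesis
  proof (rule pasting_lemma[where I = U and T = V and f = "\<lambda>_. f"])
    show "openin (subtopology X U) (V x)" if "x \<in> U" for x
      using V[OF that] by (metis inf.absorb1 openin_subtopology)
    show "continuous_map (subtopology (subtopology X U) (V x)) Y f" if "x \<in> U" for x
      using V[OF that] by (simp add: subtopology_subtopology Int_absorb1)
  qed (use V in auto)
qed

lemma Rn_iff: "x \<in> Rn d \<longleftrightarrow> (\<forall>i\<ge>d. x i = 0)"
  by (simp add: topspace_Euclidean_space)

lemma Euclidean_space_eq: "Euclidean_space d = top_of_set {x. \<forall>i\<ge>d. x i = 0}"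
  by (simp add: Euclidean_space_def euclidean_product_topology)

lemma continuous_map_Euclidean_iff:
  assumes "openin (Euclidean_space d) U"
  shows "continuous_map (subtopology (Euclidean_space d) U) euclideanreal g \<longleftrightarrow> continuous_on U g"
proof -
  have "{x. \<forall>i\<ge>d. x i = 0} \<inter> U = U"
    using openin_subset[OF assms] by (auto simp: topspace_Euclidean_space)
  then show ?thesis by (simp add: Euclidean_space_eq subtopology_subtopology)
qed

lemma upd_in_Rn: "x \<in> Rn d \<Longrightarrow> i < d \<Longrightarrow> x(i := t) \<in> Rn d"
  by (simp add: Rn_iff)

text \<open>A basic open set of the product topology restricts finitely many entries only, and the entries from
  index \<open>d\<close> on are \<open>0\<close> anyway; so the open cubes in the first \<open>d\<close> coordinates form a neighbourhood
  basis. This turns openness into the \<open>\<epsilon>\<close>-\<open>\<delta>\<close> form that the chain rule needs.\<close>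
lemma openin_Euclidean_cube:
  assumes "openin (Euclidean_space d) U" "x \<in> U"
  shows "\<exists>\<delta>>0. \<forall>y\<in>Rn d. (\<forall>i<d. \<bar>y i - x i\<bar> < \<delta>) \<longrightarrow> y \<in> U"
proof -
  obtain T where T: "openin (powertop_real UNIV) T" "U = T \<inter> Rn d"
    using assms(1) by (auto simp: Euclidean_space_def openin_subtopology)
  have "x \<in> T" "x \<in> Rn d" using T assms by auto
  then obtain W where W: "finite {i. W i \<noteq> (UNIV :: real set)}" "\<And>i. open (W i)"
      "\<And>i. x i \<in> W i" "Pi\<^sub>E UNIV W \<subseteq> T"
    using T(1) by (force simp: openin_product_topology_alt PiE_UNIV_domain)
  have "\<exists>\<delta>>0. \<forall>s. \<bar>s - x i\<bar> < \<delta> \<longrightarrow> s \<in> W i" for i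
    using W(2,3)[of i] unfolding open_dist dist_real_def by blast
  then obtain \<delta> where \<delta>: "\<And>i. \<delta> i > 0" "\<And>i s. \<bar>s - x i\<bar> < \<delta> i \<Longrightarrow> s \<in> W i"
    by metis
  define \<epsilon> where "\<epsilon> = Min (insert 1 (\<delta> ` {i. i < d}))"
  have "\<epsilon> > 0" using \<delta>(1) by (auto simp: \<epsilon>_def)
  moreover have "y \<in> U" if y: "y \<in> Rn d" "\<And>i. i < d \<Longrightarrow> \<bar>y i - x i\<bar> < \<epsilon>" for y
  proof -
    have "y i \<in> W i" for i
    proof (cases "i < d")
      case True
      then have "\<epsilon> \<le> \<delta> i" by (simp add: \<epsilon>_def)
      with y(2)[OF True] show ?thesis by (auto intro: \<delta>(2))
    next
      case False
      then have "y i = x i" using y(1) \<open>x \<in> Rn d\<close> by (simp add: Rn_iff)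
      then show ?thesis using W(3) by simp
    qed
    then show ?thesis using W(4) T(2) y(1) by (auto simp: PiE_UNIV_domain)
  qed
  ultimately show ?thesis by blast
qed

lemma openin_Euclidean_line:
  assumes U: "openin (Euclidean_space d) U" "x \<in> U" and "i < d"
  shows "\<exists>\<delta>>0. \<forall>t. \<bar>t - x i\<bar> < \<delta> \<longrightarrow> x(i := t) \<in> U"
proof -
  have x: "x \<in> Rn d" using openin_subset[OF U(1)] U(2) by blast
  obtain \<delta> where "\<delta> > 0" "\<forall>y\<in>Rn d. (\<forall>i<d. \<bar>y i - x i\<bar> < \<delta>) \<longrightarrow> y \<in> U"
    using openin_Euclidean_cube[OF U] by blast
  moreover have "x(i := t) \<in> Rn d" for t
    using upd_in_Rn[OF x \<open>i < d\<close>] .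
  ultimately show ?thesis
    by (metis abs_zero cancel_comm_monoid_add_class.diff_cancel fun_upd_apply)
qed

lemma partial_deriv_cong:
  assumes U: "openin (Euclidean_space d) U" "x \<in> U" "i < d"
    and eq: "\<And>y. y \<in> U \<Longrightarrow> g y = h y"
    and D: "((\<lambda>t. g (x(i := t))) has_real_derivative D) (at (x i))"
  shows "((\<lambda>t. h (x(i := t))) has_real_derivative D) (at (x i))"
proof -
  obtain \<delta> where "\<delta> > 0" "\<And>t. \<bar>t - x i\<bar> < \<delta> \<Longrightarrow> x(i := t) \<in> U"
    using openin_Euclidean_line[OF U] by blast
  then show ?thesis
    by (intro has_field_derivative_transform_within[OF D, of \<delta>]) (auto simp: dist_real_def eq)
qed

lemma Ck_SucD:
  assumes "Ck d U (Suc r) g" "i < d"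
  shows "\<exists>g'. (\<forall>x\<in>U. ((\<lambda>t. g (x(i := t))) has_real_derivative g' x) (at (x i))) \<and> Ck d U r g'"
  using assms by simp

lemma Ck_cong:
  assumes U: "openin (Euclidean_space d) U" and eq: "\<And>y. y \<in> U \<Longrightarrow> g y = h y"
    and "Ck d U r g"
  shows "Ck d U r h"
proof -
  have c: "continuous_map (subtopology (Euclidean_space d) U) euclideanreal h"
    using assms by (cases r) (auto simp: continuous_map_Euclidean_iff[OF U] cong: continuous_on_cong)
  show ?thesis
  proof (cases r)
    case 0
    with c show ?thesis by simp
  next
    case (Suc r')
    have "\<exists>g'. (\<forall>x\<in>U. ((\<lambda>t. h (x(i := t))) has_real_derivative g' x) (at (x i))) \<and> Ck d U r' g'"
      if i: "i < d" for i
    proof -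
      obtain g' where g': "\<forall>x\<in>U. ((\<lambda>t. g (x(i := t))) has_real_derivative g' x) (at (x i))"
          "Ck d U r' g'"
        using Ck_SucD[OF \<open>Ck d U r g\<close>[unfolded Suc] i] by blast
      have "((\<lambda>t. h (x(i := t))) has_real_derivative g' x) (at (x i))" if "x \<in> U" for x
        by (rule partial_deriv_cong[OF U that i eq bspec[OF g'(1) that]])
      with g'(2) show ?thesis by blast
    qed
    with c Suc show ?thesis by simp
  qed
qed

lemma Ck_continuous_map:
  "Ck d U r g \<Longrightarrow> continuous_map (subtopology (Euclidean_space d) U) euclideanreal g"
  by (cases r) auto

lemma Ck_continuous_on:
  "Ck d U r g \<Longrightarrow> openin (Euclidean_space d) U \<Longrightarrow> continuous_on U g"
  by (cases r) (auto simp: continuous_map_Euclidean_iff)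

lemma Ck_Suc_imp_Ck: "Ck d U (Suc r) g \<Longrightarrow> Ck d U r g"
proof (induction r arbitrary: g)
  case (Suc r)
  have "\<exists>g'. (\<forall>x\<in>U. ((\<lambda>t. g (x(i := t))) has_real_derivative g' x) (at (x i))) \<and> Ck d U r g'"
    if i: "i < d" for i
  proof -
    obtain g' where "\<forall>x\<in>U. ((\<lambda>t. g (x(i := t))) has_real_derivative g' x) (at (x i))"
        "Ck d U (Suc r) g'"
      using Ck_SucD[OF Suc.prems i] by blast
    with Suc.IH show ?thesis by blast
  qed
  with Suc.prems show ?case by simp
qed simp

lemma Ck_subset: "Ck d U r g \<Longrightarrow> V \<subseteq> U \<Longrightarrow> Ck d V r g"
proof (induction r arbitrary: g)
  case 0
  then show ?case by (auto intro: continuous_map_from_subtopology_mono)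
next
  case (Suc r)
  have "\<exists>g'. (\<forall>x\<in>V. ((\<lambda>t. g (x(i := t))) has_real_derivative g' x) (at (x i))) \<and> Ck d V r g'"
    if i: "i < d" for i
  proof -
    obtain g' where "\<forall>x\<in>U. ((\<lambda>t. g (x(i := t))) has_real_derivative g' x) (at (x i))"
        "Ck d U r g'"
      using Ck_SucD[OF Suc.prems(1) i] by blast
    with Suc.IH Suc.prems(2) show ?thesis by blast
  qed
  with Suc.prems show ?case by (auto intro: continuous_map_from_subtopology_mono)
qed

text \<open>Partial derivatives are unique, so the ones found on the members of a cover agree on overlaps;
  \<^const>\<open>deriv\<close> picks them globally.\<close>

lemma Ck_local:
  assumes "\<And>x. x \<in> U \<Longrightarrow> \<exists>V. openin (Euclidean_space d) V \<and> x \<in> V \<and> V \<subseteq> U \<and> Ck d V r g"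
  shows "openin (Euclidean_space d) U \<and> Ck d U r g"
proof -
  have U: "openin (Euclidean_space d) U"
    by (subst openin_subopen) (use assms in blast)
  have cont: "continuous_map (subtopology (Euclidean_space d) U) euclideanreal g"
    if loc: "\<And>x. x \<in> U \<Longrightarrow> \<exists>V. openin (Euclidean_space d) V \<and> x \<in> V \<and> V \<subseteq> U \<and> Ck d V r g" for r g
  proof (rule continuous_map_local)
    fix x assume "x \<in> U"
    from loc[OF this]
    obtain V where V: "openin (Euclidean_space d) V" "x \<in> V" "V \<subseteq> U" "Ck d V r g"
      by blast
    then show "\<exists>V. openin (Euclidean_space d) V \<and> x \<in> V \<and> V \<subseteq> U \<and>
        continuous_map (subtopology (Euclidean_space d) V) euclideanreal g"
      using Ck_continuous_map[OF V(4)] by blast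
  qed
  have "Ck d U r g"
    using assms
  proof (induction r arbitrary: g)
    case 0
    then show ?case using cont[of 0 g] by simp
  next
    case (Suc r)
    have "\<exists>g'. (\<forall>x\<in>U. ((\<lambda>t. g (x(i := t))) has_real_derivative g' x) (at (x i))) \<and> Ck d U r g'"
      if "i < d" for i
    proof (intro exI conjI ballI)
      let ?g' = "\<lambda>x. deriv (\<lambda>t. g (x(i := t))) (x i)"
      have *: "\<exists>V. openin (Euclidean_space d) V \<and> x \<in> V \<and> V \<subseteq> U \<and> Ck d V r ?g' \<and>
          ((\<lambda>t. g (x(i := t))) has_real_derivative ?g' x) (at (x i))" if x: "x \<in> U" for x
      proof -
        obtain V where V: "openin (Euclidean_space d) V" "x \<in> V" "V \<subseteq> U" "Ck d V (Suc r) g"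
          using Suc.prems[OF x] by blast
        obtain g' where g': "\<forall>y\<in>V. ((\<lambda>t. g (y(i := t))) has_real_derivative g' y) (at (y i))"
            "Ck d V r g'"
          using Ck_SucD[OF V(4) \<open>i < d\<close>] by blast
        have "?g' y = g' y" if "y \<in> V" for y
          by (rule DERIV_imp_deriv) (use g'(1) that in blast)
        then show ?thesis
          using V g' x Ck_cong[OF V(1) _ g'(2), of ?g'] by auto
      qed
      show "Ck d U r ?g'"
      proof (rule Suc.IH)
        fix x assume "x \<in> U"
        show "\<exists>V. openin (Euclidean_space d) V \<and> x \<in> V \<and> V \<subseteq> U \<and> Ck d V r ?g'"
          using *[OF \<open>x \<in> U\<close>] by blast
      qed
      show "((\<lambda>t. g (x(i := t))) has_real_derivative ?g' x) (at (x i))" if "x \<in> U" for x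
        using *[OF that] by blast
    qed
    then show ?case
      using cont[OF Suc.prems] by simp
  qed
  with U show ?thesis by blast
qed

lemma Ck_const: "Ck d U r (\<lambda>_. c)"
proof (induction r arbitrary: c)
  case (Suc r)
  then show ?case by (auto intro!: exI[of _ "\<lambda>_. 0"])
qed simp

lemma Ck_coord: "openin (Euclidean_space d) U \<Longrightarrow> Ck d U r (\<lambda>x. x j)"
proof (cases r)
  case (Suc r')
  assume U: "openin (Euclidean_space d) U"
  have "continuous_on U (\<lambda>x. x j)"
    by (intro continuous_on_product_coordinates continuous_on_subset[OF _ subset_UNIV])
  moreover have "\<exists>g'. (\<forall>x\<in>U. ((\<lambda>t. (x(i := t)) j) has_real_derivative g' x) (at (x i))) \<and> Ck d U r' g'" for i
    by (rule exI[of _ "\<lambda>_. if i = j then 1 else 0"]) (auto simp: Ck_const)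
  ultimately show ?thesis
    using Suc U by (simp add: continuous_map_Euclidean_iff)
qed (auto simp: continuous_map_Euclidean_iff
   intro!: continuous_on_product_coordinates continuous_on_subset[OF _ subset_UNIV])

lemma Ck_add:
  assumes U: "openin (Euclidean_space d) U"
  shows "Ck d U r a \<Longrightarrow> Ck d U r b \<Longrightarrow> Ck d U r (\<lambda>x. a x + b x)"
proof (induction r arbitrary: a b)
  case 0
  then show ?case by (auto intro: continuous_intros)
next
  case (Suc r)
  have "\<exists>g'. (\<forall>x\<in>U. ((\<lambda>t. a (x(i := t)) + b (x(i := t))) has_real_derivative g' x) (at (x i))) \<and> Ck d U r g'"
    if i: "i < d" for i
  proof -
    obtain a' where
      a': "\<forall>x\<in>U. ((\<lambda>t. a (x(i := t))) has_real_derivative a' x) (at (x i))" "Ck d U r a'"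
      using Ck_SucD[OF Suc.prems(1) i] by blast
    obtain b' where
      b': "\<forall>x\<in>U. ((\<lambda>t. b (x(i := t))) has_real_derivative b' x) (at (x i))" "Ck d U r b'"
      using Ck_SucD[OF Suc.prems(2) i] by blast
    show ?thesis
      by (rule exI[of _ "\<lambda>x. a' x + b' x"]) (use a' b' Suc.IH in \<open>auto intro!: derivative_intros\<close>)
  qed
  with Suc.prems show ?case by (auto intro: continuous_intros)
qed

text \<open>The product rule: \<open>a' b + b' a\<close> again consists of products of functions of class \<open>C\<^sup>r\<close>.\<close>
lemma Ck_mult:
  assumes U: "openin (Euclidean_space d) U"
  shows "Ck d U r a \<Longrightarrow> Ck d U r b \<Longrightarrow> Ck d U r (\<lambda>x. a x * b x)"
proof (induction r arbitrary: a b)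
  case 0
  then show ?case by (auto intro: continuous_map_real_mult)
next
  case (Suc r)
  have "\<exists>g'. (\<forall>x\<in>U. ((\<lambda>t. a (x(i := t)) * b (x(i := t))) has_real_derivative g' x) (at (x i))) \<and> Ck d U r g'"
    if i: "i < d" for i
  proof -
    obtain a' where
      a': "\<forall>x\<in>U. ((\<lambda>t. a (x(i := t))) has_real_derivative a' x) (at (x i))" "Ck d U r a'"
      using Ck_SucD[OF Suc.prems(1) i] by blast
    obtain b' where
      b': "\<forall>x\<in>U. ((\<lambda>t. b (x(i := t))) has_real_derivative b' x) (at (x i))" "Ck d U r b'"
      using Ck_SucD[OF Suc.prems(2) i] by blast
    have "((\<lambda>t. a (x(i := t)) * b (x(i := t))) has_real_derivative a' x * b x + b' x * a x) (at (x i))"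
      if "x \<in> U" for x
      using DERIV_mult[OF a'(1)[rule_format, OF that] b'(1)[rule_format, OF that]] by simp
    moreover have "Ck d U r (\<lambda>x. a' x * b x + b' x * a x)"
      using Ck_Suc_imp_Ck[OF Suc.prems(1)] Ck_Suc_imp_Ck[OF Suc.prems(2)]
      by (intro Ck_add[OF U] Suc.IH a'(2) b'(2))
    ultimately show ?thesis by (intro exI[of _ "\<lambda>x. a' x * b x + b' x * a x"]) simp
  qed
  with Suc.prems show ?case by (simp add: continuous_map_real_mult)
qed

lemma Ck_sum:
  assumes U: "openin (Euclidean_space d) U"
  shows "(\<And>j. j \<in> J \<Longrightarrow> Ck d U r (a j)) \<Longrightarrow> Ck d U r (\<lambda>x. \<Sum>j\<in>J. a j x)"
proof (induction J rule: infinite_finite_induct)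
  case (insert j J)
  then show ?case using Ck_add[OF U, of r "a j" "\<lambda>x. \<Sum>j\<in>J. a j x"] by simp
qed (simp_all add: Ck_const)

lemma mean_value:
  fixes u :: "real \<Rightarrow> real"
  assumes "\<And>s. \<bar>s - a\<bar> \<le> \<bar>b - a\<bar> \<Longrightarrow> (u has_real_derivative u' s) (at s)"
  shows "\<exists>\<xi>. \<bar>\<xi> - a\<bar> \<le> \<bar>b - a\<bar> \<and> u b - u a = (b - a) * u' \<xi>"
proof (cases a b rule: linorder_cases)
  case less
  then have "\<exists>z>a. z < b \<and> u b - u a = (b - a) * u' z" by (rule MVT2) (rule assms, simp)
  then obtain z where "z > a" "z < b" "u b - u a = (b - a) * u' z" by blast
  then show ?thesis by (intro exI[of _ z]) auto
next
  case equal
  then show ?thesis by auto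
next
  case greater
  then have "\<exists>z>b. z < a \<and> u a - u b = (a - b) * u' z" by (rule MVT2) (rule assms, simp)
  then obtain z where "z > b" "z < a" "u a - u b = (a - b) * u' z" by blast
  then show ?thesis by (intro exI[of _ z]) (auto simp: algebra_simps)
qed

text \<open>The increment of \<open>g\<close> along the curve is split into increments in one coordinate at a time. Each
  of these is, by the mean value theorem, a value of one partial derivative at a nearby point times
  the increment of one coordinate of the curve; the first factor converges by continuity.\<close>

lemma chain_rule_along_curve:
  assumes U: "openin (Euclidean_space e) U" and c0: "c t0 \<in> U"
    and cR: "\<And>t. c t \<in> Rn e"
    and c': "\<And>i. i < e \<Longrightarrow> ((\<lambda>t. c t i) has_real_derivative c' i) (at t0)"
    and G: "\<And>i x. i < e \<Longrightarrow> x \<in> U \<Longrightarrow> ((\<lambda>t. g (x(i := t))) has_real_derivative G i x) (at (x i))"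
    and Gc: "\<And>i. i < e \<Longrightarrow> continuous_on U (G i)"
  shows "((\<lambda>t. g (c t)) has_real_derivative (\<Sum>i<e. G i (c t0) * c' i)) (at t0)"
proof -
  define C where "C j t = (\<lambda>i. if i < j then c t i else c t0 i)" for j t
  have C0: "C j t0 = c t0" for j by (auto simp: C_def)
  have near: "\<forall>\<^sub>F t in at t0. \<forall>i<e. \<bar>c t i - c t0 i\<bar> < \<delta>" if "\<delta> > 0" for \<delta>
  proof -
    have "\<forall>\<^sub>F t in at t0. \<forall>i\<in>{..<e}. \<bar>c t i - c t0 i\<bar> < \<delta>"
    proof (intro eventually_ball_finite ballI)
      fix i assume "i \<in> {..<e}"
      then have "((\<lambda>t. c t i) \<longlongrightarrow> c t0 i) (at t0)"
        using DERIV_isCont[OF c'[of i]] by (simp add: isCont_def)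
      then show "\<forall>\<^sub>F t in at t0. \<bar>c t i - c t0 i\<bar> < \<delta>"
        using that by (auto simp: tendsto_iff dist_real_def)
    qed simp
    then show ?thesis by (rule eventually_mono) simp
  qed
  have step: "((\<lambda>t. g (C (Suc j) t) - g (C j t)) has_real_derivative G j (c t0) * c' j) (at t0)"
    if j: "j < e" for j
  proof -
    (* K is the difference quotient of g in the j-th coordinate. Its value for a vanishing increment
       is the expected limit, so that the factorization KC holds at every t. *)
    define K where "K t = (if c t j = c t0 j then G j (c t0)
      else (g (C (Suc j) t) - g (C j t)) / (c t j - c t0 j))" for t
    have Cupd: "C (Suc j) t = (C j t)(j := c t j)" and Cj: "C j t = (C j t)(j := c t0 j)" for t
      by (auto simp: C_def fun_eq_iff less_Suc_eq)
    have KC: "g (C (Suc j) t) - g (C j t) = K t * (c t j - c t0 j)" for t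
      using Cupd[of t] Cj[of t] by (auto simp: K_def)
    have "(K \<longlongrightarrow> G j (c t0)) (at t0)"
      unfolding tendsto_iff
    proof (intro allI impI)
      fix \<epsilon> :: real assume \<epsilon>: "\<epsilon> > 0"
      define N where "N = {y \<in> U. G j y \<in> ball (G j (c t0)) \<epsilon>}"
      have "openin (top_of_set U) N"
        using continuous_openin_preimage_gen[OF Gc[OF j], of "ball (G j (c t0)) \<epsilon>"]
        by (simp add: N_def vimage_def Int_def)
      then have "openin (Euclidean_space e) N"
        using U unfolding Euclidean_space_eq by (rule openin_trans)
      moreover have "c t0 \<in> N" using c0 \<epsilon> by (simp add: N_def)
      ultimately obtain \<delta> where \<delta>: "\<delta> > 0"
          "\<And>y. y \<in> Rn e \<Longrightarrow> (\<forall>i<e. \<bar>y i - c t0 i\<bar> < \<delta>) \<Longrightarrow> y \<in> N"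
        using openin_Euclidean_cube by metis
      show "\<forall>\<^sub>F t in at t0. dist (K t) (G j (c t0)) < \<epsilon>"
        using near[OF \<delta>(1)]
      proof eventually_elim
        case (elim t)
        define z where "z = C j t"
        have zN: "z(j := s) \<in> N" if "\<bar>s - c t0 j\<bar> \<le> \<bar>c t j - c t0 j\<bar>" for s
        proof (rule \<delta>(2))
          show "z(j := s) \<in> Rn e"
            using cR[of t] cR[of t0] j by (auto simp: z_def C_def Rn_iff)
          show "\<forall>i<e. \<bar>(z(j := s)) i - c t0 i\<bar> < \<delta>"
            using elim j that \<delta>(1) by (auto simp: z_def C_def)
        qed
        have "\<exists>\<xi>. \<bar>\<xi> - c t0 j\<bar> \<le> \<bar>c t j - c t0 j\<bar> \<and>
            g (z(j := c t j)) - g (z(j := c t0 j)) = (c t j - c t0 j) * G j (z(j := \<xi>))"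
        proof (rule mean_value)
          fix s assume "\<bar>s - c t0 j\<bar> \<le> \<bar>c t j - c t0 j\<bar>"
          from zN[OF this] show "((\<lambda>s. g (z(j := s))) has_real_derivative G j (z(j := s))) (at s)"
            using G[OF j, of "z(j := s)"] by (simp add: N_def)
        qed
        then obtain \<xi> where "\<bar>\<xi> - c t0 j\<bar> \<le> \<bar>c t j - c t0 j\<bar>"
            "g (C (Suc j) t) - g (C j t) = (c t j - c t0 j) * G j (z(j := \<xi>))"
          using Cupd[of t] Cj[of t] by (auto simp: z_def)
        then show ?case
          using zN[of \<xi>] \<epsilon> by (auto simp: K_def N_def dist_commute)
      qed
    qed
    moreover have "((\<lambda>t. (c t j - c t0 j) / (t - t0)) \<longlongrightarrow> c' j) (at t0)"
      using c'[OF j] by (simp add: has_field_derivative_iff)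
    ultimately have "((\<lambda>t. K t * ((c t j - c t0 j) / (t - t0))) \<longlongrightarrow> G j (c t0) * c' j) (at t0)"
      by (rule tendsto_mult)
    then show ?thesis
      by (simp add: has_field_derivative_iff KC C0)
  qed
  have partial: "((\<lambda>t. g (C j t)) has_real_derivative (\<Sum>i<j. G i (c t0) * c' i)) (at t0)" if "j \<le> e" for j
    using that
  proof (induction j)
    case 0
    then show ?case by (simp add: C_def)
  next
    case (Suc j)
    from DERIV_add[OF Suc.IH step[of j]] Suc.prems show ?case by simp
  qed
  have "C e t = c t" for t
    using cR[of t] cR[of t0] by (auto simp: C_def Rn_iff fun_eq_iff)
  with partial[of e] show ?thesis by simp
qed

lemma smooth_on_openin: "smooth_on d U e f \<Longrightarrow> openin (Euclidean_space d) U"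
  and smooth_on_Rn: "smooth_on d U e f \<Longrightarrow> x \<in> U \<Longrightarrow> f x \<in> Rn e"
  by (auto simp: smooth_on_def)

lemma smooth_on_continuous_on:
  assumes "smooth_on d U e f" shows "continuous_on U f"
proof (rule continuous_on_coordinatewise_then_product)
  fix j
  show "continuous_on U (\<lambda>x. f x j)"
  proof (cases "j < e")
    case True
    then have "Ck d U 0 (\<lambda>x. f x j)" using assms unfolding smooth_on_def smooth_fun_def by blast
    then show ?thesis using Ck_continuous_on smooth_on_openin[OF assms] by blast
  next
    case False
    then have "f x j = 0" if "x \<in> U" for x using smooth_on_Rn[OF assms that] by (simp add: Rn_iff)
    then show ?thesis by (metis continuous_on_cong continuous_on_const)
  qed
qed

lemma smooth_on_continuous_map:
  assumes "smooth_on d U e f"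
  shows "continuous_map (subtopology (Euclidean_space d) U) (Euclidean_space e) f"
proof -
  have "Rn d \<inter> U = U" using openin_subset[OF smooth_on_openin[OF assms]] by blast
  then show ?thesis
    using smooth_on_continuous_on[OF assms] smooth_on_Rn[OF assms]
    unfolding cm_Euclidean_space_iff_continuous_on by auto
qed

lemma openin_preimage:
  assumes "continuous_map (subtopology X U) Y f" "openin X U" "openin Y V"
  shows "openin X (U \<inter> f -` V)"
proof -
  have "openin (subtopology X U) {x \<in> topspace (subtopology X U). f x \<in> V}"
    using openin_continuous_map_preimage[OF assms(1,3)] .
  moreover have "{x \<in> topspace (subtopology X U). f x \<in> V} = U \<inter> f -` V"
    using openin_subset[OF assms(2)] by auto
  ultimately show ?thesis using assms(2) by (metis openin_trans_full)
qed

lemma smooth_on_preimage: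
  "smooth_on d U e f \<Longrightarrow> openin (Euclidean_space e) V \<Longrightarrow> openin (Euclidean_space d) (U \<inter> f -` V)"
  by (rule openin_preimage[OF smooth_on_continuous_map smooth_on_openin])

text \<open>By the chain rule the partial derivatives of \<open>g \<circ> h\<close> are sums of products of partial derivatives
  of \<open>h\<close> with composites \<open>g' \<circ> h\<close>, where \<open>g'\<close> is once less differentiable than \<open>g\<close>.\<close>

lemma Ck_compose:
  assumes h: "smooth_on d U e h" "h ` U \<subseteq> V" and V: "openin (Euclidean_space e) V"
  shows "Ck e V r g \<Longrightarrow> Ck d U r (\<lambda>x. g (h x))"
proof (induction r arbitrary: g)
  have U: "openin (Euclidean_space d) U" using h by (simp add: smooth_on_def)
  have cont: "continuous_on U (\<lambda>x. g (h x))" if "Ck e V r g" for r g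
    using continuous_on_compose2[OF Ck_continuous_on[OF that V] smooth_on_continuous_on[OF h(1)] h(2)] .
  case 0
  then show ?case
    using cont[of 0 g] by (simp add: continuous_map_Euclidean_iff[OF U])
next
  case (Suc r)
  have U: "openin (Euclidean_space d) U" using h by (simp add: smooth_on_def)
  have "Ck e V 0 g"
    using Suc.prems by simp
  then have "continuous_on U (\<lambda>x. g (h x))"
    using continuous_on_compose2[OF Ck_continuous_on[OF _ V] smooth_on_continuous_on[OF h(1)] h(2)] by blast
  moreover have "\<exists>D. (\<forall>x\<in>U. ((\<lambda>t. g (h (x(i := t)))) has_real_derivative D x) (at (x i))) \<and> Ck d U r D"
    if i: "i < d" for i
  proof -
    have "\<forall>j<e. \<exists>G. (\<forall>x\<in>V. ((\<lambda>t. g (x(j := t))) has_real_derivative G x) (at (x j))) \<and> Ck e V r G"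
      using Ck_SucD[OF Suc.prems] by blast
    then obtain G where G: "\<And>j x. j < e \<Longrightarrow> x \<in> V \<Longrightarrow> ((\<lambda>t. g (x(j := t))) has_real_derivative G j x) (at (x j))"
        "\<And>j. j < e \<Longrightarrow> Ck e V r (G j)"
      by metis
    have "\<forall>j<e. Ck d U (Suc r) (\<lambda>x. h x j)"
      using h(1) by (simp add: smooth_on_def smooth_fun_def del: Ck.simps)
    then have "\<forall>j<e. \<exists>H. (\<forall>x\<in>U. ((\<lambda>t. h (x(i := t)) j) has_real_derivative H x) (at (x i))) \<and> Ck d U r H"
      using Ck_SucD[OF _ i] by blast
    then obtain H where H: "\<And>j x. j < e \<Longrightarrow> x \<in> U \<Longrightarrow> ((\<lambda>t. h (x(i := t)) j) has_real_derivative H j x) (at (x i))"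
        "\<And>j. j < e \<Longrightarrow> Ck d U r (H j)"
      by metis
    let ?D = "\<lambda>x. \<Sum>j<e. G j (h x) * H j x"
    have "((\<lambda>t. g (h (x(i := t)))) has_real_derivative ?D x) (at (x i))" if x: "x \<in> U" for x
    proof -
      obtain \<delta> where \<delta>: "\<delta> > 0" "\<And>t. \<bar>t - x i\<bar> < \<delta> \<Longrightarrow> x(i := t) \<in> U"
        using openin_Euclidean_line[OF U x i] by blast
      \<comment> \<open>The line through \<open>x\<close> is known to stay in \<open>U\<close> only near \<open>x\<close>, and \<open>h\<close> is arbitrary outside \<open>U\<close>; so the
        curve is made constant away from \<open>x i\<close>.\<close>
      define c where "c t = (if \<bar>t - x i\<bar> < \<delta> then h (x(i := t)) else h x)" for t
      have c0: "c (x i) = h x" by (simp add: c_def)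
      have "((\<lambda>t. g (c t)) has_real_derivative (\<Sum>j<e. G j (c (x i)) * H j x)) (at (x i))"
      proof (rule chain_rule_along_curve[OF V])
        show "c (x i) \<in> V" using c0 x h(2) by auto
        show "c t \<in> Rn e" for t
          using smooth_on_Rn[OF h(1)] x \<delta> by (auto simp: c_def)
        show "((\<lambda>t. c t j) has_real_derivative H j x) (at (x i))" if "j < e" for j
          by (rule has_field_derivative_transform_within[OF H(1)[OF that x] \<delta>(1)])
            (auto simp: c_def dist_real_def)
        show "((\<lambda>t. g (y(j := t))) has_real_derivative G j y) (at (y j))" if "j < e" "y \<in> V" for j y
          by (rule G(1)[OF that])
        show "continuous_on V (G j)" if "j < e" for j
          by (rule Ck_continuous_on[OF G(2)[OF that] V])
      qed
      then have "((\<lambda>t. g (c t)) has_real_derivative ?D x) (at (x i))" by (simp add: c0)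
      then show ?thesis
        by (rule has_field_derivative_transform_within[OF _ \<delta>(1)]) (auto simp: c_def dist_real_def)
    qed
    moreover have "Ck d U r ?D"
    proof (rule Ck_sum[OF U])
      fix j assume "j \<in> {..<e}"
      then have j: "j < e" by simp
      show "Ck d U r (\<lambda>x. G j (h x) * H j x)"
        by (rule Ck_mult[OF U Suc.IH[OF G(2)[OF j]] H(2)[OF j]])
    qed
    ultimately show ?thesis by (intro exI[of _ ?D]) simp
  qed
  ultimately show ?case by (simp add: continuous_map_Euclidean_iff[OF U])
qed

lemma smooth_onD:
  "smooth_on d U e f \<Longrightarrow> j < e \<Longrightarrow> Ck d U r (\<lambda>x. f x j)"
  by (simp add: smooth_on_def smooth_fun_def)

lemma smooth_onI:
  assumes "openin (Euclidean_space d) U" "\<And>x. x \<in> U \<Longrightarrow> f x \<in> Rn e"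
    "\<And>j r. j < e \<Longrightarrow> Ck d U r (\<lambda>x. f x j)"
  shows "smooth_on d U e f"
  using assms by (auto simp: smooth_on_def smooth_fun_def)

lemma smooth_on_compose:
  assumes h: "smooth_on d U e h" "h ` U \<subseteq> V" and f: "smooth_on e V l f"
  shows "smooth_on d U l (f \<circ> h)"
proof (rule smooth_onI)
  show "(f \<circ> h) x \<in> Rn l" if "x \<in> U" for x
    using smooth_on_Rn[OF f, of "h x"] h(2) that by auto
  show "Ck d U r (\<lambda>x. (f \<circ> h) x j)" if "j < l" for j r
    using Ck_compose[OF h smooth_on_openin[OF f] smooth_onD[OF f that, of r]] by simp
qed (rule smooth_on_openin[OF h(1)])

lemma smooth_on_cong:
  assumes f: "smooth_on d U e f" and eq: "\<And>x. x \<in> U \<Longrightarrow> f x = f' x"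
  shows "smooth_on d U e f'"
proof (rule smooth_onI)
  show "f' x \<in> Rn e" if "x \<in> U" for x
    using smooth_on_Rn[OF f that] eq[OF that] by simp
  show "Ck d U r (\<lambda>x. f' x j)" if "j < e" for j r
    by (rule Ck_cong[OF smooth_on_openin[OF f] _ smooth_onD[OF f that]]) (simp add: eq)
qed (rule smooth_on_openin[OF f])

lemma smooth_on_subset:
  assumes f: "smooth_on d U e f" and "V \<subseteq> U" "openin (Euclidean_space d) V"
  shows "smooth_on d V e f"
proof (rule smooth_onI)
  show "f x \<in> Rn e" if "x \<in> V" for x
    using smooth_on_Rn[OF f] that assms(2) by blast
  show "Ck d V r (\<lambda>x. f x j)" if "j < e" for j r
    by (rule Ck_subset[OF smooth_onD[OF f that] assms(2)])
qed (rule assms(3))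

lemma smooth_on_local:
  assumes loc: "\<And>x. x \<in> U \<Longrightarrow> \<exists>V. x \<in> V \<and> V \<subseteq> U \<and> smooth_on d V e f"
  shows "smooth_on d U e f"
proof (rule smooth_onI)
  show "openin (Euclidean_space d) U"
    using loc smooth_on_openin by (subst openin_subopen) metis
  show "f x \<in> Rn e" if "x \<in> U" for x
    using loc[OF that] smooth_on_Rn by metis
  show "Ck d U r (\<lambda>x. f x j)" if "j < e" for j r
  proof (rule conjunct2[OF Ck_local])
    show "\<exists>V. openin (Euclidean_space d) V \<and> x \<in> V \<and> V \<subseteq> U \<and> Ck d V r (\<lambda>x. f x j)"
      if "x \<in> U" for x
      using loc[OF that] smooth_on_openin smooth_onD[OF _ \<open>j < e\<close>] by metis
  qed
qed

lemma smooth_on_const: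
  "openin (Euclidean_space d) U \<Longrightarrow> c \<in> Rn e \<Longrightarrow> smooth_on d U e (\<lambda>_. c)"
  by (rule smooth_onI) (simp_all add: Ck_const)

lemma smooth_on_id: "openin (Euclidean_space d) U \<Longrightarrow> smooth_on d U d (\<lambda>x. x)"
  by (rule smooth_onI) (auto simp: Ck_coord dest: openin_subset)

lemma smooth_fun_add: "smooth_fun d U a \<Longrightarrow> smooth_fun d U b \<Longrightarrow> smooth_fun d U (\<lambda>x. a x + b x)"
  and smooth_fun_mult: "smooth_fun d U a \<Longrightarrow> smooth_fun d U b \<Longrightarrow> smooth_fun d U (\<lambda>x. a x * b x)"
  by (auto simp: smooth_fun_def Ck_add Ck_mult)

lemma smooth_on_add:
  "smooth_on d U e a \<Longrightarrow> smooth_on d U e b \<Longrightarrow> smooth_on d U e (\<lambda>x i. a x i + b x i)"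
  unfolding smooth_on_def by (auto simp: smooth_fun_add topspace_Euclidean_space image_subset_iff)

lemma smooth_on_scale:
  "smooth_fun d U a \<Longrightarrow> smooth_on d U e b \<Longrightarrow> smooth_on d U e (\<lambda>x i. a x * b x i)"
  unfolding smooth_on_def by (auto simp: smooth_fun_mult topspace_Euclidean_space image_subset_iff)

lemma juxt_in_Rn: "v \<in> Rn k \<Longrightarrow> juxt n y v \<in> Rn (n + k)"
  by (auto simp: Rn_iff juxt_def)

lemma hd_part_in_Rn: "hd_part n w \<in> Rn n"
  by (auto simp: Rn_iff hd_part_def)

lemma tl_part_in_Rn: "w \<in> Rn (n + k) \<Longrightarrow> tl_part n w \<in> Rn k"
  by (auto simp: Rn_iff tl_part_def)

lemma hd_part_juxt: "y \<in> Rn n \<Longrightarrow> hd_part n (juxt n y v) = y"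
  by (auto simp: Rn_iff hd_part_def juxt_def fun_eq_iff)

lemma tl_part_juxt: "tl_part n (juxt n y v) = v"
  by (auto simp: tl_part_def juxt_def fun_eq_iff)

lemma juxt_hd_tl: "juxt n (hd_part n w) (tl_part n w) = w"
  by (auto simp: tl_part_def hd_part_def juxt_def fun_eq_iff)

text \<open>The bound on \<open>a\<close> makes the identification \<open>\<real>\<^sup>n \<times> \<real>\<^sup>k = \<real>\<^sup>n\<^sup>+\<^sup>k\<close> recover \<open>a\<close> from the juxtaposition:
  entries of \<open>a\<close> from index \<open>n\<close> on are forgotten by \<^const>\<open>juxt\<close>.\<close>
lemma smooth_on_juxt_iff:
  assumes "a ` U \<subseteq> Rn n"
  shows "smooth_on d U (n + k) (\<lambda>x. juxt n (a x) (b x)) \<longleftrightarrow> smooth_on d U n a \<and> smooth_on d U k b"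
    (is "?L \<longleftrightarrow> ?R")
proof
  assume L: ?L
  have "b x i = juxt n (a x) (b x) (n + i)" "i < n \<Longrightarrow> a x i = juxt n (a x) (b x) i" for x i
    by (simp_all add: juxt_def)
  then have "smooth_fun d U (\<lambda>x. b x i)" if "i < k" for i
    using L that by (simp add: smooth_on_def)
  moreover have "smooth_fun d U (\<lambda>x. a x i)" if "i < n" for i
  proof -
    have "smooth_fun d U (\<lambda>x. juxt n (a x) (b x) i)" using L that by (simp add: smooth_on_def)
    then show ?thesis using that by (simp add: juxt_def)
  qed
  moreover have "b x \<in> Rn k" if "x \<in> U" for x
    using tl_part_in_Rn[OF smooth_on_Rn[OF L that]] by (simp add: tl_part_juxt)
  ultimately show ?R using L assms by (auto simp: smooth_on_def)
next
  assume R: ?R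
  have "smooth_fun d U (\<lambda>x. juxt n (a x) (b x) i)" if "i < n + k" for i
    using R that by (cases "i < n") (auto simp: smooth_on_def juxt_def)
  then show ?L using R juxt_in_Rn by (auto simp: smooth_on_def)
qed

lemma smooth_on_hd_part: "smooth_on d U (n + k) q \<Longrightarrow> smooth_on d U n (\<lambda>x. hd_part n (q x))"
  and smooth_on_tl_part: "smooth_on d U (n + k) q \<Longrightarrow> smooth_on d U k (\<lambda>x. tl_part n (q x))"
proof -
  have "(\<lambda>x. hd_part n (q x)) ` U \<subseteq> Rn n"
    using hd_part_in_Rn by blast
  from smooth_on_juxt_iff[OF this, of d k "\<lambda>x. tl_part n (q x)"]
  show "smooth_on d U (n + k) q \<Longrightarrow> smooth_on d U n (\<lambda>x. hd_part n (q x))"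
    "smooth_on d U (n + k) q \<Longrightarrow> smooth_on d U k (\<lambda>x. tl_part n (q x))"
    by (simp_all add: juxt_hd_tl)
qed

section \<open>Diffeological spaces\<close>

lemma diffeological_space_axioms:
  assumes "diffeological_space X"
  shows "\<forall>d U p. plot X d U p \<longrightarrow> openin (Euclidean_space d) U \<and> p ` U \<subseteq> points X"
    and "\<forall>d U p q. plot X d U p \<and> (\<forall>x\<in>U. q x = p x) \<longrightarrow> plot X d U q"
    and "\<forall>d U. \<forall>c \<in> points X. openin (Euclidean_space d) U \<longrightarrow> plot X d U (\<lambda>_. c)"
    and "\<forall>d U p e V h. plot X d U p \<and> smooth_on e V d h \<and> h ` V \<subseteq> U \<longrightarrow> plot X e V (p \<circ> h)"
    and "\<forall>d U p. openin (Euclidean_space d) U \<and>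
        (\<forall>x\<in>U. \<exists>V. openin (Euclidean_space d) V \<and> x \<in> V \<and> V \<subseteq> U \<and> plot X d V p) \<longrightarrow>
        plot X d U p"
  using assms unfolding diffeological_space_def by - (elim conjE, assumption)+

lemma plot_openin: "diffeological_space X \<Longrightarrow> plot X d U p \<Longrightarrow> openin (Euclidean_space d) U"
  and plot_in_points: "diffeological_space X \<Longrightarrow> plot X d U p \<Longrightarrow> x \<in> U \<Longrightarrow> p x \<in> points X"
  using diffeological_space_axioms(1)[of X] by blast+

lemma plot_cong:
  "diffeological_space X \<Longrightarrow> plot X d U p \<Longrightarrow> (\<And>x. x \<in> U \<Longrightarrow> q x = p x) \<Longrightarrow> plot X d U q"
  using diffeological_space_axioms(2)[of X, rule_format, of d U p q] by blast

lemma plot_const: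
  "diffeological_space X \<Longrightarrow> c \<in> points X \<Longrightarrow> openin (Euclidean_space d) U \<Longrightarrow> plot X d U (\<lambda>_. c)"
  using diffeological_space_axioms(3)[of X, rule_format, of c d U] by blast

lemma plot_compose:
  assumes "diffeological_space X" "plot X d U p" "smooth_on e V d h" "h ` V \<subseteq> U"
  shows "plot X e V (p \<circ> h)"
  using diffeological_space_axioms(4)[OF assms(1), rule_format, of d U p e V h] assms(2-4) by blast

lemma plot_subset:
  assumes "diffeological_space X" "plot X d U p" "V \<subseteq> U" "openin (Euclidean_space d) V"
  shows "plot X d V p"
  using plot_compose[OF assms(1,2) smooth_on_id[OF assms(4)]] assms(3) by (auto simp: o_def)

lemma plot_local:
  assumes X: "diffeological_space X" and loc: "\<And>x. x \<in> U \<Longrightarrow> \<exists>V. x \<in> V \<and> V \<subseteq> U \<and> plot X d V p"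
  shows "plot X d U p"
proof -
  have loc': "\<exists>V. openin (Euclidean_space d) V \<and> x \<in> V \<and> V \<subseteq> U \<and> plot X d V p" if "x \<in> U" for x
    using loc[OF that] plot_openin[OF X] by blast
  then have "openin (Euclidean_space d) U"
    by (subst openin_subopen) blast
  with loc' show ?thesis
    using diffeological_space_axioms(5)[OF X, rule_format, of d U p] by blast
qed

lemma diffeological_spaceI:
  assumes "\<And>d U p. plot X d U p \<Longrightarrow> openin (Euclidean_space d) U"
    and "\<And>d U p x. plot X d U p \<Longrightarrow> x \<in> U \<Longrightarrow> p x \<in> points X"
    and "\<And>d U p q. plot X d U p \<Longrightarrow> (\<And>x. x \<in> U \<Longrightarrow> q x = p x) \<Longrightarrow> plot X d U q"
    and "\<And>d U c. c \<in> points X \<Longrightarrow> openin (Euclidean_space d) U \<Longrightarrow> plot X d U (\<lambda>_. c)"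
    and "\<And>d U p e V h. plot X d U p \<Longrightarrow> smooth_on e V d h \<Longrightarrow> h ` V \<subseteq> U \<Longrightarrow> plot X e V (p \<circ> h)"
    and "\<And>d U p. openin (Euclidean_space d) U \<Longrightarrow>
        (\<And>x. x \<in> U \<Longrightarrow> \<exists>V. openin (Euclidean_space d) V \<and> x \<in> V \<and> V \<subseteq> U \<and> plot X d V p) \<Longrightarrow>
        plot X d U p"
  shows "diffeological_space X"
  unfolding diffeological_space_def
proof (intro conjI allI impI; (elim conjE)?)
  fix d U and p :: "rvec \<Rightarrow> 'a"
  assume "openin (Euclidean_space d) U"
    "\<forall>x\<in>U. \<exists>V. openin (Euclidean_space d) V \<and> x \<in> V \<and> V \<subseteq> U \<and> plot X d V p"
  then show "plot X d U p" by (intro assms(6)) auto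
qed (use assms(1-5) in \<open>auto simp: image_subset_iff\<close>)

lemma dsmooth_plot: "dsmooth X Y F \<Longrightarrow> plot X d U p \<Longrightarrow> plot Y d U (F \<circ> p)"
  and dsmooth_points: "dsmooth X Y F \<Longrightarrow> x \<in> points X \<Longrightarrow> F x \<in> points Y"
  by (auto simp: dsmooth_def)

lemma plot_sub_dspace: "plot (sub_dspace X S) d U p \<longleftrightarrow> plot X d U p \<and> p ` U \<subseteq> S"
  and points_sub_dspace: "points (sub_dspace X S) = points X \<inter> S"
  by (simp_all add: sub_dspace_def)

lemma plot_prod_dspace:
    "plot (prod_dspace X Y) d U p \<longleftrightarrow> plot X d U (fst \<circ> p) \<and> plot Y d U (snd \<circ> p)"
  and points_prod_dspace: "points (prod_dspace X Y) = points X \<times> points Y"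
  by (simp_all add: prod_dspace_def)

text \<open>All axioms follow from the local description of plots: composing with a smooth map pulls the
  domains of the local components back to open sets.\<close>
lemma diffeological_disjoint_union:
  assumes X: "\<And>i. i \<in> I \<Longrightarrow> diffeological_space (X i)"
  shows "diffeological_space (disjoint_union_dspace I X)"
proof -
  let ?D = "disjoint_union_dspace I X"
  have iff: "plot ?D d U p \<longleftrightarrow> openin (Euclidean_space d) U \<and>
      (\<forall>x\<in>U. \<exists>V i q. x \<in> V \<and> V \<subseteq> U \<and> i \<in> I \<and> plot (X i) d V q \<and> (\<forall>y\<in>V. p y = (i, q y)))" for d U p
    by (simp add: disjoint_union_dspace_def)
  have pts: "points ?D = Sigma I (\<lambda>i. points (X i))"
    by (simp add: disjoint_union_dspace_def)
  show ?thesis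
  proof (rule diffeological_spaceI)
    fix d U p assume p: "plot ?D d U p"
    then show "openin (Euclidean_space d) U" by (simp add: iff)
    show "p x \<in> points ?D" if x: "x \<in> U" for x
    proof -
      obtain V i q where "x \<in> V" "i \<in> I" "plot (X i) d V q" "\<forall>y\<in>V. p y = (i, q y)"
        using p x unfolding iff by blast
      then show ?thesis using plot_in_points[OF X] by (simp add: pts)
    qed
    show "plot ?D d U q" if "\<And>x. x \<in> U \<Longrightarrow> q x = p x" for q
    proof -
      have "\<exists>V i r. x \<in> V \<and> V \<subseteq> U \<and> i \<in> I \<and> plot (X i) d V r \<and> (\<forall>y\<in>V. q y = (i, r y))"
        if x: "x \<in> U" for x
      proof -
        obtain V i r where "x \<in> V" "V \<subseteq> U" "i \<in> I" "plot (X i) d V r" "\<forall>y\<in>V. p y = (i, r y)"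
          using p x unfolding iff by blast
        then show ?thesis
          using \<open>\<And>x. x \<in> U \<Longrightarrow> q x = p x\<close> by (metis subsetD)
      qed
      with p show ?thesis by (simp add: iff)
    qed
    show "plot ?D e V (p \<circ> h)" if h: "smooth_on e V d h" "h ` V \<subseteq> U" for e V h
    proof -
      have "\<exists>V' i r. x \<in> V' \<and> V' \<subseteq> V \<and> i \<in> I \<and> plot (X i) e V' r \<and> (\<forall>y\<in>V'. (p \<circ> h) y = (i, r y))"
        if x: "x \<in> V" for x
      proof -
        have "h x \<in> U" using h(2) x by auto
        then obtain A i r where A: "h x \<in> A" "A \<subseteq> U" "i \<in> I" "plot (X i) d A r" "\<forall>y\<in>A. p y = (i, r y)"
          using p unfolding iff by blast
        have "openin (Euclidean_space e) (V \<inter> h -` A)"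
          by (rule smooth_on_preimage[OF h(1) plot_openin[OF X[OF A(3)] A(4)]])
        from plot_compose[OF X[OF A(3)] A(4) smooth_on_subset[OF h(1) _ this]]
        have "plot (X i) e (V \<inter> h -` A) (r \<circ> h)" by auto
        then show ?thesis
          using A x by (intro exI[of _ "V \<inter> h -` A"] exI[of _ i] exI[of _ "r \<circ> h"]) auto
      qed
      with smooth_on_openin[OF h(1)] show ?thesis by (simp add: iff)
    qed
  next
    fix d U c assume c: "c \<in> points ?D" and U: "openin (Euclidean_space d) U"
    then have "plot (X (fst c)) d U (\<lambda>_. snd c)"
      by (intro plot_const X) (auto simp: pts)
    moreover have "fst c \<in> I" using c by (auto simp: pts)
    ultimately show "plot ?D d U (\<lambda>_. c)"
      using U unfolding iff by (metis order_refl prod.collapse)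
  next
    fix d U p assume U: "openin (Euclidean_space d) U" and
      loc: "\<And>x. x \<in> U \<Longrightarrow> \<exists>V. openin (Euclidean_space d) V \<and> x \<in> V \<and> V \<subseteq> U \<and> plot ?D d V p"
    have "\<exists>V i q. x \<in> V \<and> V \<subseteq> U \<and> i \<in> I \<and> plot (X i) d V q \<and> (\<forall>y\<in>V. p y = (i, q y))"
      if x: "x \<in> U" for x
    proof -
      obtain A where "x \<in> A" "A \<subseteq> U" "plot ?D d A p" using loc[OF x] by blast
      moreover from this obtain V i q where "x \<in> V" "V \<subseteq> A" "i \<in> I" "plot (X i) d V q"
          "\<forall>y\<in>V. p y = (i, q y)"
        unfolding iff by blast
      ultimately show ?thesis by (intro exI[of _ V] exI[of _ i] exI[of _ q]) auto
    qed
    with U show "plot ?D d U p" by (simp add: iff)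
  qed
qed

lemma diffeological_quot:
  assumes X: "diffeological_space X"
  shows "diffeological_space (quot_dspace X R)"
proof -
  let ?Q = "quot_dspace X R"
  have iff: "plot ?Q d U p \<longleftrightarrow> openin (Euclidean_space d) U \<and>
      (\<forall>x\<in>U. \<exists>V q. x \<in> V \<and> V \<subseteq> U \<and> plot X d V q \<and> (\<forall>y\<in>V. p y = R `` {q y}))" for d U p
    by (simp add: quot_dspace_def)
  have pts: "points ?Q = points X // R"
    by (simp add: quot_dspace_def)
  show ?thesis
  proof (rule diffeological_spaceI)
    fix d U p assume p: "plot ?Q d U p"
    then show "openin (Euclidean_space d) U" by (simp add: iff)
    show "p x \<in> points ?Q" if x: "x \<in> U" for x
    proof -
      obtain V q where "x \<in> V" "plot X d V q" "\<forall>y\<in>V. p y = R `` {q y}"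
        using p x unfolding iff by blast
      then show ?thesis using plot_in_points[OF X] by (auto simp: pts intro: quotientI)
    qed
    show "plot ?Q d U q" if eq: "\<And>x. x \<in> U \<Longrightarrow> q x = p x" for q
    proof -
      have "\<exists>V r. x \<in> V \<and> V \<subseteq> U \<and> plot X d V r \<and> (\<forall>y\<in>V. q y = R `` {r y})"
        if x: "x \<in> U" for x
      proof -
        obtain V r where "x \<in> V" "V \<subseteq> U" "plot X d V r" "\<forall>y\<in>V. p y = R `` {r y}"
          using p x unfolding iff by blast
        then show ?thesis
          using eq by (metis subsetD)
      qed
      with p show ?thesis by (simp add: iff)
    qed
    show "plot ?Q e V (p \<circ> h)" if h: "smooth_on e V d h" "h ` V \<subseteq> U" for e V h
    proof -
      have "\<exists>V' r. x \<in> V' \<and> V' \<subseteq> V \<and> plot X e V' r \<and> (\<forall>y\<in>V'. (p \<circ> h) y = R `` {r y})"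
        if x: "x \<in> V" for x
      proof -
        have "h x \<in> U" using h(2) x by auto
        then obtain A r where A: "h x \<in> A" "A \<subseteq> U" "plot X d A r" "\<forall>y\<in>A. p y = R `` {r y}"
          using p unfolding iff by blast
        have "openin (Euclidean_space e) (V \<inter> h -` A)"
          by (rule smooth_on_preimage[OF h(1) plot_openin[OF X A(3)]])
        from plot_compose[OF X A(3) smooth_on_subset[OF h(1) _ this]]
        have "plot X e (V \<inter> h -` A) (r \<circ> h)" by auto
        then show ?thesis
          using A x by (intro exI[of _ "V \<inter> h -` A"] exI[of _ "r \<circ> h"]) auto
      qed
      with smooth_on_openin[OF h(1)] show ?thesis by (simp add: iff)
    qed
  next
    fix d U c assume c: "c \<in> points ?Q" and U: "openin (Euclidean_space d) U"
    then obtain a where a: "a \<in> points X" "c = R `` {a}" by (auto simp: pts elim: quotientE)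
    from plot_const[OF X a(1) U] show "plot ?Q d U (\<lambda>_. c)"
      using U a(2) unfolding iff by blast
  next
    fix d U p assume U: "openin (Euclidean_space d) U" and
      loc: "\<And>x. x \<in> U \<Longrightarrow> \<exists>V. openin (Euclidean_space d) V \<and> x \<in> V \<and> V \<subseteq> U \<and> plot ?Q d V p"
    have "\<exists>V q. x \<in> V \<and> V \<subseteq> U \<and> plot X d V q \<and> (\<forall>y\<in>V. p y = R `` {q y})"
      if x: "x \<in> U" for x
    proof -
      obtain A where "x \<in> A" "A \<subseteq> U" "plot ?Q d A p" using loc[OF x] by blast
      moreover from this obtain V q where "x \<in> V" "V \<subseteq> A" "plot X d V q"
          "\<forall>y\<in>V. p y = R `` {q y}"
        unfolding iff by blast
      ultimately show ?thesis by (intro exI[of _ V] exI[of _ q]) auto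
    qed
    with U show "plot ?Q d U p" by (simp add: iff)
  qed
qed

section \<open>The standard diffeology of a manifold\<close>

text \<open>Comparing diffeologies only involves reading a point off its coordinates and passing from a
  plot to its coordinate expressions. This needs charts that cover, are injective and have values in
  \<open>\<real>\<^sup>n\<close>. Unlike the full notion of a manifold, this notion passes to open subsets and to products at
  once.\<close>
definition charted :: "'a mfd \<Rightarrow> bool" where
  "charted M \<longleftrightarrow> (\<Union>(U, \<phi>)\<in>atlas M. U) = mset_of M \<and>
     (\<forall>(U, \<phi>)\<in>atlas M. inj_on \<phi> U \<and> \<phi> ` U \<subseteq> Rn (mdim M))"

lemma charted_inj: "charted M \<Longrightarrow> (U, \<phi>) \<in> atlas M \<Longrightarrow> inj_on \<phi> U"
  and charted_Rn: "charted M \<Longrightarrow> (U, \<phi>) \<in> atlas M \<Longrightarrow> x \<in> U \<Longrightarrow> \<phi> x \<in> Rn (mdim M)"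
  unfolding charted_def by blast+

lemma charted_chart_at:
  assumes "charted M" "x \<in> mset_of M"
  obtains U \<phi> where "(U, \<phi>) \<in> atlas M" "x \<in> U"
  using assms unfolding charted_def by blast

lemma charted_manifold:
  assumes M: "smooth_manifold M" shows "charted M"
  unfolding charted_def
proof (intro conjI ballI)
  show un: "(\<Union>(U, \<phi>)\<in>atlas M. U) = mset_of M"
    using M by (simp add: smooth_manifold_def)
  fix c assume c: "c \<in> atlas M"
  obtain U \<phi> where c_eq: "c = (U, \<phi>)" by (cases c)
  have U: "openin (Euclidean_space (mdim M)) (\<phi> ` U)"
    "homeomorphic_map (subtopology (mtop M) U) (subtopology (Euclidean_space (mdim M)) (\<phi> ` U)) \<phi>"
    "openin (mtop M) U"
    using M c c_eq unfolding smooth_manifold_def by blast+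
  have "topspace (subtopology (mtop M) U) = U"
    using openin_subset[OF U(3)] by auto
  then have "inj_on \<phi> U"
    using homeomorphic_imp_injective_map[OF U(2)] by simp
  then show "case c of (U, \<phi>) \<Rightarrow> inj_on \<phi> U \<and> \<phi> ` U \<subseteq> Rn (mdim M)"
    using openin_subset[OF U(1)] c_eq by simp
qed

lemma charted_euclid: "charted (euclid_mfd d)"
  by (auto simp: charted_def euclid_mfd_def)

lemma charted_open_submfd:
  assumes M: "charted M" shows "charted (open_submfd M W)"
  unfolding charted_def
proof (intro conjI ballI)
  have "(\<Union>(U, \<phi>)\<in>atlas M. U) = mset_of M" using M by (simp add: charted_def)
  moreover have "(\<Union>(U, \<phi>)\<in>atlas (open_submfd M W). U) = (\<Union>(U, \<phi>)\<in>atlas M. U) \<inter> W"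
    unfolding open_submfd_def by auto
  ultimately show "(\<Union>(U, \<phi>)\<in>atlas (open_submfd M W). U) = mset_of (open_submfd M W)"
    by (simp add: open_submfd_def)
  fix c assume "c \<in> atlas (open_submfd M W)"
  then obtain U \<phi> where c: "c = (U \<inter> W, \<phi>)" "(U, \<phi>) \<in> atlas M" by (auto simp: open_submfd_def)
  show "case c of (U, \<phi>) \<Rightarrow> inj_on \<phi> U \<and> \<phi> ` U \<subseteq> Rn (mdim (open_submfd M W))"
    using charted_inj[OF M c(2)] charted_Rn[OF M c(2)] c(1)
    by (auto simp: open_submfd_def intro: inj_on_subset)
qed

lemma charted_prod:
  assumes M: "charted M" and N: "charted N" shows "charted (prod_mfd M N)"
  unfolding charted_def
proof (intro conjI ballI)
  have "(\<Union>(U, \<phi>)\<in>atlas M. U) = mset_of M" "(\<Union>(U, \<phi>)\<in>atlas N. U) = mset_of N"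
    using M N by (simp_all add: charted_def)
  moreover have "(\<Union>(U, \<phi>)\<in>atlas (prod_mfd M N). U) =
      (\<Union>(U, \<phi>)\<in>atlas M. U) \<times> (\<Union>(U, \<phi>)\<in>atlas N. U)"
    unfolding prod_mfd_def by auto (metis mem_Sigma_iff)
  ultimately show "(\<Union>(U, \<phi>)\<in>atlas (prod_mfd M N). U) = mset_of (prod_mfd M N)"
    by (simp add: prod_mfd_def)
  fix c assume "c \<in> atlas (prod_mfd M N)"
  then obtain U \<phi> V \<psi> where c: "c = (U \<times> V, \<lambda>(x, y). juxt (mdim M) (\<phi> x) (\<psi> y))"
      and U: "(U, \<phi>) \<in> atlas M" and V: "(V, \<psi>) \<in> atlas N" by (auto simp: prod_mfd_def)
  have "inj_on (\<lambda>(x, y). juxt (mdim M) (\<phi> x) (\<psi> y)) (U \<times> V)"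
  proof (rule inj_onI, clarify)
    fix x y x' y' assume xy: "x \<in> U" "x' \<in> U" "y \<in> V" "y' \<in> V"
      and eq: "juxt (mdim M) (\<phi> x) (\<psi> y) = juxt (mdim M) (\<phi> x') (\<psi> y')"
    have "\<phi> x = \<phi> x'"
      using arg_cong[OF eq, of "hd_part (mdim M)"] charted_Rn[OF M U] xy by (simp add: hd_part_juxt)
    moreover have "\<psi> y = \<psi> y'"
      using arg_cong[OF eq, of "tl_part (mdim M)"] by (simp add: tl_part_juxt)
    ultimately show "x = x' \<and> y = y'"
      using xy inj_onD[OF charted_inj[OF M U]] inj_onD[OF charted_inj[OF N V]] by blast
  qed
  moreover have "juxt (mdim M) (\<phi> x) (\<psi> y) \<in> Rn (mdim M + mdim N)" if "y \<in> V" for x y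
    by (rule juxt_in_Rn[OF charted_Rn[OF N V that]])
  ultimately show "case c of (U, \<phi>) \<Rightarrow> inj_on \<phi> U \<and> \<phi> ` U \<subseteq> Rn (mdim (prod_mfd M N))"
    by (auto simp: c prod_mfd_def)
qed

lemma points_std_dspace: "points (std_dspace M) = mset_of M"
  by (simp add: std_dspace_def)

text \<open>The domain of a plot has the identity as its only chart, so smoothness of a plot is smoothness of
  its expressions in the charts of the target.\<close>
lemma plot_std_dspace:
  "plot (std_dspace M) d U p \<longleftrightarrow> openin (Euclidean_space d) U \<and>
     continuous_map (subtopology (Euclidean_space d) U) (mtop M) p \<and>
     (\<forall>(V, \<psi>)\<in>atlas M. smooth_on d (U \<inter> p -` V) (mdim M) (\<psi> \<circ> p))"
proof -
  have "smooth_on d (id ` (Rn d \<inter> U \<inter> p -` V)) e (\<psi> \<circ> p \<circ> inv_into (Rn d \<inter> U) id)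
      \<longleftrightarrow> smooth_on d (U \<inter> p -` V) e (\<psi> \<circ> p)" if U: "openin (Euclidean_space d) U" for V \<psi> e
  proof -
    have RU: "Rn d \<inter> U = U" using openin_subset[OF U] by blast
    have "inv_into U id x = x" if "x \<in> U" for x
      using inv_into_f_f[of id U x] that by simp
    then show ?thesis
      unfolding RU by (auto elim!: smooth_on_cong)
  qed
  moreover have "atlas (open_submfd (euclid_mfd d) U) = {(Rn d \<inter> U, id)}"
    by (auto simp: open_submfd_def euclid_mfd_def)
  ultimately show ?thesis
    by (auto simp: std_dspace_def smooth_map_def open_submfd_def euclid_mfd_def)
qed

lemma plot_std_dspace_openin:
  "plot (std_dspace M) d U p \<Longrightarrow> openin (Euclidean_space d) U"
  by (simp add: plot_std_dspace)

lemma plot_std_dspace_preimage: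
  "plot (std_dspace M) d U p \<Longrightarrow> openin (mtop M) W \<Longrightarrow> openin (Euclidean_space d) (U \<inter> p -` W)"
  by (rule openin_preimage[where Y = "mtop M"]) (simp_all add: plot_std_dspace)

lemma plot_std_dspace_points:
  "plot (std_dspace M) d U p \<Longrightarrow> x \<in> U \<Longrightarrow> p x \<in> mset_of M"
proof -
  assume p: "plot (std_dspace M) d U p" and x: "x \<in> U"
  then have "x \<in> topspace (subtopology (Euclidean_space d) U)"
    using openin_subset[OF plot_std_dspace_openin[OF p]] by auto
  then show ?thesis
    using p continuous_map_image_subset_topspace unfolding plot_std_dspace by blast
qed

lemma plot_std_dspace_chart:
  "plot (std_dspace M) d U p \<Longrightarrow> (V, \<psi>) \<in> atlas M \<Longrightarrow> smooth_on d (U \<inter> p -` V) (mdim M) (\<psi> \<circ> p)"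
  unfolding plot_std_dspace by blast

lemma plot_std_dspaceI:
  assumes "openin (Euclidean_space d) U"
    "continuous_map (subtopology (Euclidean_space d) U) (mtop M) p"
    "\<And>V \<psi>. (V, \<psi>) \<in> atlas M \<Longrightarrow> smooth_on d (U \<inter> p -` V) (mdim M) (\<psi> \<circ> p)"
  shows "plot (std_dspace M) d U p"
  using assms unfolding plot_std_dspace by blast

lemma diffeological_std_dspace:
  assumes M: "charted M" shows "diffeological_space (std_dspace M)"
proof (rule diffeological_spaceI)
  fix d U p assume p: "plot (std_dspace M) d U p"
  have cont: "continuous_map (subtopology (Euclidean_space d) U) (mtop M) p"
    using p by (simp add: plot_std_dspace)
  show U: "openin (Euclidean_space d) U" by (rule plot_std_dspace_openin[OF p])
  show "p x \<in> points (std_dspace M)" if "x \<in> U" for x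
    using plot_std_dspace_points[OF p that] by (simp add: points_std_dspace)
  show "plot (std_dspace M) d U q" if eq: "\<And>x. x \<in> U \<Longrightarrow> q x = p x" for q
  proof (rule plot_std_dspaceI[OF U])
    show "continuous_map (subtopology (Euclidean_space d) U) (mtop M) q"
      by (rule continuous_map_eq[OF cont]) (simp add: eq)
    fix V \<psi> assume V: "(V, \<psi>) \<in> atlas M"
    have "U \<inter> q -` V = U \<inter> p -` V" using eq by auto
    then show "smooth_on d (U \<inter> q -` V) (mdim M) (\<psi> \<circ> q)"
      using smooth_on_cong[OF plot_std_dspace_chart[OF p V], of "\<psi> \<circ> q"] eq by simp
  qed
  show "plot (std_dspace M) e W (p \<circ> h)" if h: "smooth_on e W d h" "h ` W \<subseteq> U" for e W h
  proof (rule plot_std_dspaceI[OF smooth_on_openin[OF h(1)]])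
    have "continuous_map (subtopology (Euclidean_space e) W) (subtopology (Euclidean_space d) U) h"
      using smooth_on_continuous_map[OF h(1)] h(2) by (auto simp: continuous_map_in_subtopology)
    then show "continuous_map (subtopology (Euclidean_space e) W) (mtop M) (p \<circ> h)"
      using cont by (rule continuous_map_compose)
    fix V \<psi> assume V: "(V, \<psi>) \<in> atlas M"
    note sm = plot_std_dspace_chart[OF p V]
    have eq: "W \<inter> (p \<circ> h) -` V = W \<inter> h -` (U \<inter> p -` V)" using h(2) by auto
    have "openin (Euclidean_space e) (W \<inter> h -` (U \<inter> p -` V))"
      by (rule smooth_on_preimage[OF h(1) smooth_on_openin[OF sm]])
    then have "smooth_on e (W \<inter> h -` (U \<inter> p -` V)) d h"
      by (rule smooth_on_subset[OF h(1), rotated]) auto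
    from smooth_on_compose[OF this _ sm]
    show "smooth_on e (W \<inter> (p \<circ> h) -` V) (mdim M) (\<psi> \<circ> (p \<circ> h))"
      unfolding eq by (auto simp: o_assoc)
  qed
next
  fix d U c assume c: "c \<in> points (std_dspace M)" and U: "openin (Euclidean_space d) U"
  show "plot (std_dspace M) d U (\<lambda>_. c)"
  proof (rule plot_std_dspaceI[OF U])
    show "continuous_map (subtopology (Euclidean_space d) U) (mtop M) (\<lambda>_. c)"
      using c by (simp add: points_std_dspace)
    fix V \<psi> assume V: "(V, \<psi>) \<in> atlas M"
    show "smooth_on d (U \<inter> (\<lambda>_. c) -` V) (mdim M) (\<psi> \<circ> (\<lambda>_. c))"
    proof (cases "c \<in> V")
      case True
      then show ?thesis
        using smooth_on_const[OF U charted_Rn[OF M V True]] by (simp add: o_def)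
    qed (auto intro: smooth_on_local)
  qed
next
  fix d U p assume U: "openin (Euclidean_space d) U" and
    loc: "\<And>x. x \<in> U \<Longrightarrow>
      \<exists>V. openin (Euclidean_space d) V \<and> x \<in> V \<and> V \<subseteq> U \<and> plot (std_dspace M) d V p"
  show "plot (std_dspace M) d U p"
  proof (rule plot_std_dspaceI[OF U])
    show "continuous_map (subtopology (Euclidean_space d) U) (mtop M) p"
    proof (rule continuous_map_local)
      fix x assume "x \<in> U"
      from loc[OF this] show "\<exists>V. openin (Euclidean_space d) V \<and> x \<in> V \<and> V \<subseteq> U \<and>
          continuous_map (subtopology (Euclidean_space d) V) (mtop M) p"
        unfolding plot_std_dspace by blast
    qed
    fix V \<psi> assume V: "(V, \<psi>) \<in> atlas M"
    show "smooth_on d (U \<inter> p -` V) (mdim M) (\<psi> \<circ> p)"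
    proof (rule smooth_on_local)
      fix x assume x: "x \<in> U \<inter> p -` V"
      then obtain A where A: "x \<in> A" "A \<subseteq> U" "plot (std_dspace M) d A p" using loc by blast
      with plot_std_dspace_chart[OF A(3) V] x
      show "\<exists>A. x \<in> A \<and> A \<subseteq> U \<inter> p -` V \<and> smooth_on d A (mdim M) (\<psi> \<circ> p)"
        by (intro exI[of _ "A \<inter> p -` V"]) auto
    qed
  qed
qed

lemma dspace_eqI:
  fixes X Y :: "'a dspace"
  assumes "points X = points Y" "\<And>d U p. plot X d U p \<longleftrightarrow> plot Y d U p"
  shows "X = Y"
  using assms by (cases X, cases Y) (auto simp: fun_eq_iff)

lemma std_dspace_open_submfd: "std_dspace (open_submfd M W) = sub_dspace (std_dspace M) W"
proof (rule dspace_eqI)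
  show "points (std_dspace (open_submfd M W)) = points (sub_dspace (std_dspace M) W)"
    by (simp add: std_dspace_def sub_dspace_def open_submfd_def)
  fix d U p
  show "plot (std_dspace (open_submfd M W)) d U p \<longleftrightarrow> plot (sub_dspace (std_dspace M) W) d U p"
  proof (cases "openin (Euclidean_space d) U \<and> p ` U \<subseteq> W")
    case True
    then have RU: "Rn d \<inter> U = U" using openin_subset by blast
    have "U \<inter> p -` (V \<inter> W) = U \<inter> p -` V" for V using True by auto
    moreover have "atlas (open_submfd M W) = (\<lambda>(V, \<psi>). (V \<inter> W, \<psi>)) ` atlas M"
      by (auto simp: open_submfd_def image_iff)
    ultimately have "(\<forall>(V, \<psi>)\<in>atlas (open_submfd M W). smooth_on d (U \<inter> p -` V) (mdim M) (\<psi> \<circ> p)) \<longleftrightarrow>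
        (\<forall>(V, \<psi>)\<in>atlas M. smooth_on d (U \<inter> p -` V) (mdim M) (\<psi> \<circ> p))"
      by (simp add: case_prod_beta)
    with RU True show ?thesis
      unfolding plot_std_dspace plot_sub_dspace
      by (auto simp: continuous_map_in_subtopology open_submfd_def)
  next
    case False
    have "Rn d \<inter> U = U" if "openin (Euclidean_space d) U" using openin_subset[OF that] by blast
    with False show ?thesis
      unfolding plot_std_dspace plot_sub_dspace open_submfd_def
      by (auto simp: continuous_map_in_subtopology)
  qed
qed

text \<open>The charts of a product are products of charts. To see that one component of a plot of the product
  is smooth in a chart, the other component is put into a chart around its value; such charts exist
  since the atlases cover, and smoothness is local.\<close>
lemma std_dspace_prod_mfd:
  fixes M :: "'a mfd" and N :: "'b mfd"
  assumes M: "charted M" and N: "charted N"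
  shows "std_dspace (prod_mfd M N) = prod_dspace (std_dspace M) (std_dspace N)"
proof (rule dspace_eqI)
  show "points (std_dspace (prod_mfd M N)) = points (prod_dspace (std_dspace M) (std_dspace N))"
    by (simp add: std_dspace_def prod_dspace_def prod_mfd_def)
  have atl: "(A \<times> B, \<lambda>(x, y). juxt (mdim M) (\<alpha> x) (\<beta> y)) \<in> atlas (prod_mfd M N)"
    if "(A, \<alpha>) \<in> atlas M" "(B, \<beta>) \<in> atlas N" for A B and \<alpha> :: "'a \<Rightarrow> rvec" and \<beta> :: "'b \<Rightarrow> rvec"
    using that by (auto simp: prod_mfd_def)
  have dim: "mdim (prod_mfd M N) = mdim M + mdim N" by (simp add: prod_mfd_def)
  have cont: "continuous_map T (mtop (prod_mfd M N)) p \<longleftrightarrow>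
      continuous_map T (mtop M) (fst \<circ> p) \<and> continuous_map T (mtop N) (snd \<circ> p)" for T p
    by (simp add: prod_mfd_def continuous_map_pairwise)
  fix d U and p :: "rvec \<Rightarrow> 'a \<times> 'b"
  have key: "smooth_on d (U \<inter> p -` (A \<times> B)) (mdim M + mdim N)
        ((\<lambda>(x, y). juxt (mdim M) (\<alpha> x) (\<beta> y)) \<circ> p) \<longleftrightarrow>
      smooth_on d (U \<inter> p -` (A \<times> B)) (mdim M) (\<alpha> \<circ> (fst \<circ> p)) \<and>
      smooth_on d (U \<inter> p -` (A \<times> B)) (mdim N) (\<beta> \<circ> (snd \<circ> p))"
    if A: "(A, \<alpha>) \<in> atlas M" for A B and \<alpha> :: "'a \<Rightarrow> rvec" and \<beta> :: "'b \<Rightarrow> rvec"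
  proof -
    have "(\<alpha> \<circ> (fst \<circ> p)) ` (U \<inter> p -` (A \<times> B)) \<subseteq> Rn (mdim M)"
      using charted_Rn[OF M A] by auto
    from smooth_on_juxt_iff[OF this, of d "mdim N" "\<beta> \<circ> (snd \<circ> p)"]
    show ?thesis by (simp add: o_def case_prod_beta)
  qed
  show "plot (std_dspace (prod_mfd M N)) d U p \<longleftrightarrow>
      plot (prod_dspace (std_dspace M) (std_dspace N)) d U p" (is "?L \<longleftrightarrow> ?R")
  proof
    assume L: ?L
    have U: "openin (Euclidean_space d) U" by (rule plot_std_dspace_openin[OF L])
    have c: "continuous_map (subtopology (Euclidean_space d) U) (mtop M) (fst \<circ> p)"
      "continuous_map (subtopology (Euclidean_space d) U) (mtop N) (snd \<circ> p)"
      using L unfolding plot_std_dspace cont by auto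
    have pM: "p x \<in> mset_of M \<times> mset_of N" if "x \<in> U" for x
      using plot_std_dspace_points[OF L that] by (simp add: prod_mfd_def)
    have sm: "smooth_on d (U \<inter> p -` (A \<times> B)) (mdim M) (\<alpha> \<circ> (fst \<circ> p))"
        "smooth_on d (U \<inter> p -` (A \<times> B)) (mdim N) (\<beta> \<circ> (snd \<circ> p))"
      if AB: "(A, \<alpha>) \<in> atlas M" "(B, \<beta>) \<in> atlas N" for A \<alpha> B \<beta>
      using plot_std_dspace_chart[OF L atl[OF AB]] unfolding dim key[OF AB(1)] by auto
    have "plot (std_dspace M) d U (fst \<circ> p)"
    proof (rule plot_std_dspaceI[OF U c(1)])
      fix A \<alpha> assume A: "(A, \<alpha>) \<in> atlas M"
      show "smooth_on d (U \<inter> (fst \<circ> p) -` A) (mdim M) (\<alpha> \<circ> (fst \<circ> p))"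
      proof (rule smooth_on_local)
        fix x assume x: "x \<in> U \<inter> (fst \<circ> p) -` A"
        then have "snd (p x) \<in> mset_of N" using pM[of x] by (simp add: mem_Times_iff)
        then obtain B \<beta> where "(B, \<beta>) \<in> atlas N" "snd (p x) \<in> B"
          using charted_chart_at[OF N] by blast
        with sm[OF A] x
        show "\<exists>V. x \<in> V \<and> V \<subseteq> U \<inter> (fst \<circ> p) -` A \<and> smooth_on d V (mdim M) (\<alpha> \<circ> (fst \<circ> p))"
          by (intro exI[of _ "U \<inter> p -` (A \<times> B)"]) (auto simp: mem_Times_iff)
      qed
    qed
    moreover have "plot (std_dspace N) d U (snd \<circ> p)"
    proof (rule plot_std_dspaceI[OF U c(2)])
      fix B \<beta> assume B: "(B, \<beta>) \<in> atlas N"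
      show "smooth_on d (U \<inter> (snd \<circ> p) -` B) (mdim N) (\<beta> \<circ> (snd \<circ> p))"
      proof (rule smooth_on_local)
        fix x assume x: "x \<in> U \<inter> (snd \<circ> p) -` B"
        then have "fst (p x) \<in> mset_of M" using pM[of x] by (simp add: mem_Times_iff)
        then obtain A \<alpha> where "(A, \<alpha>) \<in> atlas M" "fst (p x) \<in> A"
          using charted_chart_at[OF M] by blast
        with sm[OF _ B] x
        show "\<exists>V. x \<in> V \<and> V \<subseteq> U \<inter> (snd \<circ> p) -` B \<and> smooth_on d V (mdim N) (\<beta> \<circ> (snd \<circ> p))"
          by (intro exI[of _ "U \<inter> p -` (A \<times> B)"]) (auto simp: mem_Times_iff)
      qed
    qed
    ultimately show ?R by (simp add: plot_prod_dspace)
  next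
    assume R: ?R
    then have p1: "plot (std_dspace M) d U (fst \<circ> p)" and p2: "plot (std_dspace N) d U (snd \<circ> p)"
      by (auto simp: plot_prod_dspace)
    show ?L
    proof (rule plot_std_dspaceI)
      show "openin (Euclidean_space d) U" by (rule plot_std_dspace_openin[OF p1])
      show "continuous_map (subtopology (Euclidean_space d) U) (mtop (prod_mfd M N)) p"
        using p1 p2 unfolding plot_std_dspace cont by auto
      fix C \<gamma> assume "(C, \<gamma>) \<in> atlas (prod_mfd M N)"
      then obtain A \<alpha> B \<beta> where C: "C = A \<times> B" "\<gamma> = (\<lambda>(x, y). juxt (mdim M) (\<alpha> x) (\<beta> y))"
          and A: "(A, \<alpha>) \<in> atlas M" and B: "(B, \<beta>) \<in> atlas N"
        by (auto simp: prod_mfd_def)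
      note s1 = plot_std_dspace_chart[OF p1 A] and s2 = plot_std_dspace_chart[OF p2 B]
      have eq: "U \<inter> p -` (A \<times> B) = (U \<inter> (fst \<circ> p) -` A) \<inter> (U \<inter> (snd \<circ> p) -` B)"
        by (auto simp: mem_Times_iff)
      have op: "openin (Euclidean_space d) (U \<inter> p -` (A \<times> B))"
        unfolding eq by (intro openin_Int smooth_on_openin[OF s1] smooth_on_openin[OF s2])
      show "smooth_on d (U \<inter> p -` C) (mdim (prod_mfd M N)) (\<gamma> \<circ> p)"
        unfolding C dim key[OF A]
        using smooth_on_subset[OF s1 _ op] smooth_on_subset[OF s2 _ op] unfolding eq by auto
    qed
  qed
qed

lemma plot_std_euclid: "plot (std_dspace (euclid_mfd e)) d U p \<longleftrightarrow> smooth_on d U e p"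
proof
  assume L: "plot (std_dspace (euclid_mfd e)) d U p"
  have "(Rn e, id) \<in> atlas (euclid_mfd e)" "mdim (euclid_mfd e) = e" by (simp_all add: euclid_mfd_def)
  with plot_std_dspace_chart[OF L] have "smooth_on d (U \<inter> p -` Rn e) e (id \<circ> p)" by metis
  moreover have "U \<inter> p -` Rn e = U"
    using plot_std_dspace_points[OF L] by (auto simp: euclid_mfd_def)
  ultimately show "smooth_on d U e p" by simp
next
  assume R: "smooth_on d U e p"
  then have "U \<inter> p -` Rn e = U" using smooth_on_Rn by blast
  with R show "plot (std_dspace (euclid_mfd e)) d U p"
    using smooth_on_openin[OF R] smooth_on_continuous_map[OF R]
    by (auto simp: plot_std_dspace euclid_mfd_def)
qed

lemma points_std_euclid: "points (std_dspace (euclid_mfd e)) = Rn e"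
  by (simp add: std_dspace_def euclid_mfd_def)

text \<open>Around each point, \<open>F \<circ> p\<close> in the target chart is the coordinate expression of \<open>F\<close> composed with
  that of \<open>p\<close> in a chart of \<open>M\<close>, so the claim is the chain rule.\<close>
lemma smooth_map_imp_dsmooth:
  assumes M: "charted M" and F: "smooth_map M N F"
  shows "dsmooth (std_dspace M) (std_dspace N) F"
  unfolding dsmooth_def
proof (intro conjI allI impI)
  have Fc: "continuous_map (mtop M) (mtop N) F" using F by (simp add: smooth_map_def)
  show "F ` points (std_dspace M) \<subseteq> points (std_dspace N)"
    using continuous_map_image_subset_topspace[OF Fc] by (simp add: points_std_dspace)
  fix d U p assume p: "plot (std_dspace M) d U p"
  show "plot (std_dspace N) d U (F \<circ> p)"
  proof (rule plot_std_dspaceI[OF plot_std_dspace_openin[OF p]])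
    show "continuous_map (subtopology (Euclidean_space d) U) (mtop N) (F \<circ> p)"
      using p Fc continuous_map_compose unfolding plot_std_dspace by blast
    fix W \<psi> assume W: "(W, \<psi>) \<in> atlas N"
    show "smooth_on d (U \<inter> (F \<circ> p) -` W) (mdim N) (\<psi> \<circ> (F \<circ> p))"
    proof (rule smooth_on_local)
      fix x assume x: "x \<in> U \<inter> (F \<circ> p) -` W"
      then obtain A \<alpha> where A: "(A, \<alpha>) \<in> atlas M" "p x \<in> A"
        using charted_chart_at[OF M] plot_std_dspace_points[OF p] by blast
      have G: "smooth_on (mdim M) (\<alpha> ` (A \<inter> F -` W)) (mdim N) (\<psi> \<circ> F \<circ> inv_into A \<alpha>)"
        using F A(1) W unfolding smooth_map_def by blast
      note sp = plot_std_dspace_chart[OF p A(1)]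
      define D where "D = U \<inter> p -` A \<inter> (\<alpha> \<circ> p) -` (\<alpha> ` (A \<inter> F -` W))"
      have "openin (Euclidean_space d) D"
        unfolding D_def by (rule smooth_on_preimage[OF sp smooth_on_openin[OF G]])
      then have "smooth_on d D (mdim M) (\<alpha> \<circ> p)"
        by (rule smooth_on_subset[OF sp, rotated]) (auto simp: D_def)
      moreover have "(\<alpha> \<circ> p) ` D \<subseteq> \<alpha> ` (A \<inter> F -` W)" by (auto simp: D_def)
      ultimately have "smooth_on d D (mdim N) (\<psi> \<circ> F \<circ> inv_into A \<alpha> \<circ> (\<alpha> \<circ> p))"
        by (rule smooth_on_compose[OF _ _ G])
      then have "smooth_on d D (mdim N) (\<psi> \<circ> (F \<circ> p))"
      proof (rule smooth_on_cong)
        fix y assume "y \<in> D"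
        then have "p y \<in> A" by (simp add: D_def)
        then show "(\<psi> \<circ> F \<circ> inv_into A \<alpha> \<circ> (\<alpha> \<circ> p)) y = (\<psi> \<circ> (F \<circ> p)) y"
          by (simp add: inv_into_f_f[OF charted_inj[OF M A(1)]])
      qed
      moreover have "x \<in> D" using x A(2) by (auto simp: D_def)
      moreover have "D \<subseteq> U \<inter> (F \<circ> p) -` W"
      proof
        fix y assume "y \<in> D"
        then have y: "y \<in> U" "p y \<in> A" "\<alpha> (p y) \<in> \<alpha> ` (A \<inter> F -` W)" by (auto simp: D_def)
        then have "p y \<in> A \<inter> F -` W"
          using inj_on_image_mem_iff[OF charted_inj[OF M A(1)], of "p y" "A \<inter> F -` W"] by blast
        with y show "y \<in> U \<inter> (F \<circ> p) -` W" by simp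
      qed
      ultimately show "\<exists>V. x \<in> V \<and> V \<subseteq> U \<inter> (F \<circ> p) -` W \<and> smooth_on d V (mdim N) (\<psi> \<circ> (F \<circ> p))"
        by blast
    qed
  qed
qed

lemma mfd_diffeo_imp_ddiffeo:
  assumes "charted M" "charted N" "mfd_diffeo M N F"
  shows "ddiffeo (std_dspace M) (std_dspace N) F"
proof -
  have F: "bij_betw F (mset_of M) (mset_of N)" "smooth_map M N F"
      "smooth_map N M (inv_into (mset_of M) F)"
    using assms(3) by (simp_all add: mfd_diffeo_def)
  show ?thesis
    using F(1) smooth_map_imp_dsmooth[OF assms(1) F(2)] smooth_map_imp_dsmooth[OF assms(2) F(3)]
    by (simp add: ddiffeo_def points_std_dspace)
qed

section \<open>A space glued from an open cover\<close>

text \<open>The setting common to base and total space: open pieces \<open>W i\<close> of \<open>X\<close> with coordinates \<open>\<Phi> i\<close> in model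
  spaces. As \<open>X\<close> carries no topology, open means that preimages under plots are open. The gluing data between
  the models, \<open>A\<close> and \<open>f\<close>, are determined by the overlaps and the changes of coordinates; these are
  expressed through points of \<open>X\<close>, because all proofs below start from such points rather than from
  partial inverses of the coordinates.\<close>
locale open_chart_cover =
  fixes X :: "'a dspace" and I :: "'i set" and W :: "'i \<Rightarrow> 'a set"
    and Y :: "'i \<Rightarrow> 'c dspace" and \<Phi> :: "'i \<Rightarrow> 'a \<Rightarrow> 'c"
    and A :: "'i \<Rightarrow> 'i \<Rightarrow> 'c set" and f :: "'i \<Rightarrow> 'i \<Rightarrow> 'c \<Rightarrow> 'c"
  assumes X: "diffeological_space X"
    and Y: "i \<in> I \<Longrightarrow> diffeological_space (Y i)"
    and cover: "points X = (\<Union>i\<in>I. W i)"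
    and preimage_open: "i \<in> I \<Longrightarrow> plot X d U p \<Longrightarrow> openin (Euclidean_space d) (U \<inter> p -` W i)"
    and chart: "i \<in> I \<Longrightarrow> ddiffeo (sub_dspace X (W i)) (Y i) (\<Phi> i)"
    and overlap: "i \<in> I \<Longrightarrow> j \<in> I \<Longrightarrow> points (Y i) \<inter> A i j = \<Phi> i ` (W i \<inter> W j)"
    and transition: "i \<in> I \<Longrightarrow> j \<in> I \<Longrightarrow> x \<in> W i \<inter> W j \<Longrightarrow> f i j (\<Phi> i x) = \<Phi> j x"
begin

definition gl :: "(('i \<times> 'c) \<times> ('i \<times> 'c)) set" where
  "gl = glue_rel I (\<lambda>i. points (Y i)) A f"

definition glued :: "('i \<times> 'c) set dspace" where
  "glued = quot_dspace (disjoint_union_dspace I Y) gl"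

text \<open>The coordinates of \<open>x\<close> in all charts around it: the class that corresponds to \<open>x\<close> in the glued
  space.\<close>
definition reps :: "'a \<Rightarrow> ('i \<times> 'c) set" where
  "reps x = {(i, \<Phi> i x) |i. i \<in> I \<and> x \<in> W i}"

lemma W_subset: "i \<in> I \<Longrightarrow> W i \<subseteq> points X"
  using cover by blast

lemma points_sub_W: "i \<in> I \<Longrightarrow> points (sub_dspace X (W i)) = W i"
  using W_subset by (auto simp: points_sub_dspace)

lemma bij_chart: "i \<in> I \<Longrightarrow> bij_betw (\<Phi> i) (W i) (points (Y i))"
  using chart[of i] points_sub_W[of i] by (simp add: ddiffeo_def)

lemma chart_inv: "i \<in> I \<Longrightarrow> x \<in> W i \<Longrightarrow> inv_into (W i) (\<Phi> i) (\<Phi> i x) = x"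
  using bij_chart[of i] by (simp add: bij_betw_def inv_into_f_f)

lemma chart_in: "i \<in> I \<Longrightarrow> x \<in> W i \<Longrightarrow> \<Phi> i x \<in> points (Y i)"
  using bij_chart[of i] by (auto simp: bij_betw_def)

lemma chart_inv_in: "i \<in> I \<Longrightarrow> a \<in> points (Y i) \<Longrightarrow> inv_into (W i) (\<Phi> i) a \<in> W i"
  and chart_chart_inv: "i \<in> I \<Longrightarrow> a \<in> points (Y i) \<Longrightarrow> \<Phi> i (inv_into (W i) (\<Phi> i) a) = a"
  using bij_chart[of i] by (auto simp: bij_betw_def inv_into_into f_inv_into_f)

lemma chart_smooth: "i \<in> I \<Longrightarrow> plot X d U p \<Longrightarrow> p ` U \<subseteq> W i \<Longrightarrow> plot (Y i) d U (\<Phi> i \<circ> p)"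
  using chart[of i] by (auto simp: ddiffeo_def plot_sub_dspace dest: dsmooth_plot)

lemma chart_inv_smooth: "i \<in> I \<Longrightarrow> plot (Y i) d U p \<Longrightarrow> plot X d U (inv_into (W i) (\<Phi> i) \<circ> p)"
  using chart[of i] dsmooth_plot[of "Y i" "sub_dspace X (W i)" "inv_into (W i) (\<Phi> i)" d U p]
  by (auto simp: ddiffeo_def plot_sub_dspace points_sub_W)

text \<open>Every elementary identification \<open>(i, a) \<sim> (j, f i j a)\<close> preserves the point of \<open>X\<close> that a
  representative stands for, and two representatives of the same point are related in one step.\<close>

lemma gl_iff: "(s, t) \<in> gl \<longleftrightarrow> (\<exists>x\<in>points X. s \<in> reps x \<and> t \<in> reps x)"
proof
  let ?r = "\<lambda>s t. \<exists>i\<in>I. \<exists>j\<in>I. \<exists>a \<in> points (Y i) \<inter> A i j. s = (i, a) \<and> t = (j, f i j a)"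
  define pt where "pt s = inv_into (W (fst s)) (\<Phi> (fst s)) (snd s)" for s :: "'i \<times> 'c"
  have step: "pt s = pt t" if st: "?r s t" for s t
  proof -
    obtain i j a where ij: "i \<in> I" "j \<in> I" "a \<in> points (Y i) \<inter> A i j" "s = (i, a)" "t = (j, f i j a)"
      using st by blast
    then obtain x where x: "x \<in> W i \<inter> W j" "a = \<Phi> i x"
      using overlap[OF ij(1,2)] by blast
    then show ?thesis
      using ij transition[OF ij(1,2) x(1)] chart_inv by (simp add: pt_def)
  qed
  assume "(s, t) \<in> gl"
  then have s: "s \<in> Sigma I (\<lambda>i. points (Y i))" and t: "t \<in> Sigma I (\<lambda>i. points (Y i))"
      and st: "equivclp ?r s t"
    by (auto simp: gl_def glue_rel_def)
  from st have eq: "pt s = pt t"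
  proof (induction rule: equivclp_induct)
    case (step u v)
    then show ?case using \<open>\<And>t s. ?r s t \<Longrightarrow> pt s = pt t\<close> by metis
  qed simp
  have r: "u \<in> reps (pt u) \<and> pt u \<in> points X" if u: "u \<in> Sigma I (\<lambda>i. points (Y i))" for u
  proof -
    obtain i a where ia: "u = (i, a)" "i \<in> I" "a \<in> points (Y i)" using u by auto
    then show ?thesis
      using chart_inv_in[OF ia(2,3)] chart_chart_inv[OF ia(2,3)] W_subset[OF ia(2)]
      by (auto simp: pt_def reps_def)
  qed
  show "\<exists>x\<in>points X. s \<in> reps x \<and> t \<in> reps x"
    using r[OF s] r[OF t] eq by metis
next
  assume "\<exists>x\<in>points X. s \<in> reps x \<and> t \<in> reps x"
  then obtain x i j where ij: "i \<in> I" "j \<in> I" "x \<in> W i \<inter> W j" "s = (i, \<Phi> i x)" "t = (j, \<Phi> j x)"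
    by (auto simp: reps_def)
  let ?r = "\<lambda>s t. \<exists>i\<in>I. \<exists>j\<in>I. \<exists>a \<in> points (Y i) \<inter> A i j. s = (i, a) \<and> t = (j, f i j a)"
  have "\<Phi> i x \<in> points (Y i) \<inter> A i j" using overlap[OF ij(1,2)] ij(3) by blast
  then have "?r s t"
    using ij transition[OF ij(1,2,3)] by metis
  then have "equivclp ?r s t" by (rule r_into_equivclp)
  then show "(s, t) \<in> gl"
    using ij chart_in by (auto simp: gl_def glue_rel_def)
qed

lemma reps_nonempty: "x \<in> points X \<Longrightarrow> reps x \<noteq> {}"
  using cover by (auto simp: reps_def)

lemma reps_unique: "s \<in> reps x \<Longrightarrow> s \<in> reps y \<Longrightarrow> x = y"
  unfolding reps_def using chart_inv by (auto; metis)

text \<open>To identify a class it suffices to know some of its representatives. This computes the projection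
  and the operations of a glued pseudo-bundle, which are defined as the classes of sets of results.\<close>
lemma gl_class:
  assumes "x \<in> points X" "S \<noteq> {}" "S \<subseteq> reps x"
  shows "gl `` S = reps x"
proof
  show "gl `` S \<subseteq> reps x"
  proof
    fix t assume "t \<in> gl `` S"
    then obtain s y where "s \<in> S" "s \<in> reps y" "t \<in> reps y" by (auto simp: gl_iff)
    with assms(3) show "t \<in> reps x" using reps_unique[of s x y] by blast
  qed
  show "reps x \<subseteq> gl `` S"
  proof
    fix t assume "t \<in> reps x"
    moreover obtain s where "s \<in> S" using assms(2) by blast
    ultimately have "(s, t) \<in> gl" using assms(1,3) unfolding gl_iff by blast
    with \<open>s \<in> S\<close> show "t \<in> gl `` S" by blast
  qed
qed

lemma points_glued: "points glued = reps ` points X"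
proof -
  have "points glued = Sigma I (\<lambda>i. points (Y i)) // gl"
    by (simp add: glued_def quot_dspace_def disjoint_union_dspace_def)
  also have "\<dots> = reps ` points X"
  proof
    show "Sigma I (\<lambda>i. points (Y i)) // gl \<subseteq> reps ` points X"
    proof
      fix C assume "C \<in> Sigma I (\<lambda>i. points (Y i)) // gl"
      then obtain i a where ia: "i \<in> I" "a \<in> points (Y i)" "C = gl `` {(i, a)}"
        by (auto elim!: quotientE)
      define x where "x = inv_into (W i) (\<Phi> i) a"
      have x: "x \<in> W i" "(i, a) = (i, \<Phi> i x)"
        using chart_inv_in[OF ia(1,2)] chart_chart_inv[OF ia(1,2)] by (auto simp: x_def)
      then have "gl `` {(i, a)} = reps x"
        using W_subset[OF ia(1)] ia(1) by (intro gl_class) (auto simp: reps_def)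
      then show "C \<in> reps ` points X"
        using ia(3) x(1) W_subset[OF ia(1)] by blast
    qed
    show "reps ` points X \<subseteq> Sigma I (\<lambda>i. points (Y i)) // gl"
    proof clarify
      fix x assume x: "x \<in> points X"
      then obtain i where i: "i \<in> I" "x \<in> W i" using cover by blast
      then have "gl `` {(i, \<Phi> i x)} = reps x"
        using x by (intro gl_class) (auto simp: reps_def)
      then show "reps x \<in> Sigma I (\<lambda>i. points (Y i)) // gl"
        using quotientI[of "(i, \<Phi> i x)" "Sigma I (\<lambda>i. points (Y i))" gl] i chart_in by auto
    qed
  qed
  finally show ?thesis .
qed

lemma diffeological_glued: "diffeological_space glued"
  unfolding glued_def by (intro diffeological_quot diffeological_disjoint_union Y)

lemma inj_reps: "inj_on reps (points X)"
  by (rule inj_onI) (metis reps_nonempty reps_unique ex_in_conv)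

text \<open>The part of a plot of \<open>X\<close> that runs in \<open>W i\<close> is defined on an open set, where its coordinates under
  \<open>\<Phi> i\<close> lift it to the disjoint union.\<close>
lemma reps_smooth: "dsmooth X glued reps"
  unfolding dsmooth_def
proof (intro conjI allI impI)
  show "reps ` points X \<subseteq> points glued" by (simp add: points_glued)
  fix d U p assume p: "plot X d U p"
  have "\<exists>V q. x \<in> V \<and> V \<subseteq> U \<and> plot (disjoint_union_dspace I Y) d V q \<and>
      (\<forall>y\<in>V. (reps \<circ> p) y = gl `` {q y})" if x: "x \<in> U" for x
  proof -
    have "p x \<in> points X" by (rule plot_in_points[OF X p x])
    then obtain i where i: "i \<in> I" "p x \<in> W i" using cover by blast
    define V where "V = U \<inter> p -` W i"
    have V: "openin (Euclidean_space d) V"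
      unfolding V_def by (rule preimage_open[OF i(1) p])
    have "plot X d V p" by (rule plot_subset[OF X p _ V]) (auto simp: V_def)
    then have "plot (Y i) d V (\<Phi> i \<circ> p)" by (rule chart_smooth[OF i(1)]) (auto simp: V_def)
    then have "plot (disjoint_union_dspace I Y) d V (\<lambda>y. (i, \<Phi> i (p y)))"
      using V i(1) by (auto simp: disjoint_union_dspace_def intro!: exI[of _ V] exI[of _ i] exI[of _ "\<Phi> i \<circ> p"])
    moreover have "reps (p y) = gl `` {(i, \<Phi> i (p y))}" if "y \<in> V" for y
    proof -
      have "p y \<in> W i" using that by (simp add: V_def)
      then show ?thesis
        using i(1) W_subset[OF i(1)] by (intro gl_class[symmetric]) (auto simp: reps_def)
    qed
    ultimately show ?thesis
      using x i(2) by (intro exI[of _ V] exI[of _ "\<lambda>y. (i, \<Phi> i (p y))"]) (auto simp: V_def)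
  qed
  then show "plot glued d U (reps \<circ> p)"
    using plot_openin[OF X p] by (simp add: glued_def quot_dspace_def)
qed

text \<open>Locally, a plot of the glued space lifts to a plot of a single model \<open>Y i\<close>, and there the inverse
  is the smooth inverse of \<open>\<Phi> i\<close>.\<close>
lemma reps_inv_smooth: "dsmooth glued X (inv_into (points X) reps)"
  unfolding dsmooth_def
proof (intro conjI allI impI)
  show "inv_into (points X) reps ` points glued \<subseteq> points X"
    by (auto simp: points_glued intro!: inv_into_into)
  fix d U P assume P: "plot glued d U P"
  show "plot X d U (inv_into (points X) reps \<circ> P)"
  proof (rule plot_local[OF X])
    fix x assume "x \<in> U"
    then obtain V q where V: "x \<in> V" "V \<subseteq> U" "plot (disjoint_union_dspace I Y) d V q"
        "\<forall>y\<in>V. P y = gl `` {q y}"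
      using P unfolding glued_def quot_dspace_def by auto
    then obtain V' i r where V': "x \<in> V'" "V' \<subseteq> V" "i \<in> I" "plot (Y i) d V' r"
        "\<forall>y\<in>V'. q y = (i, r y)"
      unfolding disjoint_union_dspace_def by auto
    have "plot X d V' (inv_into (points X) reps \<circ> P)"
    proof (rule plot_cong[OF X chart_inv_smooth[OF V'(3,4)]])
      fix y assume y: "y \<in> V'"
      define z where "z = inv_into (W i) (\<Phi> i) (r y)"
      have r: "r y \<in> points (Y i)" by (rule plot_in_points[OF Y[OF V'(3)] V'(4) y])
      have z: "z \<in> W i" "\<Phi> i z = r y"
        unfolding z_def by (rule chart_inv_in[OF V'(3) r], rule chart_chart_inv[OF V'(3) r])
      then have "z \<in> points X" using W_subset[OF V'(3)] by blast
      have "P y = gl `` {(i, r y)}" using V(4) V'(2,5) y by auto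
      also have "\<dots> = reps z"
        using z V'(3) \<open>z \<in> points X\<close> by (intro gl_class) (auto simp: reps_def)
      finally have "inv_into (points X) reps (P y) = z"
        using inv_into_f_f[OF inj_reps \<open>z \<in> points X\<close>] by simp
      then show "(inv_into (points X) reps \<circ> P) y = (inv_into (W i) (\<Phi> i) \<circ> r) y"
        by (simp add: z_def)
    qed
    then show "\<exists>V. x \<in> V \<and> V \<subseteq> U \<and> plot X d V (inv_into (points X) reps \<circ> P)"
      using V V' by blast
  qed
qed

lemma ddiffeo_reps: "ddiffeo X glued reps"
  unfolding ddiffeo_def
  using inj_reps points_glued reps_smooth reps_inv_smooth by (simp add: bij_betw_def)

lemma transition_smooth:
  assumes ij: "i \<in> I" "j \<in> I"
  shows "dsmooth (sub_dspace (Y i) (A i j)) (Y j) (f i j)"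
  unfolding dsmooth_def
proof (intro conjI allI impI)
  have inv: "inv_into (W i) (\<Phi> i) a \<in> W i \<inter> W j \<and> f i j a = \<Phi> j (inv_into (W i) (\<Phi> i) a)"
    if a: "a \<in> points (Y i) \<inter> A i j" for a
  proof -
    obtain x where x: "x \<in> W i \<inter> W j" "a = \<Phi> i x"
      using a unfolding overlap[OF ij] by blast
    then show ?thesis using transition[OF ij x(1)] chart_inv[OF ij(1)] by simp
  qed
  show "f i j ` points (sub_dspace (Y i) (A i j)) \<subseteq> points (Y j)"
    using inv chart_in[OF ij(2)] by (auto simp: points_sub_dspace)
  fix d U q assume "plot (sub_dspace (Y i) (A i j)) d U q"
  then have q: "plot (Y i) d U q" "q ` U \<subseteq> A i j" by (auto simp: plot_sub_dspace)
  have qA: "q x \<in> points (Y i) \<inter> A i j" if "x \<in> U" for x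
    using plot_in_points[OF Y[OF ij(1)] q(1) that] q(2) that by blast
  have "plot (Y j) d U (\<Phi> j \<circ> (inv_into (W i) (\<Phi> i) \<circ> q))"
    by (rule chart_smooth[OF ij(2) chart_inv_smooth[OF ij(1) q(1)]]) (use inv qA in auto)
  then show "plot (Y j) d U (f i j \<circ> q)"
    by (rule plot_cong[OF Y[OF ij(2)]]) (use inv qA in auto)
qed

end

section \<open>Pseudo-bundles\<close>

lemma real_vector_space_on_axioms:
  assumes "real_vector_space_on S pls scl zer"
  shows "zer \<in> S" and "\<forall>u\<in>S. \<forall>v\<in>S. pls u v \<in> S" and "\<forall>r. \<forall>v\<in>S. scl r v \<in> S"
    and "\<forall>u\<in>S. \<forall>v\<in>S. \<forall>w\<in>S. pls (pls u v) w = pls u (pls v w)"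
    and "\<forall>u\<in>S. \<forall>v\<in>S. pls u v = pls v u"
    and "\<forall>v\<in>S. pls zer v = v" and "\<forall>v\<in>S. \<exists>w\<in>S. pls v w = zer"
    and "\<forall>r. \<forall>u\<in>S. \<forall>v\<in>S. scl r (pls u v) = pls (scl r u) (scl r v)"
    and "\<forall>r s. \<forall>v\<in>S. scl (r + s) v = pls (scl r v) (scl s v)"
    and "\<forall>r s. \<forall>v\<in>S. scl (r * s) v = scl r (scl s v)"
    and "\<forall>v\<in>S. scl 1 v = v"
  using assms unfolding real_vector_space_on_def by - (elim conjE, assumption)+

text \<open>The axioms are closure conditions, equations and the existence of negatives, all of which pass to
  images under a map that respects the operations.\<close>
lemma real_vector_space_on_image:
  assumes V: "real_vector_space_on S pls scl zer"
    and add: "\<And>u v. u \<in> S \<Longrightarrow> v \<in> S \<Longrightarrow> F (pls u v) = pls' (F u) (F v)"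
    and scale: "\<And>r v. v \<in> S \<Longrightarrow> F (scl r v) = scl' r (F v)"
  shows "real_vector_space_on (F ` S) pls' scl' (F zer)"
proof -
  note ax = real_vector_space_on_axioms[OF V, rule_format]
  show ?thesis
    unfolding real_vector_space_on_def
  proof (intro conjI ballI allI)
    show "F zer \<in> F ` S" using ax(1) by simp
    fix u v w assume uvw: "u \<in> F ` S" "v \<in> F ` S" "w \<in> F ` S"
    then obtain a b c where abc: "a \<in> S" "b \<in> S" "c \<in> S" and [simp]: "u = F a" "v = F b" "w = F c"
      by blast
    note [simp] = abc ax(1-3) add[symmetric] scale[symmetric]
    show "pls' (pls' u v) w = pls' u (pls' v w)" by (simp add: ax(4))
  next
    fix u v assume uv: "u \<in> F ` S" "v \<in> F ` S"
    then obtain a b where ab: "a \<in> S" "b \<in> S" and [simp]: "u = F a" "v = F b"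
      by blast
    note [simp] = ab ax(1-3) add[symmetric] scale[symmetric]
    show "pls' u v \<in> F ` S" by simp
    show "pls' u v = pls' v u" by (simp add: ax(5)[of a b])
    show "scl' r (pls' u v) = pls' (scl' r u) (scl' r v)" for r by (simp add: ax(8))
  next
    fix v assume v: "v \<in> F ` S"
    then obtain b where b: "b \<in> S" and [simp]: "v = F b"
      by blast
    note [simp] = b ax(1-3) add[symmetric] scale[symmetric]
    show "scl' r v \<in> F ` S" for r by simp
    show "pls' (F zer) v = v" by (simp add: ax(6))
    obtain c where "c \<in> S" "pls b c = zer" using ax(7)[OF b] by blast
    then show "\<exists>w\<in>F ` S. pls' v w = F zer" by (intro bexI[of _ "F c"]) auto
    show "scl' (r + s) v = pls' (scl' r v) (scl' s v)" for r s by (simp add: ax(9))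
    show "scl' (r * s) v = scl' r (scl' s v)" for r s by (simp add: ax(10))
    show "scl' 1 v = v" by (simp add: ax(11))
  qed
qed

text \<open>Each structure map of \<open>Q\<close> is the conjugate of the one of \<open>P\<close> by the isomorphism, so it is smooth.
  That the spaces of \<open>Q\<close> are diffeological is a separate assumption, because a diffeomorphism does not
  control maps whose values lie outside the set of points.\<close>
lemma pseudo_bundle_iso:
  assumes P: "pseudo_bundle P" and iso: "pbundle_iso P Q F f"
    and T: "diffeological_space (total Q)" and B: "diffeological_space (base Q)"
    and zero: "\<And>x. x \<in> points (base P) \<Longrightarrow> fib_zero Q (f x) = F (fib_zero P x)"
  shows "pseudo_bundle Q"
proof -
  let ?G = "inv_into (points (total P)) F" and ?g = "inv_into (points (base P)) f"
  have P_T: "diffeological_space (total P)" and P_B: "diffeological_space (base P)"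
    and P_proj: "dsmooth (total P) (base P) (proj P)" "proj P ` points (total P) = points (base P)"
    and P_vs: "\<And>x. x \<in> points (base P) \<Longrightarrow> real_vector_space_on {v \<in> points (total P). proj P v = x}
          (fib_add P) (fib_scale P) (fib_zero P x)"
    and P_add: "dsmooth (sub_dspace (prod_dspace (total P) (total P)) {(u, v). proj P u = proj P v})
       (total P) (\<lambda>(u, v). fib_add P u v)"
    and P_scale: "dsmooth (prod_dspace real_dspace (total P)) (total P) (\<lambda>(r, v). fib_scale P r v)"
    and P_zero: "dsmooth (base P) (total P) (fib_zero P)"
    using P unfolding pseudo_bundle_def by simp_all
  have F_bij: "bij_betw F (points (total P)) (points (total Q))"
    and F: "dsmooth (total P) (total Q) F" and G: "dsmooth (total Q) (total P) ?G"
    and f_bij: "bij_betw f (points (base P)) (points (base Q))"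
    and f: "dsmooth (base P) (base Q) f" and g: "dsmooth (base Q) (base P) ?g"
    and proj: "\<And>v. v \<in> points (total P) \<Longrightarrow> proj Q (F v) = f (proj P v)"
    and add: "\<And>u v. u \<in> points (total P) \<Longrightarrow> v \<in> points (total P) \<Longrightarrow> proj P u = proj P v \<Longrightarrow>
        F (fib_add P u v) = fib_add Q (F u) (F v)"
    and scale: "\<And>r v. v \<in> points (total P) \<Longrightarrow> F (fib_scale P r v) = fib_scale Q r (F v)"
    using iso unfolding pbundle_iso_def ddiffeo_def by simp_all
  have P_proj_in: "v \<in> points (total P) \<Longrightarrow> proj P v \<in> points (base P)" for v
    using P_proj(2) by blast
  have G_in: "w \<in> points (total Q) \<Longrightarrow> ?G w \<in> points (total P)"
    and FG: "w \<in> points (total Q) \<Longrightarrow> F (?G w) = w" for w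
    using F_bij by (auto simp: bij_betw_def inv_into_into f_inv_into_f)
  have g_in: "y \<in> points (base Q) \<Longrightarrow> ?g y \<in> points (base P)"
    and fg: "y \<in> points (base Q) \<Longrightarrow> f (?g y) = y" for y
    using f_bij by (auto simp: bij_betw_def inv_into_into f_inv_into_f)
  have fib: "proj P (?G u) = proj P (?G v)"
    if "u \<in> points (total Q)" "v \<in> points (total Q)" "proj Q u = proj Q v" for u v
  proof -
    have "f (proj P (?G u)) = f (proj P (?G v))"
      using that proj[OF G_in] FG by metis
    then show ?thesis
      using f_bij P_proj_in G_in that by (metis bij_betw_def inj_onD)
  qed
  show ?thesis
    unfolding pseudo_bundle_def
  proof (intro conjI ballI)
    show "diffeological_space (total Q)" "diffeological_space (base Q)" by fact+
    have im: "proj Q ` points (total Q) = f ` points (base P)"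
    proof -
      have "proj Q ` points (total Q) = proj Q ` F ` points (total P)"
        using F_bij by (simp add: bij_betw_def)
      also have "\<dots> = f ` proj P ` points (total P)"
        using proj by (simp add: image_image)
      finally show ?thesis by (simp add: P_proj(2))
    qed
    then show im': "proj Q ` points (total Q) = points (base Q)"
      using f_bij by (simp add: bij_betw_def)
    show "dsmooth (total Q) (base Q) (proj Q)"
      unfolding dsmooth_def
    proof (intro conjI allI impI)
      show "proj Q ` points (total Q) \<subseteq> points (base Q)" using im' by simp
      fix d U q assume q: "plot (total Q) d U q"
      have "plot (base Q) d U (f \<circ> (proj P \<circ> (?G \<circ> q)))"
        by (rule dsmooth_plot[OF f dsmooth_plot[OF P_proj(1) dsmooth_plot[OF G q]]])
      then show "plot (base Q) d U (proj Q \<circ> q)"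
      proof (rule plot_cong[OF B])
        fix x assume "x \<in> U"
        from plot_in_points[OF T q this] show "(proj Q \<circ> q) x = (f \<circ> (proj P \<circ> (?G \<circ> q))) x"
          using proj[OF G_in] FG by simp
      qed
    qed
    show "real_vector_space_on {v \<in> points (total Q). proj Q v = y} (fib_add Q) (fib_scale Q) (fib_zero Q y)"
      if y: "y \<in> points (base Q)" for y
    proof -
      define x where "x = ?g y"
      have x: "x \<in> points (base P)" "f x = y" using g_in[OF y] fg[OF y] by (simp_all add: x_def)
      have "real_vector_space_on (F ` {v \<in> points (total P). proj P v = x}) (fib_add Q) (fib_scale Q)
          (F (fib_zero P x))"
        by (rule real_vector_space_on_image[OF P_vs[OF x(1)]]) (auto simp: add scale)
      moreover have "F ` {v \<in> points (total P). proj P v = x} = {v \<in> points (total Q). proj Q v = y}"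
      proof
        show "F ` {v \<in> points (total P). proj P v = x} \<subseteq> {v \<in> points (total Q). proj Q v = y}"
          using F_bij proj x(2) by (auto simp: bij_betw_def)
        show "{v \<in> points (total Q). proj Q v = y} \<subseteq> F ` {v \<in> points (total P). proj P v = x}"
        proof
          fix v assume "v \<in> {v \<in> points (total Q). proj Q v = y}"
          then have v: "v \<in> points (total Q)" "proj Q v = y" by auto
          have "f (proj P (?G v)) = f x" using proj[OF G_in[OF v(1)]] FG[OF v(1)] v(2) x(2) by simp
          then have "proj P (?G v) = x"
            using f_bij P_proj_in[OF G_in[OF v(1)]] x(1) by (metis bij_betw_def inj_onD)
          then show "v \<in> F ` {v \<in> points (total P). proj P v = x}"
            using G_in[OF v(1)] FG[OF v(1)] by (intro image_eqI[of _ _ "?G v"]) auto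
        qed
      qed
      ultimately show ?thesis using zero[OF x(1)] x(2) by simp
    qed
    show "dsmooth (sub_dspace (prod_dspace (total Q) (total Q)) {(u, v). proj Q u = proj Q v})
        (total Q) (\<lambda>(u, v). fib_add Q u v)"
      unfolding dsmooth_def
    proof (intro conjI allI impI)
      have Qadd: "fib_add Q u v = F (fib_add P (?G u) (?G v))"
        if "u \<in> points (total Q)" "v \<in> points (total Q)" "proj Q u = proj Q v" for u v
        using add[OF G_in[OF that(1)] G_in[OF that(2)] fib[OF that]] FG that by simp
      have Padd_in: "fib_add P (?G u) (?G v) \<in> points (total P)"
        if "u \<in> points (total Q)" "v \<in> points (total Q)" "proj Q u = proj Q v" for u v
        using dsmooth_points[OF P_add, of "(?G u, ?G v)"] G_in that fib[OF that]
        by (simp add: points_sub_dspace points_prod_dspace)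
      show "(\<lambda>(u, v). fib_add Q u v) ` points (sub_dspace (prod_dspace (total Q) (total Q)) {(u, v). proj Q u = proj Q v})
          \<subseteq> points (total Q)"
        using Padd_in Qadd dsmooth_points[OF F] by (auto simp: points_sub_dspace points_prod_dspace)
      fix d U q
      assume "plot (sub_dspace (prod_dspace (total Q) (total Q)) {(u, v). proj Q u = proj Q v}) d U q"
      then have q1: "plot (total Q) d U (fst \<circ> q)" and q2: "plot (total Q) d U (snd \<circ> q)"
        and qf: "\<And>x. x \<in> U \<Longrightarrow> proj Q (fst (q x)) = proj Q (snd (q x))"
        by (auto simp: plot_sub_dspace plot_prod_dspace)
      note q1' = plot_in_points[OF T q1, simplified] and q2' = plot_in_points[OF T q2, simplified]
      have "plot (sub_dspace (prod_dspace (total P) (total P)) {(u, v). proj P u = proj P v}) d U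
          (\<lambda>x. (?G (fst (q x)), ?G (snd (q x))))"
        using dsmooth_plot[OF G q1] dsmooth_plot[OF G q2] fib[OF q1' q2' qf]
        by (auto simp: plot_sub_dspace plot_prod_dspace o_def)
      from dsmooth_plot[OF F dsmooth_plot[OF P_add this]]
      show "plot (total Q) d U ((\<lambda>(u, v). fib_add Q u v) \<circ> q)"
        by (rule plot_cong[OF T]) (simp add: case_prod_beta Qadd[OF q1' q2' qf])
    qed
    show "dsmooth (prod_dspace real_dspace (total Q)) (total Q) (\<lambda>(r, v). fib_scale Q r v)"
      unfolding dsmooth_def
    proof (intro conjI allI impI)
      have Qsc: "fib_scale Q r v = F (fib_scale P r (?G v))" if "v \<in> points (total Q)" for r v
        using scale[OF G_in[OF that]] FG[OF that] by simp
      have Psc_in: "fib_scale P r v \<in> points (total P)" if "v \<in> points (total P)" for r v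
        using dsmooth_points[OF P_scale, of "(r, v)"] that
        by (simp add: points_prod_dspace real_dspace_def)
      show "(\<lambda>(r, v). fib_scale Q r v) ` points (prod_dspace real_dspace (total Q)) \<subseteq> points (total Q)"
        using Qsc Psc_in G_in dsmooth_points[OF F] by (auto simp: points_prod_dspace)
      fix d U q
      assume "plot (prod_dspace real_dspace (total Q)) d U q"
      then have q1: "plot real_dspace d U (fst \<circ> q)" and q2: "plot (total Q) d U (snd \<circ> q)"
        by (auto simp: plot_prod_dspace)
      have "plot (prod_dspace real_dspace (total P)) d U (\<lambda>x. (fst (q x), ?G (snd (q x))))"
        using q1 dsmooth_plot[OF G q2] by (simp add: plot_prod_dspace o_def)
      from dsmooth_plot[OF F dsmooth_plot[OF P_scale this]]
      show "plot (total Q) d U ((\<lambda>(r, v). fib_scale Q r v) \<circ> q)"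
        by (rule plot_cong[OF T]) (use plot_in_points[OF T q2] Qsc in \<open>simp add: case_prod_beta\<close>)
    qed
    show "dsmooth (base Q) (total Q) (fib_zero Q)"
      unfolding dsmooth_def
    proof (intro conjI allI impI)
      have Qz: "fib_zero Q y = F (fib_zero P (?g y))" if "y \<in> points (base Q)" for y
        using zero[OF g_in[OF that]] fg[OF that] by simp
      show "fib_zero Q ` points (base Q) \<subseteq> points (total Q)"
        using Qz g_in dsmooth_points[OF P_zero] dsmooth_points[OF F] by auto
      fix d U q assume q: "plot (base Q) d U q"
      from dsmooth_plot[OF F dsmooth_plot[OF P_zero dsmooth_plot[OF g q]]]
      show "plot (total Q) d U (fib_zero Q \<circ> q)"
        by (rule plot_cong[OF T]) (use plot_in_points[OF B q] Qz in simp)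
    qed
  qed
qed

section \<open>Smooth vector bundles as pseudo-bundles\<close>

locale vector_bundle =
  fixes k :: nat and E :: "'e mfd" and M :: "'b mfd" and \<pi> :: "'e \<Rightarrow> 'b"
    and pls :: "'e \<Rightarrow> 'e \<Rightarrow> 'e" and scl :: "real \<Rightarrow> 'e \<Rightarrow> 'e" and zer :: "'b \<Rightarrow> 'e"
  assumes vbundle: "smooth_vector_bundle k E M \<pi> pls scl zer"
begin

abbreviation "dE \<equiv> std_dspace E"
abbreviation "dM \<equiv> std_dspace M"
abbreviation "over U \<equiv> mset_of E \<inter> \<pi> -` U"

lemma charted_E: "charted E" and charted_M: "charted M"
  using vbundle charted_manifold unfolding smooth_vector_bundle_def by blast+

lemmas dspace_E = diffeological_std_dspace[OF charted_E]
  and dspace_M = diffeological_std_dspace[OF charted_M]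

lemma pi_smooth: "dsmooth dE dM \<pi>"
  using vbundle by (intro smooth_map_imp_dsmooth[OF charted_E]) (simp add: smooth_vector_bundle_def)

lemma pi_image: "\<pi> ` mset_of E = mset_of M"
  using vbundle by (simp add: smooth_vector_bundle_def)

lemma pi_in: "u \<in> mset_of E \<Longrightarrow> \<pi> u \<in> mset_of M"
  using pi_image by blast

lemma fibre_vs: "x \<in> mset_of M \<Longrightarrow> real_vector_space_on {u \<in> mset_of E. \<pi> u = x} pls scl (zer x)"
  using vbundle by (simp add: smooth_vector_bundle_def)

lemma pls_in: "u \<in> mset_of E \<Longrightarrow> v \<in> mset_of E \<Longrightarrow> \<pi> v = \<pi> u \<Longrightarrow> pls u v \<in> mset_of E \<and> \<pi> (pls u v) = \<pi> u"
  using real_vector_space_on_axioms(2)[OF fibre_vs[OF pi_in[of u]]] by auto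

lemma scl_in: "u \<in> mset_of E \<Longrightarrow> scl r u \<in> mset_of E \<and> \<pi> (scl r u) = \<pi> u"
  using real_vector_space_on_axioms(3)[OF fibre_vs[OF pi_in[of u]]] by auto

lemma zer_in: "x \<in> mset_of M \<Longrightarrow> zer x \<in> mset_of E \<and> \<pi> (zer x) = x"
  using real_vector_space_on_axioms(1)[OF fibre_vs[of x]] by auto

text \<open>Plots are continuous, so preimages of the open set \<open>\<pi>\<^sup>-\<^sup>1(U)\<close> under them are open.\<close>
lemma over_preimage_open:
  assumes U: "openin (mtop M) U" and p: "plot dE d V p"
  shows "openin (Euclidean_space d) (V \<inter> p -` over U)"
proof -
  have "openin (Euclidean_space d) (V \<inter> (\<pi> \<circ> p) -` U)"
    by (rule plot_std_dspace_preimage[OF dsmooth_plot[OF pi_smooth p] U])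
  moreover have "V \<inter> (\<pi> \<circ> p) -` U = V \<inter> p -` over U"
    using plot_std_dspace_points[OF p] by auto
  ultimately show ?thesis by simp
qed

context
  fixes U :: "'b set" and \<psi> :: "'e \<Rightarrow> 'b \<times> rvec"
  assumes triv: "local_triv k E M \<pi> pls scl U \<psi>"
begin

lemma triv_open: "openin (mtop M) U"
  using triv by (simp add: local_triv_def)

lemma triv_subset: "U \<subseteq> mset_of M"
  using openin_subset[OF triv_open] .

lemma triv_ddiffeo:
  "ddiffeo (sub_dspace dE (over U)) (prod_dspace (sub_dspace dM U) (std_dspace (euclid_mfd k))) \<psi>"
proof -
  have "ddiffeo (std_dspace (open_submfd E (over U)))
      (std_dspace (prod_mfd (open_submfd M U) (euclid_mfd k))) \<psi>"
    using triv charted_E charted_M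
    by (intro mfd_diffeo_imp_ddiffeo charted_prod charted_open_submfd charted_euclid)
      (auto simp: local_triv_def)
  then show ?thesis
    using std_dspace_prod_mfd[OF charted_open_submfd[OF charted_M, of U] charted_euclid[of k]]
    by (simp add: std_dspace_open_submfd)
qed

lemma points_over: "points (sub_dspace dE (over U)) = over U"
  by (auto simp: points_sub_dspace points_std_dspace)

lemma points_triv:
  "points (prod_dspace (sub_dspace dM U) (std_dspace (euclid_mfd k))) = U \<times> Rn k"
  using triv_subset by (auto simp: points_prod_dspace points_sub_dspace points_std_dspace euclid_mfd_def)

lemma triv_bij: "bij_betw \<psi> (over U) (U \<times> Rn k)"
  using triv_ddiffeo unfolding ddiffeo_def points_over points_triv by blast

lemma triv_fst: "u \<in> over U \<Longrightarrow> fst (\<psi> u) = \<pi> u"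
  using triv by (simp add: local_triv_def)

lemma triv_snd_in: "u \<in> over U \<Longrightarrow> snd (\<psi> u) \<in> Rn k"
  using bij_betwE[OF triv_bij] by (auto simp: mem_Times_iff)

lemma triv_eq: "u \<in> over U \<Longrightarrow> \<psi> u = (\<pi> u, snd (\<psi> u))"
  using triv_fst by (metis prod.collapse)

lemma triv_inv: "u \<in> over U \<Longrightarrow> inv_into (over U) \<psi> (\<pi> u, snd (\<psi> u)) = u"
  using triv_bij triv_eq by (metis bij_betw_def inv_into_f_f)

lemma triv_inv_in:
  assumes "x \<in> U" "v \<in> Rn k"
  shows "inv_into (over U) \<psi> (x, v) \<in> over U"
    and "\<pi> (inv_into (over U) \<psi> (x, v)) = x"
    and "snd (\<psi> (inv_into (over U) \<psi> (x, v))) = v"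
proof -
  have im: "(x, v) \<in> \<psi> ` over U" using assms triv_bij by (simp add: bij_betw_def)
  show i: "inv_into (over U) \<psi> (x, v) \<in> over U" using inv_into_into[OF im] .
  have e: "\<psi> (inv_into (over U) \<psi> (x, v)) = (x, v)" using f_inv_into_f[OF im] .
  show "\<pi> (inv_into (over U) \<psi> (x, v)) = x" using triv_fst[OF i] e by simp
  show "snd (\<psi> (inv_into (over U) \<psi> (x, v))) = v" using e by simp
qed

lemma triv_pls:
  "u \<in> over U \<Longrightarrow> v \<in> mset_of E \<Longrightarrow> \<pi> v = \<pi> u \<Longrightarrow> snd (\<psi> (pls u v)) = (\<lambda>a. snd (\<psi> u) a + snd (\<psi> v) a)"
  using triv by (simp add: local_triv_def)

lemma triv_scl: "u \<in> over U \<Longrightarrow> snd (\<psi> (scl r u)) = (\<lambda>a. r * snd (\<psi> u) a)"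
  using triv by (simp add: local_triv_def)

text \<open>From \<open>0 + 0 = 0\<close> in the fibre and additivity of \<open>\<psi>\<close>, the image equals its own double.\<close>
lemma triv_zer:
  assumes "x \<in> U" shows "snd (\<psi> (zer x)) = (\<lambda>_. 0)"
proof -
  have x: "x \<in> mset_of M" using assms triv_subset by blast
  have z: "zer x \<in> over U" using zer_in[OF x] assms by simp
  have "pls (zer x) (zer x) = zer x"
    using real_vector_space_on_axioms(6)[OF fibre_vs[OF x]] zer_in[OF x] by simp
  then have "snd (\<psi> (zer x)) a = snd (\<psi> (zer x)) a + snd (\<psi> (zer x)) a" for a
    using triv_pls[OF z, of "zer x"] z by (metis IntD1)
  then show ?thesis by (simp add: fun_eq_iff)
qed

lemma triv_smooth:
  assumes "plot dE d V q" "q ` V \<subseteq> over U"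
  shows "smooth_on d V k (\<lambda>x. snd (\<psi> (q x)))"
proof -
  have "plot (sub_dspace dE (over U)) d V q" using assms by (simp add: plot_sub_dspace)
  then have "plot (prod_dspace (sub_dspace dM U) (std_dspace (euclid_mfd k))) d V (\<psi> \<circ> q)"
    using triv_ddiffeo unfolding ddiffeo_def by (intro dsmooth_plot) auto
  then show ?thesis by (simp add: plot_prod_dspace plot_std_euclid o_def)
qed

text \<open>Since \<open>\<psi>\<close> is a diffeomorphism onto \<open>U \<times> \<real>\<^sup>k\<close>, a map into \<open>\<pi>\<^sup>-\<^sup>1(U)\<close> may be tested on its two
  components.\<close>
lemma plot_trivI:
  assumes q: "\<And>x. x \<in> V \<Longrightarrow> q x \<in> over U"
    and 1: "plot dM d V (\<lambda>x. \<pi> (q x))" and 2: "smooth_on d V k (\<lambda>x. snd (\<psi> (q x)))"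
  shows "plot dE d V q"
proof -
  have "plot (prod_dspace (sub_dspace dM U) (std_dspace (euclid_mfd k))) d V (\<lambda>x. (\<pi> (q x), snd (\<psi> (q x))))"
    using q 1 2 by (auto simp: plot_prod_dspace plot_sub_dspace plot_std_euclid o_def)
  moreover have "dsmooth (prod_dspace (sub_dspace dM U) (std_dspace (euclid_mfd k)))
      (sub_dspace dE (over U)) (inv_into (over U) \<psi>)"
    using triv_ddiffeo unfolding ddiffeo_def points_over by blast
  ultimately have "plot (sub_dspace dE (over U)) d V
      (inv_into (over U) \<psi> \<circ> (\<lambda>x. (\<pi> (q x), snd (\<psi> (q x)))))"
    by (intro dsmooth_plot)
  then have "plot dE d V (inv_into (over U) \<psi> \<circ> (\<lambda>x. (\<pi> (q x), snd (\<psi> (q x)))))"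
    by (simp add: plot_sub_dspace)
  then show ?thesis
    by (rule plot_cong[OF dspace_E]) (simp add: triv_inv[OF q])
qed

end

text \<open>The test for plots of \<open>E\<close> used for each operation below: the projection to \<open>M\<close> is a plot, and the
  fibre components in local trivializations are smooth.\<close>
lemma plot_dE_local:
  assumes pq: "plot dM d V (\<pi> \<circ> q)" and q: "\<And>x. x \<in> V \<Longrightarrow> q x \<in> mset_of E"
    and sm: "\<And>U \<psi> V'. local_triv k E M \<pi> pls scl U \<psi> \<Longrightarrow> V' \<subseteq> V \<Longrightarrow> openin (Euclidean_space d) V' \<Longrightarrow>
        (\<And>x. x \<in> V' \<Longrightarrow> \<pi> (q x) \<in> U) \<Longrightarrow> smooth_on d V' k (\<lambda>x. snd (\<psi> (q x)))"
  shows "plot dE d V q"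
proof (rule plot_local[OF dspace_E])
  fix x assume x: "x \<in> V"
  have "\<pi> (q x) \<in> mset_of M" using pi_in[OF q[OF x]] .
  then obtain U \<psi> where U: "\<pi> (q x) \<in> U" "local_triv k E M \<pi> pls scl U \<psi>"
    using vbundle unfolding smooth_vector_bundle_def by blast
  define V' where "V' = V \<inter> (\<pi> \<circ> q) -` U"
  have V': "openin (Euclidean_space d) V'"
    unfolding V'_def by (rule plot_std_dspace_preimage[OF pq triv_open[OF U(2)]])
  have "plot dM d V' (\<pi> \<circ> q)"
    by (rule plot_subset[OF dspace_M pq _ V']) (auto simp: V'_def)
  moreover have "smooth_on d V' k (\<lambda>x. snd (\<psi> (q x)))"
    by (rule sm[OF U(2) _ V']) (auto simp: V'_def)
  ultimately have "plot dE d V' q"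
    by (intro plot_trivI[OF U(2)]) (auto simp: V'_def o_def q)
  then show "\<exists>V'. x \<in> V' \<and> V' \<subseteq> V \<and> plot dE d V' q"
    using x U(1) by (intro exI[of _ V']) (auto simp: V'_def)
qed

text \<open>In a local trivialization, addition, scalar multiplication and the zero section become those of
  \<open>\<real>\<^sup>k\<close>, which preserve smoothness.\<close>
lemma pseudo_bundle_std: "pseudo_bundle (std_pbundle E M \<pi> pls scl zer)"
proof -
  have sel: "total (std_pbundle E M \<pi> pls scl zer) = dE" "base (std_pbundle E M \<pi> pls scl zer) = dM"
    "proj (std_pbundle E M \<pi> pls scl zer) = \<pi>" "fib_add (std_pbundle E M \<pi> pls scl zer) = pls"
    "fib_scale (std_pbundle E M \<pi> pls scl zer) = scl" "fib_zero (std_pbundle E M \<pi> pls scl zer) = zer"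
    by (simp_all add: std_pbundle_def)
  show ?thesis
    unfolding pseudo_bundle_def sel
  proof (intro conjI ballI)
    show "diffeological_space dE" "diffeological_space dM" by (rule dspace_E, rule dspace_M)
    show "dsmooth dE dM \<pi>" by (rule pi_smooth)
    show "\<pi> ` points dE = points dM" by (simp add: points_std_dspace pi_image)
    show "real_vector_space_on {v \<in> points dE. \<pi> v = x} pls scl (zer x)" if "x \<in> points dM" for x
      using fibre_vs that by (simp add: points_std_dspace)
    show "dsmooth (sub_dspace (prod_dspace dE dE) {(u, v). \<pi> u = \<pi> v}) dE (\<lambda>(u, v). pls u v)"
      unfolding dsmooth_def
    proof (intro conjI allI impI)
      show "(\<lambda>(u, v). pls u v) ` points (sub_dspace (prod_dspace dE dE) {(u, v). \<pi> u = \<pi> v}) \<subseteq> points dE"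
        using pls_in by (auto simp: points_sub_dspace points_prod_dspace points_std_dspace)
      fix d V q assume "plot (sub_dspace (prod_dspace dE dE) {(u, v). \<pi> u = \<pi> v}) d V q"
      then have q1: "plot dE d V (fst \<circ> q)" and q2: "plot dE d V (snd \<circ> q)"
          and fib: "\<And>x. x \<in> V \<Longrightarrow> \<pi> (fst (q x)) = \<pi> (snd (q x))"
        by (auto simp: plot_sub_dspace plot_prod_dspace)
      have in1: "fst (q x) \<in> mset_of E" and in2: "snd (q x) \<in> mset_of E" if "x \<in> V" for x
        using plot_std_dspace_points[OF q1 that] plot_std_dspace_points[OF q2 that] by simp_all
      show "plot dE d V ((\<lambda>(u, v). pls u v) \<circ> q)"
      proof (rule plot_dE_local)
        show "plot dM d V (\<pi> \<circ> ((\<lambda>(u, v). pls u v) \<circ> q))"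
          by (rule plot_cong[OF dspace_M dsmooth_plot[OF pi_smooth q1]])
            (use pls_in[OF in1 in2] fib in \<open>simp add: case_prod_beta\<close>)
        show "((\<lambda>(u, v). pls u v) \<circ> q) x \<in> mset_of E" if "x \<in> V" for x
          using pls_in[OF in1 in2] fib that by (simp add: case_prod_beta)
        fix U \<psi> V' assume t: "local_triv k E M \<pi> pls scl U \<psi>" and V': "V' \<subseteq> V"
          and oV': "openin (Euclidean_space d) V'"
          and inU: "\<And>x. x \<in> V' \<Longrightarrow> \<pi> (((\<lambda>(u, v). pls u v) \<circ> q) x) \<in> U"
        have U1: "\<pi> (fst (q x)) \<in> U" if "x \<in> V'" for x
          using inU[OF that] pls_in[OF in1 in2, of x x] fib[of x] V' that by (auto simp: case_prod_beta)
        have U2: "\<pi> (snd (q x)) \<in> U" if "x \<in> V'" for x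
          using U1[OF that] fib[of x] V' that by auto
        have "smooth_on d V' k (\<lambda>x. snd (\<psi> ((fst \<circ> q) x)))"
          by (rule triv_smooth[OF t plot_subset[OF dspace_E q1 V' oV']]) (use U1 in1 V' in auto)
        moreover have "smooth_on d V' k (\<lambda>x. snd (\<psi> ((snd \<circ> q) x)))"
          by (rule triv_smooth[OF t plot_subset[OF dspace_E q2 V' oV']]) (use U2 in2 V' in auto)
        ultimately have "smooth_on d V' k (\<lambda>x a. snd (\<psi> (fst (q x))) a + snd (\<psi> (snd (q x))) a)"
          using smooth_on_add by simp
        then show "smooth_on d V' k (\<lambda>x. snd (\<psi> (((\<lambda>(u, v). pls u v) \<circ> q) x)))"
        proof (rule smooth_on_cong)
          fix x assume x: "x \<in> V'"
          then have "x \<in> V" using V' by blast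
          then show "(\<lambda>a. snd (\<psi> (fst (q x))) a + snd (\<psi> (snd (q x))) a) = snd (\<psi> (((\<lambda>(u, v). pls u v) \<circ> q) x))"
            using triv_pls[OF t _ in2[of x] fib[of x, symmetric]] U1[OF x] in1[of x]
            by (simp add: case_prod_beta)
        qed
      qed
    qed
    show "dsmooth (prod_dspace real_dspace dE) dE (\<lambda>(r, v). scl r v)"
      unfolding dsmooth_def
    proof (intro conjI allI impI)
      show "(\<lambda>(r, v). scl r v) ` points (prod_dspace real_dspace dE) \<subseteq> points dE"
        using scl_in by (auto simp: points_prod_dspace points_std_dspace)
      fix d V q assume "plot (prod_dspace real_dspace dE) d V q"
      then have q1: "smooth_fun d V (fst \<circ> q)" and q2: "plot dE d V (snd \<circ> q)"
        by (auto simp: plot_prod_dspace real_dspace_def)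
      have in2: "snd (q x) \<in> mset_of E" if "x \<in> V" for x
        using plot_std_dspace_points[OF q2 that] by simp
      show "plot dE d V ((\<lambda>(r, v). scl r v) \<circ> q)"
      proof (rule plot_dE_local)
        show "plot dM d V (\<pi> \<circ> ((\<lambda>(r, v). scl r v) \<circ> q))"
          by (rule plot_cong[OF dspace_M dsmooth_plot[OF pi_smooth q2]])
            (use scl_in[OF in2] in \<open>simp add: case_prod_beta\<close>)
        show "((\<lambda>(r, v). scl r v) \<circ> q) x \<in> mset_of E" if "x \<in> V" for x
          using scl_in[OF in2] that by (simp add: case_prod_beta)
        fix U \<psi> V' assume t: "local_triv k E M \<pi> pls scl U \<psi>" and V': "V' \<subseteq> V"
          and oV': "openin (Euclidean_space d) V'"
          and inU: "\<And>x. x \<in> V' \<Longrightarrow> \<pi> (((\<lambda>(r, v). scl r v) \<circ> q) x) \<in> U"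
        have U2: "\<pi> (snd (q x)) \<in> U" if "x \<in> V'" for x
          using inU[OF that] scl_in[OF in2, of x] V' that by (auto simp: case_prod_beta)
        have "smooth_on d V' k (\<lambda>x. snd (\<psi> ((snd \<circ> q) x)))"
          by (rule triv_smooth[OF t plot_subset[OF dspace_E q2 V' oV']]) (use U2 in2 V' in auto)
        moreover have "smooth_fun d V' (fst \<circ> q)"
          using q1 oV' Ck_subset[OF _ V'] by (auto simp: smooth_fun_def)
        ultimately have "smooth_on d V' k (\<lambda>x a. (fst \<circ> q) x * snd (\<psi> ((snd \<circ> q) x)) a)"
          by (intro smooth_on_scale)
        then show "smooth_on d V' k (\<lambda>x. snd (\<psi> (((\<lambda>(r, v). scl r v) \<circ> q) x)))"
        proof (rule smooth_on_cong)
          fix x assume x: "x \<in> V'"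
          then have "x \<in> V" using V' by blast
          then show "(\<lambda>a. (fst \<circ> q) x * snd (\<psi> ((snd \<circ> q) x)) a) = snd (\<psi> (((\<lambda>(r, v). scl r v) \<circ> q) x))"
            using triv_scl[OF t, of "snd (q x)" "fst (q x)"] U2[OF x] in2[of x]
            by (simp add: case_prod_beta)
        qed
      qed
    qed
    show "dsmooth dM dE zer"
      unfolding dsmooth_def
    proof (intro conjI allI impI)
      show "zer ` points dM \<subseteq> points dE" using zer_in by (auto simp: points_std_dspace)
      fix d V q assume q: "plot dM d V q"
      note q_in = plot_std_dspace_points[OF q]
      show "plot dE d V (zer \<circ> q)"
      proof (rule plot_dE_local)
        show "plot dM d V (\<pi> \<circ> (zer \<circ> q))"
          by (rule plot_cong[OF dspace_M q]) (use zer_in q_in in simp)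
        show "(zer \<circ> q) x \<in> mset_of E" if "x \<in> V" for x
          using zer_in q_in that by simp
        fix U \<psi> V' assume t: "local_triv k E M \<pi> pls scl U \<psi>" and V': "V' \<subseteq> V"
          and oV': "openin (Euclidean_space d) V'"
          and inU: "\<And>x. x \<in> V' \<Longrightarrow> \<pi> ((zer \<circ> q) x) \<in> U"
        have "smooth_on d V' k (\<lambda>_ _. 0)"
          by (rule smooth_on_const[OF oV']) (simp add: Rn_iff)
        then show "smooth_on d V' k (\<lambda>x. snd (\<psi> ((zer \<circ> q) x)))"
        proof (rule smooth_on_cong)
          fix x assume x: "x \<in> V'"
          then have "q x \<in> U" using inU[OF x] zer_in[OF q_in, of x] V' by auto
          then show "(\<lambda>_. 0) = snd (\<psi> ((zer \<circ> q) x))" using triv_zer[OF t] by simp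
        qed
      qed
    qed
  qed
qed

end

text \<open>The fibre over \<open>y\<close> is the image of \<open>\<real>\<^sup>k\<close> under \<open>v \<mapsto> (y, v)\<close>, from which it inherits its vector space
  structure.\<close>
lemma pseudo_bundle_euclid:
  assumes p: "\<And>w. w \<in> Rn (n + k) \<Longrightarrow> p w = hd_part n w"
  shows "pseudo_bundle (euclid_pbundle n k p)"
proof -
  let ?add = "\<lambda>w w'. juxt n (hd_part n w) (\<lambda>a. tl_part n w a + tl_part n w' a)"
  let ?scl = "\<lambda>r w. juxt n (hd_part n w) (\<lambda>a. r * tl_part n w a)"
  let ?T = "std_dspace (euclid_mfd (n + k))" and ?B = "std_dspace (euclid_mfd n)"
  have sel: "total (euclid_pbundle n k p) = ?T" "base (euclid_pbundle n k p) = ?B"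
    "proj (euclid_pbundle n k p) = p" "fib_add (euclid_pbundle n k p) = ?add"
    "fib_scale (euclid_pbundle n k p) = ?scl" "fib_zero (euclid_pbundle n k p) = (\<lambda>y. juxt n y (\<lambda>_. 0))"
    by (simp_all add: euclid_pbundle_def std_pbundle_def)
  have vs: "real_vector_space_on (Rn k) (\<lambda>u v a. u a + v a) (\<lambda>r v a. r * v a) (\<lambda>_. 0)"
    unfolding real_vector_space_on_def
  proof (intro conjI ballI allI)
    show "\<exists>w\<in>Rn k. (\<lambda>a. v a + w a) = (\<lambda>_. 0)" if "v \<in> Rn k" for v
      using that by (intro bexI[of _ "\<lambda>a. - v a"]) (auto simp: Rn_iff)
  qed (auto simp: Rn_iff algebra_simps)
  have add_in: "u \<in> Rn k \<Longrightarrow> v \<in> Rn k \<Longrightarrow> (\<lambda>a. u a + v a) \<in> Rn k"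
    and scl_in: "v \<in> Rn k \<Longrightarrow> (\<lambda>a. r * v a) \<in> Rn k" for r u v
    by (auto simp: Rn_iff)
  show ?thesis
    unfolding pseudo_bundle_def sel
  proof (intro conjI ballI)
    show "diffeological_space ?T" "diffeological_space ?B"
      by (intro diffeological_std_dspace charted_euclid)+
    show "dsmooth ?T ?B p"
      unfolding dsmooth_def
    proof (intro conjI allI impI)
      show "p ` points ?T \<subseteq> points ?B" using p hd_part_in_Rn by (auto simp: points_std_euclid)
      fix d U q assume "plot ?T d U q"
      then have q: "smooth_on d U (n + k) q" by (simp add: plot_std_euclid)
      have "smooth_on d U n (p \<circ> q)"
        by (rule smooth_on_cong[OF smooth_on_hd_part[OF q]]) (simp add: p[OF smooth_on_Rn[OF q]])
      then show "plot ?B d U (p \<circ> q)" by (simp add: plot_std_euclid)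
    qed
    show "p ` points ?T = points ?B"
    proof
      show "p ` points ?T \<subseteq> points ?B" using p hd_part_in_Rn by (auto simp: points_std_euclid)
      show "points ?B \<subseteq> p ` points ?T"
      proof
        fix y assume "y \<in> points ?B"
        then have y: "y \<in> Rn n" by (simp add: points_std_euclid)
        have "juxt n y (\<lambda>_. 0) \<in> Rn (n + k)" by (rule juxt_in_Rn) (simp add: Rn_iff)
        then show "y \<in> p ` points ?T"
          using p hd_part_juxt[OF y] by (intro image_eqI[of _ _ "juxt n y (\<lambda>_. 0)"]) (simp_all add: points_std_euclid)
      qed
    qed
    fix x assume "x \<in> points ?B"
    then have x: "x \<in> Rn n" by (simp add: points_std_euclid)
    have "{v \<in> points ?T. p v = x} = juxt n x ` Rn k"
    proof
      show "{v \<in> points ?T. p v = x} \<subseteq> juxt n x ` Rn k"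
      proof
        fix v assume "v \<in> {v \<in> points ?T. p v = x}"
        then have "v \<in> Rn (n + k)" "hd_part n v = x" using p by (auto simp: points_std_euclid)
        then show "v \<in> juxt n x ` Rn k"
          using juxt_hd_tl[of n v] tl_part_in_Rn[of v n k] by (intro image_eqI[of _ _ "tl_part n v"]) auto
      qed
      show "juxt n x ` Rn k \<subseteq> {v \<in> points ?T. p v = x}"
        using juxt_in_Rn[of _ k n x] p hd_part_juxt[OF x] by (auto simp: points_std_euclid)
    qed
    moreover have "real_vector_space_on (juxt n x ` Rn k) ?add ?scl (juxt n x (\<lambda>_. 0))"
      by (rule real_vector_space_on_image[OF vs]) (simp_all add: hd_part_juxt[OF x] tl_part_juxt)
    ultimately show "real_vector_space_on {v \<in> points ?T. p v = x} ?add ?scl (juxt n x (\<lambda>_. 0))"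
      by simp
  next
    show "dsmooth (sub_dspace (prod_dspace ?T ?T) {(u, v). p u = p v}) ?T (\<lambda>(u, v). ?add u v)"
      unfolding dsmooth_def
    proof (intro conjI allI impI)
      show "(\<lambda>(u, v). ?add u v) ` points (sub_dspace (prod_dspace ?T ?T) {(u, v). p u = p v}) \<subseteq> points ?T"
        by (auto simp: points_sub_dspace points_prod_dspace points_std_euclid
            intro!: juxt_in_Rn add_in tl_part_in_Rn)
      fix d U q assume "plot (sub_dspace (prod_dspace ?T ?T) {(u, v). p u = p v}) d U q"
      then have q: "smooth_on d U (n + k) (\<lambda>x. fst (q x))" "smooth_on d U (n + k) (\<lambda>x. snd (q x))"
        by (simp_all add: plot_sub_dspace plot_prod_dspace plot_std_euclid o_def)
      have "smooth_on d U (n + k) (\<lambda>x. ?add (fst (q x)) (snd (q x)))"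
        by (subst smooth_on_juxt_iff)
          (use hd_part_in_Rn smooth_on_hd_part[OF q(1)] smooth_on_add[OF smooth_on_tl_part[OF q(1)] smooth_on_tl_part[OF q(2)]] in auto)
      then show "plot ?T d U ((\<lambda>(u, v). ?add u v) \<circ> q)"
        by (simp add: plot_std_euclid o_def case_prod_beta)
    qed
    show "dsmooth (prod_dspace real_dspace ?T) ?T (\<lambda>(r, v). ?scl r v)"
      unfolding dsmooth_def
    proof (intro conjI allI impI)
      show "(\<lambda>(r, v). ?scl r v) ` points (prod_dspace real_dspace ?T) \<subseteq> points ?T"
        by (auto simp: points_prod_dspace points_std_euclid intro!: juxt_in_Rn scl_in tl_part_in_Rn)
      fix d U q assume "plot (prod_dspace real_dspace ?T) d U q"
      then have q: "smooth_fun d U (\<lambda>x. fst (q x))" "smooth_on d U (n + k) (\<lambda>x. snd (q x))"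
        by (simp_all add: plot_prod_dspace plot_std_euclid real_dspace_def o_def)
      have "smooth_on d U (n + k) (\<lambda>x. ?scl (fst (q x)) (snd (q x)))"
        by (subst smooth_on_juxt_iff)
          (use hd_part_in_Rn smooth_on_hd_part[OF q(2)] smooth_on_scale[OF q(1) smooth_on_tl_part[OF q(2)]] in auto)
      then show "plot ?T d U ((\<lambda>(r, v). ?scl r v) \<circ> q)"
        by (simp add: plot_std_euclid o_def case_prod_beta)
    qed
    show "dsmooth ?B ?T (\<lambda>y. juxt n y (\<lambda>_. 0))"
      unfolding dsmooth_def
    proof (intro conjI allI impI)
      have z: "(\<lambda>_. 0) \<in> Rn k" by (simp add: Rn_iff)
      show "(\<lambda>y. juxt n y (\<lambda>_. 0)) ` points ?B \<subseteq> points ?T"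
        using juxt_in_Rn[OF z] by (auto simp: points_std_euclid)
      fix d U q assume "plot ?B d U q"
      then have q: "smooth_on d U n q" by (simp add: plot_std_euclid)
      have "smooth_on d U (n + k) (\<lambda>x. juxt n (q x) (\<lambda>_. 0))"
        by (subst smooth_on_juxt_iff)
          (use smooth_on_Rn[OF q] q smooth_on_const[OF smooth_on_openin[OF q] z] in auto)
      then show "plot ?T d U ((\<lambda>y. juxt n y (\<lambda>_. 0)) \<circ> q)"
        by (simp add: plot_std_euclid o_def)
    qed
  qed
qed

section \<open>The bundle glued from its local trivializations\<close>

text \<open>A vector bundle with an atlas of local trivializations over the domains \<open>U i\<close> of global coordinates
  \<open>\<phi> i : U i \<rightarrow> \<real>\<^sup>n\<close>, together with the projections \<open>p i\<close> and the gluing maps \<open>f i j\<close>, \<open>F i j\<close> that the atlas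
  determines.\<close>
locale bundle_atlas = vector_bundle k E M \<pi> pls scl zer
  for k :: nat and E :: "'e mfd" and M :: "'b mfd" and \<pi> :: "'e \<Rightarrow> 'b"
    and pls :: "'e \<Rightarrow> 'e \<Rightarrow> 'e" and scl :: "real \<Rightarrow> 'e \<Rightarrow> 'e" and zer :: "'b \<Rightarrow> 'e" +
  fixes n :: nat and I :: "'i set"
    and U :: "'i \<Rightarrow> 'b set" and \<phi> :: "'i \<Rightarrow> 'b \<Rightarrow> rvec" and \<psi> :: "'i \<Rightarrow> 'e \<Rightarrow> 'b \<times> rvec"
    and g :: "'i \<Rightarrow> 'i \<Rightarrow> 'b \<Rightarrow> real mat"
    and p :: "'i \<Rightarrow> rvec \<Rightarrow> rvec" and f F :: "'i \<Rightarrow> 'i \<Rightarrow> rvec \<Rightarrow> rvec"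
  assumes cover: "mset_of M = (\<Union>i\<in>I. U i)"
    and phi: "i \<in> I \<Longrightarrow> mfd_diffeo (open_submfd M (U i)) (euclid_mfd n) (\<phi> i)"
    and psi: "i \<in> I \<Longrightarrow> local_triv k E M \<pi> pls scl (U i) (\<psi> i)"
    and g_trans: "i \<in> I \<Longrightarrow> j \<in> I \<Longrightarrow> x \<in> U i \<inter> U j \<Longrightarrow> v \<in> Rn k \<Longrightarrow>
        \<psi> j (inv_into (over (U i)) (\<psi> i) (x, v)) = (x, mat_act k (g i j x) v)"
    and p_eq: "i \<in> I \<Longrightarrow> y \<in> Rn n \<Longrightarrow> v \<in> Rn k \<Longrightarrow>
        p i (juxt n y v) = \<phi> i (\<pi> (inv_into (over (U i)) (\<psi> i) (inv_into (U i) (\<phi> i) y, v)))"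
    and f_eq: "i \<in> I \<Longrightarrow> j \<in> I \<Longrightarrow> y \<in> \<phi> i ` (U i \<inter> U j) \<Longrightarrow>
        f i j y = \<phi> j (inv_into (U i \<inter> U j) (\<phi> i) y)"
    and F_eq: "i \<in> I \<Longrightarrow> j \<in> I \<Longrightarrow> y \<in> \<phi> i ` (U i \<inter> U j) \<Longrightarrow> v \<in> Rn k \<Longrightarrow>
        F i j (juxt n y v) = juxt n (f i j y) (mat_act k (g i j (inv_into (U i) (\<phi> i) y)) v)"
begin

abbreviation "dR d \<equiv> std_dspace (euclid_mfd d)"

text \<open>The coordinates \<open>(\<phi>\<^sub>i \<times> id) \<circ> \<psi>\<^sub>i : \<pi>\<^sup>-\<^sup>1(U\<^sub>i) \<rightarrow> \<real>\<^sup>n\<^sup>+\<^sup>k\<close> of the total space.\<close>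
definition \<Phi> :: "'i \<Rightarrow> 'e \<Rightarrow> rvec" where
  "\<Phi> i u = juxt n (\<phi> i (\<pi> u)) (snd (\<psi> i u))"

lemma U_subset: "i \<in> I \<Longrightarrow> U i \<subseteq> mset_of M"
  using cover by blast

lemma points_sub_U: "i \<in> I \<Longrightarrow> points (sub_dspace dM (U i)) = U i"
  using U_subset by (auto simp: points_sub_dspace points_std_dspace)

lemma phi_ddiffeo: "i \<in> I \<Longrightarrow> ddiffeo (sub_dspace dM (U i)) (dR n) (\<phi> i)"
  using mfd_diffeo_imp_ddiffeo[OF charted_open_submfd[OF charted_M] charted_euclid phi]
  by (simp add: std_dspace_open_submfd)

lemma phi_bij: "i \<in> I \<Longrightarrow> bij_betw (\<phi> i) (U i) (Rn n)"
  using phi_ddiffeo[of i] unfolding ddiffeo_def by (simp add: points_sub_U points_std_euclid)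

lemma phi_inj: "i \<in> I \<Longrightarrow> x \<in> U i \<Longrightarrow> y \<in> U i \<Longrightarrow> \<phi> i x = \<phi> i y \<Longrightarrow> x = y"
  using phi_bij[of i] by (auto simp: bij_betw_def dest: inj_onD)

lemma phi_in: "i \<in> I \<Longrightarrow> x \<in> U i \<Longrightarrow> \<phi> i x \<in> Rn n"
  and phi_inv: "i \<in> I \<Longrightarrow> x \<in> U i \<Longrightarrow> inv_into (U i) (\<phi> i) (\<phi> i x) = x"
  and phi_inv_in: "i \<in> I \<Longrightarrow> y \<in> Rn n \<Longrightarrow> inv_into (U i) (\<phi> i) y \<in> U i"
  and phi_phi_inv: "i \<in> I \<Longrightarrow> y \<in> Rn n \<Longrightarrow> \<phi> i (inv_into (U i) (\<phi> i) y) = y"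
  using phi_bij[of i] by (auto simp: bij_betw_def inv_into_f_f inv_into_into f_inv_into_f)

text \<open>The map \<open>p i\<close> is the projection \<open>\<pi>\<close> read in the coordinates \<open>\<Phi> i\<close> and \<open>\<phi> i\<close>; as \<open>\<psi> i\<close> preserves base
  points, this is the projection onto the first \<open>n\<close> coordinates.\<close>
lemma p_hd_part:
  assumes i: "i \<in> I" and w: "w \<in> Rn (n + k)" shows "p i w = hd_part n w"
proof -
  note h = hd_part_in_Rn[of n w] and t = tl_part_in_Rn[OF w]
  have "p i (juxt n (hd_part n w) (tl_part n w)) = hd_part n w"
    using p_eq[OF i h t] triv_inv_in(2)[OF psi[OF i] phi_inv_in[OF i h] t] phi_phi_inv[OF i h] by simp
  then show ?thesis by (simp add: juxt_hd_tl)
qed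

lemma Phi_in: "i \<in> I \<Longrightarrow> u \<in> over (U i) \<Longrightarrow> \<Phi> i u \<in> Rn (n + k)"
  unfolding \<Phi>_def by (rule juxt_in_Rn[OF triv_snd_in[OF psi]])

lemma hd_Phi: "i \<in> I \<Longrightarrow> u \<in> over (U i) \<Longrightarrow> hd_part n (\<Phi> i u) = \<phi> i (\<pi> u)"
  unfolding \<Phi>_def by (rule hd_part_juxt[OF phi_in]) auto

lemma tl_Phi: "tl_part n (\<Phi> i u) = snd (\<psi> i u)"
  by (simp add: \<Phi>_def tl_part_juxt)

lemma p_Phi: "i \<in> I \<Longrightarrow> u \<in> over (U i) \<Longrightarrow> p i (\<Phi> i u) = \<phi> i (\<pi> u)"
  by (simp add: p_hd_part Phi_in hd_Phi)

lemma Phi_bij: assumes i: "i \<in> I" shows "bij_betw (\<Phi> i) (over (U i)) (Rn (n + k))"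
proof -
  have "inj_on (\<Phi> i) (over (U i))"
  proof (rule inj_onI)
    fix u v assume uv: "u \<in> over (U i)" "v \<in> over (U i)" "\<Phi> i u = \<Phi> i v"
    have "\<phi> i (\<pi> u) = \<phi> i (\<pi> v)" using hd_Phi[OF i] uv by metis
    then have "\<pi> u = \<pi> v" by (rule phi_inj[OF i, rotated 2]) (use uv in auto)
    moreover have "snd (\<psi> i u) = snd (\<psi> i v)" using tl_Phi uv(3) by metis
    ultimately have "\<psi> i u = \<psi> i v"
      by (intro prod_eqI) (simp_all only: triv_fst[OF psi[OF i]] uv(1,2))
    then show "u = v"
      using triv_bij[OF psi[OF i]] uv(1,2) unfolding bij_betw_def by (blast dest: inj_onD)
  qed
  moreover have "\<Phi> i ` over (U i) = Rn (n + k)"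
  proof
    show "\<Phi> i ` over (U i) \<subseteq> Rn (n + k)" using Phi_in[OF i] by blast
    show "Rn (n + k) \<subseteq> \<Phi> i ` over (U i)"
    proof
      fix w assume w: "w \<in> Rn (n + k)"
      note h = hd_part_in_Rn[of n w] and t = tl_part_in_Rn[OF w]
      define u where "u = inv_into (over (U i)) (\<psi> i) (inv_into (U i) (\<phi> i) (hd_part n w), tl_part n w)"
      note u = triv_inv_in[OF psi[OF i] phi_inv_in[OF i h] t, folded u_def]
      have "\<Phi> i u = w"
        unfolding \<Phi>_def using u phi_phi_inv[OF i h] by (simp add: juxt_hd_tl)
      then show "w \<in> \<Phi> i ` over (U i)" using u(1) by blast
    qed
  qed
  ultimately show ?thesis by (simp add: bij_betw_def)
qed

text \<open>Both components of \<open>\<Phi> i\<close> are smooth on plots; conversely, a plot of \<open>\<real>\<^sup>n\<^sup>+\<^sup>k\<close> is carried to a map into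
  \<open>E\<close> whose projection and fibre component are smooth.\<close>
lemma Phi_ddiffeo: assumes i: "i \<in> I" shows "ddiffeo (sub_dspace dE (over (U i))) (dR (n + k)) (\<Phi> i)"
  unfolding ddiffeo_def points_over[OF psi[OF i]] points_std_euclid
proof (intro conjI)
  note phi_sm = phi_ddiffeo[OF i, unfolded ddiffeo_def points_sub_U[OF i]]
  show "bij_betw (\<Phi> i) (over (U i)) (Rn (n + k))" by (rule Phi_bij[OF i])
  show "dsmooth (sub_dspace dE (over (U i))) (dR (n + k)) (\<Phi> i)"
    unfolding dsmooth_def
  proof (intro conjI allI impI)
    show "\<Phi> i ` points (sub_dspace dE (over (U i))) \<subseteq> points (dR (n + k))"
      unfolding points_over[OF psi[OF i]] points_std_euclid using Phi_in[OF i] by blast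
    fix d V q assume "plot (sub_dspace dE (over (U i))) d V q"
    then have q: "plot dE d V q" "q ` V \<subseteq> over (U i)" by (auto simp: plot_sub_dspace)
    have "plot (sub_dspace dM (U i)) d V (\<pi> \<circ> q)"
      using dsmooth_plot[OF pi_smooth q(1)] q(2) by (auto simp: plot_sub_dspace)
    then have "plot (dR n) d V (\<phi> i \<circ> (\<pi> \<circ> q))"
      using phi_sm by (intro dsmooth_plot[of "sub_dspace dM (U i)"]) auto
    then have 1: "smooth_on d V n (\<lambda>x. \<phi> i (\<pi> (q x)))" by (simp add: plot_std_euclid o_def)
    have 2: "smooth_on d V k (\<lambda>x. snd (\<psi> i (q x)))" by (rule triv_smooth[OF psi[OF i] q])
    have "smooth_on d V (n + k) (\<lambda>x. \<Phi> i (q x))"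
      unfolding \<Phi>_def using smooth_on_Rn[OF 1] by (subst smooth_on_juxt_iff) (use 1 2 in auto)
    then show "plot (dR (n + k)) d V (\<Phi> i \<circ> q)" by (simp add: plot_std_euclid o_def)
  qed
  show "dsmooth (dR (n + k)) (sub_dspace dE (over (U i))) (inv_into (over (U i)) (\<Phi> i))"
    unfolding dsmooth_def
  proof (intro conjI allI impI)
    have inv: "inv_into (over (U i)) (\<Phi> i) w \<in> over (U i)" "\<Phi> i (inv_into (over (U i)) (\<Phi> i) w) = w"
      if "w \<in> Rn (n + k)" for w
      using Phi_bij[OF i] that by (metis bij_betw_def inv_into_into, metis bij_betw_def f_inv_into_f)
    show "inv_into (over (U i)) (\<Phi> i) ` points (dR (n + k)) \<subseteq> points (sub_dspace dE (over (U i)))"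
      unfolding points_over[OF psi[OF i]] points_std_euclid using inv(1) by blast
    fix d V s assume "plot (dR (n + k)) d V s"
    then have s: "smooth_on d V (n + k) s" by (simp add: plot_std_euclid)
    define q where "q = inv_into (over (U i)) (\<Phi> i) \<circ> s"
    have q: "q x \<in> over (U i)" "\<Phi> i (q x) = s x" if "x \<in> V" for x
      unfolding q_def using inv[OF smooth_on_Rn[OF s that]] by simp_all
    have "plot (dR n) d V (\<lambda>x. hd_part n (s x))"
      using smooth_on_hd_part[OF s] by (simp add: plot_std_euclid)
    then have "plot (sub_dspace dM (U i)) d V (inv_into (U i) (\<phi> i) \<circ> (\<lambda>x. hd_part n (s x)))"
      using phi_sm by (intro dsmooth_plot[of "dR n"]) auto
    then have "plot dM d V (inv_into (U i) (\<phi> i) \<circ> (\<lambda>x. hd_part n (s x)))"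
      by (simp add: plot_sub_dspace)
    then have 1: "plot dM d V (\<lambda>x. \<pi> (q x))"
    proof (rule plot_cong[OF dspace_M])
      fix x assume x: "x \<in> V"
      show "\<pi> (q x) = (inv_into (U i) (\<phi> i) \<circ> (\<lambda>x. hd_part n (s x))) x"
        using hd_Phi[OF i q(1)[OF x]] q(2)[OF x] phi_inv[OF i, of "\<pi> (q x)"] q(1)[OF x] by simp
    qed
    have 2: "smooth_on d V k (\<lambda>x. snd (\<psi> i (q x)))"
      by (rule smooth_on_cong[OF smooth_on_tl_part[OF s]]) (metis q(2) tl_Phi)
    have "plot dE d V q" by (rule plot_trivI[OF psi[OF i] q(1) 1 2])
    then show "plot (sub_dspace dE (over (U i))) d V (inv_into (over (U i)) (\<Phi> i) \<circ> s)"
      using q(1) unfolding q_def by (auto simp: plot_sub_dspace)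
  qed
qed

lemma f_phi:
  assumes ij: "i \<in> I" "j \<in> I" and x: "x \<in> U i \<inter> U j" shows "f i j (\<phi> i x) = \<phi> j x"
proof -
  have "inj_on (\<phi> i) (U i \<inter> U j)"
    using phi_bij[OF ij(1)] by (auto simp: bij_betw_def intro: inj_on_subset)
  then show ?thesis using f_eq[OF ij, of "\<phi> i x"] x by (simp add: inv_into_f_f)
qed

text \<open>The transition matrices are defined so that the lifts are the changes of the coordinates
  \<open>\<Phi>\<close>. Linearity of \<open>F i j\<close> will therefore come from that of the trivializations.\<close>
lemma F_Phi:
  assumes ij: "i \<in> I" "j \<in> I" and u: "u \<in> over (U i) \<inter> over (U j)" shows "F i j (\<Phi> i u) = \<Phi> j u"
proof -
  have ui: "u \<in> over (U i)" and x: "\<pi> u \<in> U i \<inter> U j" using u by auto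
  note v = triv_snd_in[OF psi[OF ij(1)] ui]
  have "F i j (\<Phi> i u) = juxt n (\<phi> j (\<pi> u)) (mat_act k (g i j (\<pi> u)) (snd (\<psi> i u)))"
    unfolding \<Phi>_def using F_eq[OF ij imageI[OF x] v] f_phi[OF ij x] phi_inv[OF ij(1)] x by simp
  also have "mat_act k (g i j (\<pi> u)) (snd (\<psi> i u)) = snd (\<psi> j u)"
    using g_trans[OF ij x v] triv_inv[OF psi[OF ij(1)] ui] by simp
  finally show ?thesis by (simp add: \<Phi>_def)
qed

text \<open>The gluing theorem for covers applies to the base with the coordinates \<open>\<phi> i\<close>, and to the total space
  with the coordinates \<open>\<Phi> i\<close>.\<close>
sublocale B: open_chart_cover dM I U "\<lambda>_. dR n" \<phi> "\<lambda>i j. \<phi> i ` (U i \<inter> U j)" f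
proof
  show "diffeological_space dM" by (rule dspace_M)
  show "diffeological_space (dR n)" by (rule diffeological_std_dspace[OF charted_euclid])
  show "points dM = (\<Union>i\<in>I. U i)" by (simp add: points_std_dspace cover)
  show "openin (Euclidean_space d) (V \<inter> q -` U i)" if "i \<in> I" "plot dM d V q" for i d V q
    by (rule plot_std_dspace_preimage[OF that(2) triv_open[OF psi[OF that(1)]]])
  show "ddiffeo (sub_dspace dM (U i)) (dR n) (\<phi> i)" if "i \<in> I" for i
    by (rule phi_ddiffeo[OF that])
  show "points (dR n) \<inter> \<phi> i ` (U i \<inter> U j) = \<phi> i ` (U i \<inter> U j)" if "i \<in> I" for i j
    using phi_in[OF that] by (auto simp: points_std_euclid)
  show "f i j (\<phi> i x) = \<phi> j x" if "i \<in> I" "j \<in> I" "x \<in> U i \<inter> U j" for i j x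
    by (rule f_phi[OF that])
qed

sublocale T: open_chart_cover dE I "\<lambda>i. over (U i)" "\<lambda>_. dR (n + k)" \<Phi>
  "\<lambda>i j. p i -` \<phi> i ` (U i \<inter> U j)" F
proof
  show "diffeological_space dE" by (rule dspace_E)
  show "diffeological_space (dR (n + k))" by (rule diffeological_std_dspace[OF charted_euclid])
  show "points dE = (\<Union>i\<in>I. over (U i))"
    using pi_in by (auto simp: points_std_dspace cover)
  show "openin (Euclidean_space d) (V \<inter> q -` over (U i))" if "i \<in> I" "plot dE d V q" for i d V q
    by (rule over_preimage_open[OF triv_open[OF psi[OF that(1)]] that(2)])
  show "ddiffeo (sub_dspace dE (over (U i))) (dR (n + k)) (\<Phi> i)" if "i \<in> I" for i
    by (rule Phi_ddiffeo[OF that])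
  show "points (dR (n + k)) \<inter> p i -` \<phi> i ` (U i \<inter> U j) = \<Phi> i ` (over (U i) \<inter> over (U j))"
    if ij: "i \<in> I" "j \<in> I" for i j
  proof
    show "points (dR (n + k)) \<inter> p i -` \<phi> i ` (U i \<inter> U j) \<subseteq> \<Phi> i ` (over (U i) \<inter> over (U j))"
    proof
      fix w assume w: "w \<in> points (dR (n + k)) \<inter> p i -` \<phi> i ` (U i \<inter> U j)"
      then have "w \<in> \<Phi> i ` over (U i)"
        using Phi_bij[OF ij(1)] by (simp add: points_std_euclid bij_betw_def)
      then obtain u where u: "u \<in> over (U i)" "w = \<Phi> i u" by blast
      then have "\<phi> i (\<pi> u) \<in> \<phi> i ` (U i \<inter> U j)" using w p_Phi[OF ij(1) u(1)] by simp
      then obtain x where x: "x \<in> U i \<inter> U j" "\<phi> i (\<pi> u) = \<phi> i x" by blast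
      then have "\<pi> u = x" by (intro phi_inj[OF ij(1) _ _ x(2)]) (use u(1) in auto)
      then show "w \<in> \<Phi> i ` (over (U i) \<inter> over (U j))" using u x(1) by blast
    qed
    show "\<Phi> i ` (over (U i) \<inter> over (U j)) \<subseteq> points (dR (n + k)) \<inter> p i -` \<phi> i ` (U i \<inter> U j)"
      using Phi_in[OF ij(1)] p_Phi[OF ij(1)] by (auto simp: points_std_euclid)
  qed
  show "F i j (\<Phi> i u) = \<Phi> j u" if "i \<in> I" "j \<in> I" "u \<in> over (U i) \<inter> over (U j)" for i j u
    by (rule F_Phi[OF that])
qed

lemma euclid_sel:
  "total (euclid_pbundle n k q) = dR (n + k)" "base (euclid_pbundle n k q) = dR n"
  "proj (euclid_pbundle n k q) = q"
  "fib_add (euclid_pbundle n k q) = (\<lambda>w w'. juxt n (hd_part n w) (\<lambda>a. tl_part n w a + tl_part n w' a))"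
  "fib_scale (euclid_pbundle n k q) = (\<lambda>r w. juxt n (hd_part n w) (\<lambda>a. r * tl_part n w a))"
  "fib_zero (euclid_pbundle n k q) = (\<lambda>y. juxt n y (\<lambda>_. 0))"
  by (simp_all add: euclid_pbundle_def std_pbundle_def)

lemma std_sel:
  "total (std_pbundle E M \<pi> pls scl zer) = dE" "base (std_pbundle E M \<pi> pls scl zer) = dM"
  "proj (std_pbundle E M \<pi> pls scl zer) = \<pi>" "fib_add (std_pbundle E M \<pi> pls scl zer) = pls"
  "fib_scale (std_pbundle E M \<pi> pls scl zer) = scl" "fib_zero (std_pbundle E M \<pi> pls scl zer) = zer"
  by (simp_all add: std_pbundle_def)

text \<open>The coordinates \<open>\<Phi> i\<close> are linear on fibres.\<close>
lemma Phi_pls: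
  assumes i: "i \<in> I" and u: "u \<in> over (U i)" and v: "v \<in> mset_of E" "\<pi> v = \<pi> u"
  shows "fib_add (euclid_pbundle n k q) (\<Phi> i u) (\<Phi> i v) = \<Phi> i (pls u v)" "pls u v \<in> over (U i)"
proof -
  have "pls u v \<in> mset_of E \<and> \<pi> (pls u v) = \<pi> u" using pls_in v u by simp
  then show "fib_add (euclid_pbundle n k q) (\<Phi> i u) (\<Phi> i v) = \<Phi> i (pls u v)" "pls u v \<in> over (U i)"
    using triv_pls[OF psi[OF i] u v] u unfolding euclid_sel hd_Phi[OF i u] tl_Phi
    by (simp_all add: \<Phi>_def)
qed

lemma Phi_scl:
  assumes i: "i \<in> I" and u: "u \<in> over (U i)"
  shows "fib_scale (euclid_pbundle n k q) r (\<Phi> i u) = \<Phi> i (scl r u)" "scl r u \<in> over (U i)"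
proof -
  have "scl r u \<in> mset_of E \<and> \<pi> (scl r u) = \<pi> u" using scl_in u by simp
  then show "fib_scale (euclid_pbundle n k q) r (\<Phi> i u) = \<Phi> i (scl r u)" "scl r u \<in> over (U i)"
    using triv_scl[OF psi[OF i] u] u unfolding euclid_sel hd_Phi[OF i u] tl_Phi
    by (simp_all add: \<Phi>_def)
qed

lemma Phi_zer:
  assumes i: "i \<in> I" and x: "x \<in> U i"
  shows "fib_zero (euclid_pbundle n k q) (\<phi> i x) = \<Phi> i (zer x)" "zer x \<in> over (U i)"
proof -
  have "zer x \<in> mset_of E \<and> \<pi> (zer x) = x" using zer_in x U_subset[OF i] by blast
  then show "fib_zero (euclid_pbundle n k q) (\<phi> i x) = \<Phi> i (zer x)" "zer x \<in> over (U i)"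
    using triv_zer[OF psi[OF i] x] x unfolding euclid_sel by (simp_all add: \<Phi>_def)
qed

text \<open>Every point at which a lift is defined is \<open>\<Phi>\<^sub>i(u)\<close> for some \<open>u\<close> over \<open>U\<^sub>i \<inter> U\<^sub>j\<close>, and the lift carries it to
  \<open>\<Phi>\<^sub>j(u)\<close>; so it inherits all properties from the operations of \<open>E\<close>.\<close>
lemma gluing_maps_atlas:
  assumes ij: "i \<in> I" "j \<in> I"
  shows "gluing_maps (euclid_pbundle n k (p i)) (euclid_pbundle n k (p j))
    (\<phi> i ` (U i \<inter> U j)) (F i j) (f i j)"
proof -
  have ov: "\<exists>u. w = \<Phi> i u \<and> u \<in> over (U i) \<and> u \<in> over (U j)"
    if "w \<in> points (dR (n + k)) \<inter> p i -` \<phi> i ` (U i \<inter> U j)" for w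
    using that unfolding T.overlap[OF ij] by blast
  have fib: "\<exists>v. w = \<Phi> i v \<and> v \<in> mset_of E \<and> \<pi> v = \<pi> u"
    if w: "w \<in> points (dR (n + k))" and u: "u \<in> over (U i)" and eq: "p i w = p i (\<Phi> i u)" for w u
  proof -
    obtain v where v: "v \<in> over (U i)" "w = \<Phi> i v"
      using w Phi_bij[OF ij(1)] by (auto simp: points_std_euclid bij_betw_def)
    then have "\<phi> i (\<pi> v) = \<phi> i (\<pi> u)" using eq p_Phi[OF ij(1)] u by simp
    then have "\<pi> v = \<pi> u" by (rule phi_inj[OF ij(1), rotated 2]) (use u v(1) in auto)
    with v show ?thesis by blast
  qed
  show ?thesis
    unfolding gluing_maps_def euclid_sel(1-3)
  proof (intro conjI ballI allI impI)
    show "\<phi> i ` (U i \<inter> U j) \<subseteq> points (dR n)"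
      using phi_in[OF ij(1)] by (auto simp: points_std_euclid)
    show "dsmooth (sub_dspace (dR n) (\<phi> i ` (U i \<inter> U j))) (dR n) (f i j)"
      by (rule B.transition_smooth[OF ij])
    show "dsmooth (sub_dspace (dR (n + k)) (p i -` \<phi> i ` (U i \<inter> U j))) (dR (n + k)) (F i j)"
      by (rule T.transition_smooth[OF ij])
    fix w assume "w \<in> points (dR (n + k)) \<inter> p i -` \<phi> i ` (U i \<inter> U j)"
    from ov[OF this] obtain u where u: "w = \<Phi> i u" "u \<in> over (U i)" "u \<in> over (U j)" by blast
    have Fu: "F i j w = \<Phi> j u" using F_Phi[OF ij] u by simp
    show "p j (F i j w) = f i j (p i w)"
      using Fu p_Phi[OF ij(1) u(2)] p_Phi[OF ij(2) u(3)] f_phi[OF ij, of "\<pi> u"] u by simp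
    show "F i j (fib_scale (euclid_pbundle n k (p i)) r w) = fib_scale (euclid_pbundle n k (p j)) r (F i j w)"
      for r
      unfolding Fu unfolding u(1) Phi_scl(1)[OF ij(1) u(2)] Phi_scl(1)[OF ij(2) u(3)]
      using F_Phi[OF ij] Phi_scl(2)[OF ij(1) u(2)] Phi_scl(2)[OF ij(2) u(3)] by blast
    fix w' assume w': "w' \<in> points (dR (n + k))" "p i w' = p i w"
    then obtain v where v: "w' = \<Phi> i v" "v \<in> mset_of E" "\<pi> v = \<pi> u"
      using fib[OF w'(1) u(2)] u(1) by blast
    then have "F i j w' = \<Phi> j v" using F_Phi[OF ij, of v] u by simp
    then show "F i j (fib_add (euclid_pbundle n k (p i)) w w') =
        fib_add (euclid_pbundle n k (p j)) (F i j w) (F i j w')"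
      using F_Phi[OF ij] Phi_pls[OF ij(1) u(2) v(2,3)] Phi_pls[OF ij(2) u(3) v(2,3)] Fu u(1) v(1)
      by simp
  qed
qed

abbreviation "glued_bundle \<equiv>
  glue_pbundles I (\<lambda>i. euclid_pbundle n k (p i)) (\<lambda>i j. \<phi> i ` (U i \<inter> U j)) F f"

lemma glued_sel:
  "total glued_bundle = T.glued" "base glued_bundle = B.glued"
  "proj glued_bundle = (\<lambda>C. B.gl `` {(i, p i w) |i w. (i, w) \<in> C})"
  "fib_add glued_bundle = (\<lambda>C C'. T.gl `` {(i, fib_add (euclid_pbundle n k (p i)) w w') |i w w'.
     (i, w) \<in> C \<and> (i, w') \<in> C' \<and> p i w = p i w'})"
  "fib_scale glued_bundle = (\<lambda>r C. T.gl `` {(i, fib_scale (euclid_pbundle n k (p i)) r w) |i w. (i, w) \<in> C})"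
  "fib_zero glued_bundle = (\<lambda>c. T.gl `` {(i, fib_zero (euclid_pbundle n k (p i)) y) |i y. (i, y) \<in> c})"
  by (simp_all add: glue_pbundles_def Let_def euclid_sel(1-3) T.glued_def B.glued_def T.gl_def B.gl_def)

lemma T_repsE:
  assumes "(i, w) \<in> T.reps u" obtains "i \<in> I" "u \<in> over (U i)" "w = \<Phi> i u"
  using assms by (auto simp: T.reps_def)

lemma some_chart:
  assumes "x \<in> mset_of M" obtains i where "i \<in> I" "x \<in> U i"
  using assms cover by blast

text \<open>The induced structure of the glued bundle is evaluated on the representatives that the charts
  provide; all of them stand for one and the same point of \<open>E\<close> or \<open>M\<close>.\<close>
lemma reps_proj:
  assumes u: "u \<in> mset_of E"
  shows "proj glued_bundle (T.reps u) = B.reps (\<pi> u)"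
  unfolding glued_sel
proof (rule B.gl_class)
  show "\<pi> u \<in> points dM" using pi_in[OF u] by (simp add: points_std_dspace)
  obtain i where i: "i \<in> I" "\<pi> u \<in> U i" using some_chart[OF pi_in[OF u]] .
  then have "(i, \<Phi> i u) \<in> T.reps u" using u by (auto simp: T.reps_def)
  then show "{(i, p i w) |i w. (i, w) \<in> T.reps u} \<noteq> {}" by blast
  show "{(i, p i w) |i w. (i, w) \<in> T.reps u} \<subseteq> B.reps (\<pi> u)"
    using p_Phi by (auto simp: B.reps_def elim!: T_repsE)
qed

lemma reps_add:
  assumes u: "u \<in> mset_of E" and v: "v \<in> mset_of E" "\<pi> u = \<pi> v"
  shows "T.reps (pls u v) = fib_add glued_bundle (T.reps u) (T.reps v)"
  unfolding glued_sel
proof (rule T.gl_class[symmetric])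
  note vu = v(2)[symmetric]
  let ?S = "{(i, fib_add (euclid_pbundle n k (p i)) w w') |i w w'.
     (i, w) \<in> T.reps u \<and> (i, w') \<in> T.reps v \<and> p i w = p i w'}"
  show "pls u v \<in> points dE" using pls_in[OF u v(1) vu] by (simp add: points_std_dspace)
  obtain i where i: "i \<in> I" "\<pi> u \<in> U i" using some_chart[OF pi_in[OF u]] .
  then have "(i, \<Phi> i u) \<in> T.reps u" "(i, \<Phi> i v) \<in> T.reps v" "p i (\<Phi> i u) = p i (\<Phi> i v)"
    using u v p_Phi by (auto simp: T.reps_def)
  then show "?S \<noteq> {}" by blast
  show "?S \<subseteq> T.reps (pls u v)"
  proof
    fix s assume "s \<in> ?S"
    then obtain i w w' where s: "s = (i, fib_add (euclid_pbundle n k (p i)) w w')"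
        "(i, w) \<in> T.reps u" "(i, w') \<in> T.reps v" by blast
    then have i: "i \<in> I" "u \<in> over (U i)" "w = \<Phi> i u" "w' = \<Phi> i v" by (auto elim!: T_repsE)
    then show "s \<in> T.reps (pls u v)"
      using Phi_pls[OF i(1,2) v(1) vu] s(1) by (auto simp: T.reps_def)
  qed
qed

lemma reps_scale:
  assumes u: "u \<in> mset_of E"
  shows "T.reps (scl r u) = fib_scale glued_bundle r (T.reps u)"
  unfolding glued_sel
proof (rule T.gl_class[symmetric])
  let ?S = "{(i, fib_scale (euclid_pbundle n k (p i)) r w) |i w. (i, w) \<in> T.reps u}"
  show "scl r u \<in> points dE" using scl_in[OF u] by (simp add: points_std_dspace)
  obtain i where i: "i \<in> I" "\<pi> u \<in> U i" using some_chart[OF pi_in[OF u]] .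
  then have "(i, \<Phi> i u) \<in> T.reps u" using u by (auto simp: T.reps_def)
  then show "?S \<noteq> {}" by blast
  show "?S \<subseteq> T.reps (scl r u)"
  proof
    fix s assume "s \<in> ?S"
    then obtain i w where s: "s = (i, fib_scale (euclid_pbundle n k (p i)) r w)"
        "(i, w) \<in> T.reps u" by blast
    then have i: "i \<in> I" "u \<in> over (U i)" "w = \<Phi> i u" by (auto elim!: T_repsE)
    then show "s \<in> T.reps (scl r u)"
      using Phi_scl[OF i(1,2)] s(1) by (auto simp: T.reps_def)
  qed
qed

lemma reps_zero:
  assumes x: "x \<in> mset_of M"
  shows "fib_zero glued_bundle (B.reps x) = T.reps (zer x)"
  unfolding glued_sel
proof (rule T.gl_class)
  let ?S = "{(i, fib_zero (euclid_pbundle n k (p i)) y) |i y. (i, y) \<in> B.reps x}"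
  show "zer x \<in> points dE" using zer_in[OF x] by (simp add: points_std_dspace)
  obtain i where i: "i \<in> I" "x \<in> U i" using some_chart[OF x] .
  then have "(i, \<phi> i x) \<in> B.reps x" by (auto simp: B.reps_def)
  then show "?S \<noteq> {}" by blast
  show "?S \<subseteq> T.reps (zer x)"
  proof
    fix s assume "s \<in> ?S"
    then obtain i where i: "i \<in> I" "x \<in> U i" "s = (i, fib_zero (euclid_pbundle n k (p i)) (\<phi> i x))"
      by (auto simp: B.reps_def)
    then show "s \<in> T.reps (zer x)"
      using Phi_zer[OF i(1,2)] by (auto simp: T.reps_def)
  qed
qed

lemma iso_reps: "pbundle_iso (std_pbundle E M \<pi> pls scl zer) glued_bundle T.reps B.reps"
  unfolding pbundle_iso_def std_sel glued_sel(1,2)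
  using T.ddiffeo_reps B.ddiffeo_reps reps_proj reps_add reps_scale
  by (simp add: points_std_dspace)

lemma pseudo_bundle_glued: "pseudo_bundle glued_bundle"
  by (rule pseudo_bundle_iso[OF pseudo_bundle_std iso_reps])
    (simp_all add: std_sel glued_sel(1,2) T.diffeological_glued B.diffeological_glued reps_zero points_std_dspace)

end

theorem theorem3p3:
  fixes E :: "'e mfd" and M :: "'b mfd" and \<pi> :: "'e \<Rightarrow> 'b"
    and pls :: "'e \<Rightarrow> 'e \<Rightarrow> 'e" and scl :: "real \<Rightarrow> 'e \<Rightarrow> 'e" and zer :: "'b \<Rightarrow> 'e"
    and n k m :: nat
    and U :: "nat \<Rightarrow> 'b set" and \<phi> :: "nat \<Rightarrow> 'b \<Rightarrow> rvec" and \<psi> :: "nat \<Rightarrow> 'e \<Rightarrow> 'b \<times> rvec"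
    and g :: "nat \<Rightarrow> nat \<Rightarrow> 'b \<Rightarrow> real mat"
    and p :: "nat \<Rightarrow> rvec \<Rightarrow> rvec"
    and f F :: "nat \<Rightarrow> nat \<Rightarrow> rvec \<Rightarrow> rvec"
  assumes vbundle: "smooth_vector_bundle k E M \<pi> pls scl zer"
    and dim: "mdim M = n"
    and cover: "mset_of M = (\<Union>i\<in>{1..m}. U i)"
    and U_open: "\<forall>i\<in>{1..m}. openin (mtop M) (U i)"
    and \<phi>_diffeo: "\<forall>i\<in>{1..m}. mfd_diffeo (open_submfd M (U i)) (euclid_mfd n) (\<phi> i)"
    and \<psi>_triv: "\<forall>i\<in>{1..m}. local_triv k E M \<pi> pls scl (U i) (\<psi> i)"
    and g_GL: "\<forall>i\<in>{1..m}. \<forall>j\<in>{1..m}. \<forall>x \<in> U i \<inter> U j. g i j x \<in> GL k"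
    and g_trans: "\<forall>i\<in>{1..m}. \<forall>j\<in>{1..m}. \<forall>x \<in> U i \<inter> U j. \<forall>v \<in> Rn k.
        \<psi> j (inv_into (mset_of E \<inter> \<pi> -` U i) (\<psi> i) (x, v)) = (x, mat_act k (g i j x) v)"
    and p_eq: "\<forall>i\<in>{1..m}. \<forall>y \<in> Rn n. \<forall>v \<in> Rn k.
        p i (juxt n y v) =
          \<phi> i (\<pi> (inv_into (mset_of E \<inter> \<pi> -` U i) (\<psi> i) (inv_into (U i) (\<phi> i) y, v)))"
    and f_eq: "\<forall>i\<in>{1..m}. \<forall>j\<in>{1..m}. \<forall>y \<in> \<phi> i ` (U i \<inter> U j).
        f i j y = \<phi> j (inv_into (U i \<inter> U j) (\<phi> i) y)"
    and F_eq: "\<forall>i\<in>{1..m}. \<forall>j\<in>{1..m}. \<forall>y \<in> \<phi> i ` (U i \<inter> U j). \<forall>v \<in> Rn k.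
        F i j (juxt n y v) = juxt n (f i j y) (mat_act k (g i j (inv_into (U i) (\<phi> i) y)) v)"
  shows "pseudo_bundle (std_pbundle E M \<pi> pls scl zer) \<and>
    (\<forall>i\<in>{1..m}. pseudo_bundle (euclid_pbundle n k (p i))) \<and>
    (\<forall>i\<in>{1..m}. \<forall>j\<in>{1..m}.
        gluing_maps (euclid_pbundle n k (p i)) (euclid_pbundle n k (p j))
          (\<phi> i ` (U i \<inter> U j)) (F i j) (f i j)) \<and>
    pseudo_bundle
      (glue_pbundles {1..m} (\<lambda>i. euclid_pbundle n k (p i)) (\<lambda>i j. \<phi> i ` (U i \<inter> U j)) F f) \<and>
    pbundles_isomorphic (std_pbundle E M \<pi> pls scl zer)
      (glue_pbundles {1..m} (\<lambda>i. euclid_pbundle n k (p i)) (\<lambda>i j. \<phi> i ` (U i \<inter> U j)) F f)"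
proof -
  interpret vector_bundle k E M \<pi> pls scl zer
    by unfold_locales (rule vbundle)
  interpret bundle_atlas k E M \<pi> pls scl zer n "{1..m}" U \<phi> \<psi> g p f F
    by unfold_locales (simp_all only: cover \<phi>_diffeo \<psi>_triv g_trans p_eq f_eq F_eq)
  show ?thesis
  proof (intro conjI ballI)
    show "pseudo_bundle (std_pbundle E M \<pi> pls scl zer)" by (rule pseudo_bundle_std)
    show "pseudo_bundle (euclid_pbundle n k (p i))" if "i \<in> {1..m}" for i
      by (rule pseudo_bundle_euclid[OF p_hd_part[OF that]])
    show "gluing_maps (euclid_pbundle n k (p i)) (euclid_pbundle n k (p j))
        (\<phi> i ` (U i \<inter> U j)) (F i j) (f i j)" if "i \<in> {1..m}" "j \<in> {1..m}" for i j
      by (rule gluing_maps_atlas[OF that])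
    show "pseudo_bundle glued_bundle" by (rule pseudo_bundle_glued)
    show "pbundles_isomorphic (std_pbundle E M \<pi> pls scl zer) glued_bundle"
      unfolding pbundles_isomorphic_def using iso_reps by blast
  qed
qed

end
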